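(* Let $I$ be the ideal of a configuration of points in $\mathbb{P}^2$ such that $\mathrm{reg}(I)=\alpha(I)$. Then for every integer $m\ge1$ the ordinary power $I^m$ has a linear free resolution.
   Context: $\mathbb{K}$ is an algebraically closed field and $R=\mathbb{K}[\mathbb{P}^2]=\mathbb{K}[x_0,x_1,x_2]$ is the coordinate ring of the projective plane over $\mathbb{K}$. A configuration of points is a finite set of reduced points in $\mathbb{P}^2$; its ideal is the radical homogeneous ideal generated by all forms vanishing at every point of the set. $\alpha(I)$, the initial degree, is the least degree of a nonzero polynomial in $I$. $\mathrm{reg}(I)$ is the Castelnuovo–Mumford regularity: if $0\to F_r\to\dots\to F_0\to I\to 0$ is a minimal graded free resolution of $I$ over $R$ and $f_j$ is the maximum degree of the generators of $F_j$, then $\mathrm{reg}(I)=\max\{f_j-j\mid j\ge 0\}$. A homogeneous ideal $J$ has a linear free resolution if there is an integer $k$ such that, in its minimal graded free resolution, all generators of the $j$-th free module $F_j$ have degree $k+j$ for every $j\ge 0$. *)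

theory Defs
  imports
    "HOL-Library.Poly_Mapping"
    "HOL-Library.Numeral_Type"
    "HOL-Computational_Algebra.Polynomial"
    "Jordan_Normal_Form.Matrix_Kernel"
begin

text \<open>
  The coordinate ring $K[x_0,x_1,x_2]$: monomials are exponent vectors indexed by the
  three-element type \<^typ>\<open>3\<close>.
\<close>

type_synonym 'k poly3 = "(3 \<Rightarrow>\<^sub>0 nat) \<Rightarrow>\<^sub>0 'k"

definition mon_deg :: "(3 \<Rightarrow>\<^sub>0 nat) \<Rightarrow> nat" where
  "mon_deg t = (\<Sum>i\<in>UNIV. Poly_Mapping.lookup t i)"

definition total_degree :: "'k::zero poly3 \<Rightarrow> nat" where
  "total_degree f = Max (insert 0 (mon_deg ` Poly_Mapping.keys f))"

text \<open>
  Zero is homogeneous of every degree. The degree is an integer because it occurs below as a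
  difference of shifts; in negative degrees only zero is homogeneous.
\<close>

definition homogeneous :: "int \<Rightarrow> 'k::zero poly3 \<Rightarrow> bool" where
  "homogeneous d f \<longleftrightarrow> (\<forall>t\<in>Poly_Mapping.keys f. int (mon_deg t) = d)"

definition eval3 :: "'k::comm_semiring_1 poly3 \<Rightarrow> (3 \<Rightarrow> 'k) \<Rightarrow> 'k" where
  "eval3 f v = (\<Sum>t\<in>Poly_Mapping.keys f. Poly_Mapping.lookup f t * (\<Prod>i\<in>UNIV. v i ^ Poly_Mapping.lookup t i))"

text \<open>
  The ideal generated by a set is its span in the ring regarded as a module over itself.
  The qualifier selects the type-class module, not the record-based one.
\<close>

abbreviation ideal_gen :: "'a::comm_ring_1 set \<Rightarrow> 'a set" where
  "ideal_gen \<equiv> Modules.module.span (*)"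

lemma module_times: "Modules.module ((*) :: 'a::comm_ring_1 \<Rightarrow> 'a \<Rightarrow> 'a)"
  by unfold_locales (auto simp: algebra_simps)

definition ideal_mult :: "'a::comm_ring_1 set \<Rightarrow> 'a set \<Rightarrow> 'a set" where
  "ideal_mult I J = ideal_gen {f * g | f g. f \<in> I \<and> g \<in> J}"

primrec ideal_power :: "'a::comm_ring_1 set \<Rightarrow> nat \<Rightarrow> 'a set" where
  "ideal_power I 0 = UNIV"
| "ideal_power I (Suc m) = ideal_mult I (ideal_power I m)"

definition irrelevant_ideal :: "'k::comm_ring_1 poly3 set" where
  "irrelevant_ideal = ideal_gen {Poly_Mapping.single (Poly_Mapping.single i 1) 1 | i. True}"


text \<open>A point of the projective plane is the set of all its homogeneous coordinate vectors.\<close>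

definition proj_rel :: "((3 \<Rightarrow> 'k::field) \<times> (3 \<Rightarrow> 'k)) set" where
  "proj_rel = {(u, v). u \<noteq> (\<lambda>_. 0) \<and> v \<noteq> (\<lambda>_. 0) \<and> (\<exists>c. c \<noteq> 0 \<and> v = (\<lambda>i. c * u i))}"

definition proj_plane :: "(3 \<Rightarrow> 'k::field) set set" where
  "proj_plane = {v. v \<noteq> (\<lambda>_. 0)} // proj_rel"

lemma equiv_proj_rel: "equiv {v. v \<noteq> (\<lambda>_. 0)} (proj_rel :: ((3 \<Rightarrow> 'k::field) \<times> _) set)"
proof (rule equivI)
  show "refl_on {v. v \<noteq> (\<lambda>_. 0)} (proj_rel :: ((3 \<Rightarrow> 'k) \<times> _) set)"
    by (auto simp: refl_on_def proj_rel_def intro!: exI[of _ 1])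
  show "sym (proj_rel :: ((3 \<Rightarrow> 'k) \<times> _) set)"
  proof (rule symI)
    fix u v :: "3 \<Rightarrow> 'k" assume "(u, v) \<in> proj_rel"
    then obtain c where "c \<noteq> 0" "v = (\<lambda>i. c * u i)" "u \<noteq> (\<lambda>_. 0)" "v \<noteq> (\<lambda>_. 0)"
      by (auto simp: proj_rel_def)
    moreover from this have "u = (\<lambda>i. inverse c * v i)" by (auto simp: field_simps)
    ultimately show "(v, u) \<in> proj_rel"
      unfolding proj_rel_def using nonzero_imp_inverse_nonzero by blast
  qed
  show "trans (proj_rel :: ((3 \<Rightarrow> 'k) \<times> _) set)"
  proof (rule transI)
    fix u v w :: "3 \<Rightarrow> 'k" assume "(u, v) \<in> proj_rel" "(v, w) \<in> proj_rel"
    then obtain c d where "c \<noteq> 0" "v = (\<lambda>i. c * u i)" "d \<noteq> 0" "w = (\<lambda>i. d * v i)"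
      and "u \<noteq> (\<lambda>_. 0)" "w \<noteq> (\<lambda>_. 0)"
      by (auto simp: proj_rel_def)
    moreover from this have "d * c \<noteq> 0" "w = (\<lambda>i. (d * c) * u i)" by (auto simp: algebra_simps)
    ultimately show "(u, w) \<in> proj_rel" unfolding proj_rel_def by blast
  qed
qed (auto simp: proj_rel_def)

definition ideal_of_points :: "(3 \<Rightarrow> 'k::field) set set \<Rightarrow> 'k poly3 set" where
  "ideal_of_points Z =
     ideal_gen {f. (\<exists>d. homogeneous d f) \<and> (\<forall>P\<in>Z. \<forall>v\<in>P. eval3 f v = 0)}"

definition initial_degree :: "'k::zero poly3 set \<Rightarrow> nat" where
  "initial_degree I = (LEAST d. \<exists>f\<in>I. f \<noteq> 0 \<and> total_degree f = d)"


text \<open>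
  A graded complex of free modules is given by the lists \<open>sh j\<close> of degrees of the basis of
  $F_j$ (so $F_j = \bigoplus_i R(-\mathtt{sh}\,j\,!\,i)$) and by the matrices of its maps:
  \<open>\<phi> 0\<close> is the augmentation $F_0 \to R$ and \<open>\<phi> (Suc j)\<close> is the map
  $F_{j+1} \to F_j$. Thus \<open>target_shifts sh j\<close> lists the degrees of the basis of the
  codomain of \<open>\<phi> j\<close>.
\<close>

primrec target_shifts :: "(nat \<Rightarrow> int list) \<Rightarrow> nat \<Rightarrow> int list" where
  "target_shifts sh 0 = [0]"
| "target_shifts sh (Suc j) = sh j"

definition mat_image :: "'a::comm_ring_1 mat \<Rightarrow> 'a vec set" where
  "mat_image A = {A *\<^sub>v w | w. w \<in> carrier_vec (dim_col A)}"

definition graded_free_resolution ::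
    "'k::field poly3 set \<Rightarrow> (nat \<Rightarrow> int list) \<Rightarrow> (nat \<Rightarrow> 'k poly3 mat) \<Rightarrow> bool" where
  "graded_free_resolution I sh \<phi> \<longleftrightarrow>
     (\<exists>r. \<forall>j>r. sh j = []) \<and>
     (\<forall>j. \<phi> j \<in> carrier_mat (length (target_shifts sh j)) (length (sh j))) \<and>
     (\<forall>j. \<forall>a<length (target_shifts sh j). \<forall>b<length (sh j).
        homogeneous (sh j ! b - target_shifts sh j ! a) (\<phi> j $$ (a, b))) \<and>
     mat_image (\<phi> 0) = {vec 1 (\<lambda>_. f) | f. f \<in> I} \<and>
     (\<forall>j. mat_image (\<phi> (Suc j)) = mat_kernel (\<phi> j))"

text \<open>
  Minimality means that $F_{j+1}$ is mapped into $\mathfrak{m}F_j$, where $\mathfrak{m}$ is the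
  irrelevant ideal. There is no such condition on the augmentation \<open>\<phi> 0\<close>.
\<close>

definition minimal_graded_free_resolution ::
    "'k::field poly3 set \<Rightarrow> (nat \<Rightarrow> int list) \<Rightarrow> (nat \<Rightarrow> 'k poly3 mat) \<Rightarrow> bool" where
  "minimal_graded_free_resolution I sh \<phi> \<longleftrightarrow>
     graded_free_resolution I sh \<phi> \<and>
     (\<forall>j. \<forall>a<length (sh j). \<forall>b<length (sh (Suc j)). \<phi> (Suc j) $$ (a, b) \<in> irrelevant_ideal)"

text \<open>
  The maximum is over the nonzero $F_j$ only. A nonzero homogeneous ideal has a minimal graded
  free resolution, and any two are isomorphic, so the value does not depend on the one chosen.
  For the zero ideal the value is unspecified.
\<close>

definition regularity :: "'k::field poly3 set \<Rightarrow> int" where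
  "regularity I =
     (let sh = (SOME sh. \<exists>\<phi>. minimal_graded_free_resolution I sh \<phi>)
      in Max {Max (set (sh j)) - int j | j. sh j \<noteq> []})"

definition has_linear_resolution :: "'k::field poly3 set \<Rightarrow> bool" where
  "has_linear_resolution J \<longleftrightarrow>
     (\<exists>k sh \<phi>. minimal_graded_free_resolution J sh \<phi> \<and>
        (\<forall>j. \<forall>d\<in>set (sh j). d = k + int j))"

end

theory Submission
  imports Defs "HOL-Library.Function_Algebras"
begin

text \<open>
  Choose a linear form \<open>h\<close> that vanishes at no point of \<open>Z\<close>, and complete it by \<open>y\<close>, \<open>z\<close> to a
  coordinate system. Then \<open>h\<close> is a nonzerodivisor modulo \<open>I\<close>, and the residue ring modulo \<open>h\<close> is
  the ring of binary forms \<open>K[y,z]\<close>. Everything is computed there and lifted back: a graded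
  complex of free modules that is exact modulo \<open>h\<close> is exact, because an element of the kernel
  can be corrected by an image until it is divisible by \<open>h\<close>, and the quotient is again in the
  kernel and has smaller degree (\<open>lift_exact\<close>).

  Regularity is defined through a chosen minimal resolution, so one has to exist
  (\<open>minimal_resolution_exists\<close>). The residues of \<open>I\<close> contain powers of \<open>y\<close> and \<open>z\<close>, which gives
  finitely many generators; the syzygies of a minimal system of generators form a free module,
  since they stay saturated modulo \<open>h\<close> and \<open>z\<close>, where only the polynomial ring in \<open>y\<close> is left
  (\<open>syzygies_free\<close>).

  Let \<open>d\<close> be the common value of the regularity and the initial degree. Then \<open>I\<close> is generated in
  degree \<open>d\<close> and its syzygies in degree at most \<open>d + 1\<close>. A socle argument in \<open>K[y,z]\<close> shows that
  all binary forms of degree at least \<open>d\<close> are residues of elements of \<open>I\<close>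
  (\<open>ideal_contains_forms\<close>). As \<open>I\<close> has no elements of degree \<open>d - 1\<close>, the residue map is injective
  on \<open>I\<close> in degree \<open>d\<close>. So \<open>I\<close> is generated by unique lifts \<open>f i\<close> of the monomials
  \<open>y^i z^(d-i)\<close>, and \<open>z f(i+1) - y f(i)\<close> is \<open>h\<close> times a linear combination of these lifts.

  Put \<open>J = I^m\<close> and \<open>k = d m\<close>. The products of \<open>m\<close> of the \<open>f i\<close> span \<open>J\<close> in degree \<open>k\<close>, and such a
  product lifts \<open>y^w z^(k-w)\<close>, where \<open>w\<close> is the sum of its indices. Two products of the same
  weight \<open>w\<close> are connected by exchanges that raise one index and lower another one; the relations
  between the \<open>f i\<close> show that \<open>y\<close> and \<open>z\<close> multiply the difference into \<open>h J\<close>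
  (\<open>same_weight_torsion\<close>). Hence \<open>J / h J\<close> is the direct sum of the ideal \<open>(y,z)^k\<close> and of copies
  of the residue field in degree \<open>k\<close>. The first summand is resolved by the relations between
  neighbouring monomials and the others by Koszul complexes, so both resolutions are linear, and
  they lift to a linear resolution of \<open>J\<close> (\<open>linear_resolution\<close>).
\<close>

section \<open>Homogeneous components and evaluation\<close>

abbreviation const_poly :: "'k::zero \<Rightarrow> 'k poly3" where
  "const_poly c \<equiv> Poly_Mapping.single 0 c"

text \<open>
  The exponent is in the form to which the simplifier rewrites the number one.
\<close>

abbreviation coord :: "3 \<Rightarrow> 'k::zero_neq_one poly3" where
  "coord i \<equiv> Poly_Mapping.single (Poly_Mapping.single i (Suc 0)) 1"

lemma mon_deg_add: "mon_deg (s + t) = mon_deg s + mon_deg t"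
  by (simp add: mon_deg_def lookup_add sum.distrib)

lemma mon_deg_zero [simp]: "mon_deg 0 = 0"
  by (simp add: mon_deg_def)

lemma mon_deg_single [simp]: "mon_deg (Poly_Mapping.single i n) = n"
  by (simp add: mon_deg_def lookup_single when_def)

lemma mon_deg_eq_0_iff: "mon_deg t = 0 \<longleftrightarrow> t = 0"
proof
  assume "mon_deg t = 0"
  then show "t = 0" by (intro poly_mapping_eqI) (simp add: mon_deg_def)
qed simp

lemma homogeneous_iff: "homogeneous d f \<longleftrightarrow> (\<forall>t. Poly_Mapping.lookup f t \<noteq> 0 \<longrightarrow> int (mon_deg t) = d)"
  by (auto simp: homogeneous_def in_keys_iff)

lemma homogeneous_0 [simp]: "homogeneous d 0"
  by (simp add: homogeneous_def)

lemma homogeneous_add: "homogeneous d f \<Longrightarrow> homogeneous d g \<Longrightarrow> homogeneous d (f + g)"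
  for f :: "'k::comm_ring_1 poly3"
  unfolding homogeneous_iff lookup_add by (metis add_0)

lemma homogeneous_uminus: "homogeneous d f \<Longrightarrow> homogeneous d (- f)"
  for f :: "'k::comm_ring_1 poly3"
  by (auto simp: homogeneous_iff)

lemma homogeneous_diff: "homogeneous d f \<Longrightarrow> homogeneous d g \<Longrightarrow> homogeneous d (f - g)"
  for f :: "'k::comm_ring_1 poly3"
  by (metis add_uminus_conv_diff homogeneous_add homogeneous_uminus)

lemma homogeneous_sum: "(\<And>i. i \<in> A \<Longrightarrow> homogeneous d (f i)) \<Longrightarrow> homogeneous d (\<Sum>i\<in>A. f i)"
  for f :: "'i \<Rightarrow> 'k::comm_ring_1 poly3"
  by (induction A rule: infinite_finite_induct) (auto intro: homogeneous_add)

lemma homogeneous_mult: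
  fixes f g :: "'k::comm_ring_1 poly3"
  assumes "homogeneous d f" "homogeneous e g" shows "homogeneous (d + e) (f * g)"
  unfolding homogeneous_def
proof
  fix t assume "t \<in> Poly_Mapping.keys (f * g)"
  then obtain a b where "t = a + b" "a \<in> Poly_Mapping.keys f" "b \<in> Poly_Mapping.keys g"
    using keys_mult[of f g] by blast
  then show "int (mon_deg t) = d + e"
    using assms by (auto simp: homogeneous_def mon_deg_add)
qed

lemma homogeneous_mult':
  "homogeneous d f \<Longrightarrow> homogeneous e g \<Longrightarrow> s = d + e \<Longrightarrow> homogeneous s (f * g)"
  for f g :: "'k::comm_ring_1 poly3"
  using homogeneous_mult by blast

lemma homogeneous_const [simp]: "homogeneous 0 (const_poly c)"
  by (auto simp: homogeneous_iff lookup_single when_def)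

lemma homogeneous_1 [simp]: "homogeneous 0 (1 :: 'k::comm_ring_1 poly3)"
  by (metis homogeneous_const single_one)

lemma homogeneous_coord [simp]: "homogeneous 1 (coord i)"
  by (auto simp: homogeneous_iff lookup_single when_def)

lemma homogeneous_power: "homogeneous d f \<Longrightarrow> s = int n * d \<Longrightarrow> homogeneous s (f ^ n)"
  for f :: "'k::comm_ring_1 poly3"
proof (induction n arbitrary: s)
  case (Suc n)
  then show ?case
    using homogeneous_mult[OF Suc.prems(1) Suc.IH[OF Suc.prems(1) refl]] by (simp add: algebra_simps)
qed simp

lemma homogeneous_const_mult: "homogeneous d f \<Longrightarrow> homogeneous d (const_poly c * f)"
  for f :: "'k::comm_ring_1 poly3"
  using homogeneous_mult[OF homogeneous_const[of c]] by simp

lemma homogeneous_neg: "homogeneous d f \<Longrightarrow> d < 0 \<Longrightarrow> f = 0"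
  by (rule poly_mapping_eqI) (force simp: homogeneous_iff)

lemma homogeneous_0_const:
  assumes "homogeneous 0 f" shows "f = const_poly (Poly_Mapping.lookup f 0)"
proof (rule poly_mapping_eqI)
  fix t show "Poly_Mapping.lookup f t = Poly_Mapping.lookup (const_poly (Poly_Mapping.lookup f 0)) t"
    using assms mon_deg_eq_0_iff[of t] by (auto simp: homogeneous_iff lookup_single when_def)
qed

lemma const_poly_mult: "const_poly a * const_poly b = const_poly (a * b)"
  for a :: "'k::comm_ring_1"
  by (simp add: mult_single)

lemma const_poly_inverse: "c \<noteq> 0 \<Longrightarrow> const_poly (inverse c) * const_poly c = 1"
  for c :: "'k::field"
  by (simp add: mult_single)

lemma const_poly_eq_0 [simp]: "const_poly c = 0 \<longleftrightarrow> c = 0"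
  by (metis lookup_single_eq lookup_zero single_zero)


definition component :: "int \<Rightarrow> 'k::comm_ring_1 poly3 \<Rightarrow> 'k poly3" where
  "component d f = (\<Sum>t | t \<in> Poly_Mapping.keys f \<and> int (mon_deg t) = d. Poly_Mapping.single t (Poly_Mapping.lookup f t))"

lemma lookup_component:
  "Poly_Mapping.lookup (component d f) t = (if int (mon_deg t) = d then Poly_Mapping.lookup f t else 0)"
proof -
  have "Poly_Mapping.lookup (component d f) t =
    (\<Sum>s | s \<in> Poly_Mapping.keys f \<and> int (mon_deg s) = d. if s = t then Poly_Mapping.lookup f s else 0)"
    by (simp add: component_def lookup_sum lookup_single when_def)
  also have "\<dots> = (if t \<in> {s. s \<in> Poly_Mapping.keys f \<and> int (mon_deg s) = d} then Poly_Mapping.lookup f t else 0)"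
    by (subst sum.delta) auto
  finally show ?thesis by (auto simp: in_keys_iff)
qed

lemma component_add: "component d (f + g) = component d f + component d g"
  by (rule poly_mapping_eqI) (simp add: lookup_component lookup_add)

lemma component_0 [simp]: "component d 0 = 0"
  by (rule poly_mapping_eqI) (simp add: lookup_component)

lemma component_diff: "component d (f - g) = component d f - component d g"
  by (rule poly_mapping_eqI) (simp add: lookup_component lookup_minus)

lemma component_sum: "component d (\<Sum>i\<in>A. f i) = (\<Sum>i\<in>A. component d (f i))"
  by (induction A rule: infinite_finite_induct) (auto simp: component_add)

lemma homogeneous_component [simp]: "homogeneous d (component d f)"
  by (auto simp: homogeneous_iff lookup_component)

lemma component_homogeneous: "homogeneous e f \<Longrightarrow> component d f = (if d = e then f else 0)"
  by (rule poly_mapping_eqI) (auto simp: homogeneous_iff lookup_component)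

lemma component_same: "homogeneous d f \<Longrightarrow> component d f = f"
  by (simp add: component_homogeneous)

definition degrees :: "'k::comm_ring_1 poly3 \<Rightarrow> int set" where
  "degrees f = (int \<circ> mon_deg) ` Poly_Mapping.keys f"

lemma finite_degrees [simp]: "finite (degrees f)"
  by (simp add: degrees_def)

lemma sum_components:
  assumes "finite D" "degrees f \<subseteq> D" shows "(\<Sum>d\<in>D. component d f) = f"
proof (rule poly_mapping_eqI)
  fix t
  have "Poly_Mapping.lookup (\<Sum>d\<in>D. component d f) t =
     (\<Sum>d\<in>D. if int (mon_deg t) = d then Poly_Mapping.lookup f t else 0)"
    by (simp add: lookup_sum lookup_component)
  also have "\<dots> = (if int (mon_deg t) \<in> D then Poly_Mapping.lookup f t else 0)"
    using assms(1) by (simp add: sum.delta')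
  also have "\<dots> = Poly_Mapping.lookup f t"
    using assms(2) by (auto simp: degrees_def image_subset_iff) (metis in_keys_iff)
  finally show "Poly_Mapping.lookup (\<Sum>d\<in>D. component d f) t = Poly_Mapping.lookup f t" .
qed

text \<open>
  A form shifts the grading when it is multiplied. This is why a linear system with homogeneous
  coefficients that has a solution has a homogeneous one.
\<close>

lemma component_mult_left:
  assumes "homogeneous s f" shows "component t (f * g) = f * component (t - s) g"
proof -
  have "f * g = (\<Sum>d\<in>degrees g. f * component d g)"
    by (simp add: sum_components flip: sum_distrib_left)
  then have "component t (f * g) = (\<Sum>d\<in>degrees g. component t (f * component d g))"
    by (simp add: component_sum)
  also have "\<dots> = (\<Sum>d\<in>degrees g. if d = t - s then f * component d g else 0)"
    using assms by (intro sum.cong refl)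
      (subst component_homogeneous[OF homogeneous_mult[OF assms homogeneous_component]], auto)
  also have "\<dots> = f * component (t - s) g"
  proof (cases "t - s \<in> degrees g")
    case False
    then have "component (t - s) g = 0"
      by (intro poly_mapping_eqI) (auto simp: lookup_component degrees_def image_iff, metis in_keys_iff)
    then show ?thesis by (simp add: sum.delta)
  qed (simp add: sum.delta)
  finally show ?thesis .
qed

lemma homogeneous_dvd_cancel:
  fixes f g :: "'k::field poly3"
  assumes "homogeneous s f" "homogeneous t (f * g)" "f \<noteq> 0"
  shows "homogeneous (t - s) g"
proof -
  have "f * component (t - s) g = f * g"
    using assms by (metis component_mult_left component_same)
  with assms(3) show ?thesis by (metis homogeneous_component mult_cancel_left)
qed

lemma homogeneous_dvdE:
  fixes f g :: "'k::field poly3"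
  assumes "f dvd g" "homogeneous s f" "homogeneous t g" "f \<noteq> 0"
  obtains q where "homogeneous (t - s) q" "g = f * q"
  using assms homogeneous_dvd_cancel by (metis dvdE)


lemma eval3_eq_sum:
  assumes "finite A" "Poly_Mapping.keys f \<subseteq> A"
  shows "eval3 f v = (\<Sum>t\<in>A. Poly_Mapping.lookup f t * (\<Prod>i\<in>UNIV. v i ^ Poly_Mapping.lookup t i))"
  unfolding eval3_def using assms
  by (intro sum.mono_neutral_left) (auto simp: in_keys_iff)

lemma eval3_add: "eval3 (f + g) v = eval3 f v + eval3 g v"
proof -
  let ?A = "Poly_Mapping.keys f \<union> Poly_Mapping.keys g"
  have "Poly_Mapping.keys (f + g) \<subseteq> ?A" by (rule Poly_Mapping.keys_add)
  then show ?thesis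
    using eval3_eq_sum[of ?A f v] eval3_eq_sum[of ?A g v] eval3_eq_sum[of ?A "f + g" v]
    by (simp add: lookup_add sum.distrib algebra_simps)
qed

lemma eval3_0 [simp]: "eval3 0 v = 0"
  by (simp add: eval3_def)

lemma eval3_single: "eval3 (Poly_Mapping.single t c) v = c * (\<Prod>i\<in>UNIV. v i ^ Poly_Mapping.lookup t i)"
  by (cases "c = 0") (auto simp: eval3_def)

lemma eval3_const [simp]: "eval3 (const_poly c) v = c"
  by (simp add: eval3_single)

lemma eval3_1 [simp]: "eval3 1 v = 1"
  by (metis eval3_const single_one)

lemma eval3_coord [simp]: "eval3 (coord i) v = v i"
proof -
  have "(\<Prod>j\<in>UNIV. v j ^ Poly_Mapping.lookup (Poly_Mapping.single i (Suc 0)) j) = (\<Prod>j\<in>UNIV. if j = i then v j else 1)"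
    by (intro prod.cong) (auto simp: lookup_single when_def)
  then show ?thesis by (simp add: eval3_single)
qed

lemma eval3_sum: "eval3 (\<Sum>i\<in>A. f i) v = (\<Sum>i\<in>A. eval3 (f i) v)"
  by (induction A rule: infinite_finite_induct) (auto simp: eval3_add)

lemma sum_monomials: "(\<Sum>t\<in>Poly_Mapping.keys f. Poly_Mapping.single t (Poly_Mapping.lookup f t)) = f"
proof (rule poly_mapping_eqI)
  fix s
  have "Poly_Mapping.lookup (\<Sum>t\<in>Poly_Mapping.keys f. Poly_Mapping.single t (Poly_Mapping.lookup f t)) s
    = (\<Sum>t\<in>Poly_Mapping.keys f. if t = s then Poly_Mapping.lookup f t else 0)"
    by (simp add: lookup_sum lookup_single when_def)
  then show "Poly_Mapping.lookup (\<Sum>t\<in>Poly_Mapping.keys f. Poly_Mapping.single t (Poly_Mapping.lookup f t)) s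
    = Poly_Mapping.lookup f s"
    by (simp add: in_keys_iff)
qed

lemma eval3_mult: "eval3 (f * g) v = eval3 f v * eval3 g v" for f :: "'k::comm_ring_1 poly3"
proof -
  have 1: "f = (\<Sum>t\<in>Poly_Mapping.keys f. Poly_Mapping.single t (Poly_Mapping.lookup f t))" for f :: "'k poly3"
    by (rule sum_monomials[symmetric])
  have "f * g = (\<Sum>s\<in>Poly_Mapping.keys f. \<Sum>t\<in>Poly_Mapping.keys g.
       Poly_Mapping.single (s + t) (Poly_Mapping.lookup f s * Poly_Mapping.lookup g t))"
    by (subst 1[of f], subst 1[of g]) (simp add: sum_product mult_single)
  then have "eval3 (f * g) v = (\<Sum>s\<in>Poly_Mapping.keys f. \<Sum>t\<in>Poly_Mapping.keys g.
       Poly_Mapping.lookup f s * Poly_Mapping.lookup g t * (\<Prod>i\<in>UNIV. v i ^ Poly_Mapping.lookup (s + t) i))"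
    by (simp add: eval3_sum eval3_single)
  also have "\<dots> = eval3 f v * eval3 g v"
    by (simp add: eval3_def sum_product lookup_add power_add prod.distrib algebra_simps)
  finally show ?thesis .
qed

lemma eval3_diff: "eval3 (f - g) v = eval3 f v - eval3 g v" for f :: "'k::comm_ring_1 poly3"
  by (metis add_diff_cancel_right' diff_add_cancel eval3_add)

lemma eval3_power: "eval3 (f ^ n) v = eval3 f v ^ n" for f :: "'k::comm_ring_1 poly3"
  by (induction n) (auto simp: eval3_mult)

lemma eval3_prod: "eval3 (\<Prod>i\<in>A. f i) v = (\<Prod>i\<in>A. eval3 (f i) v)" for f :: "'i \<Rightarrow> 'k::comm_ring_1 poly3"
  by (induction A rule: infinite_finite_induct) (auto simp: eval3_mult)

text \<open>
  Each monomial of positive degree gives up one variable. The lemma serves to recognise elements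
  of the irrelevant ideal and to change coordinates.
\<close>

lemma homogeneous_pos_decomp:
  fixes f :: "'k::comm_ring_1 poly3"
  assumes "homogeneous d f" "d > 0"
  obtains g where "\<And>i. homogeneous (d - 1) (g i)" "f = (\<Sum>i\<in>UNIV. coord i * g i)"
proof -
  have mono: "\<exists>g. (\<forall>i. homogeneous (d - 1) (g i)) \<and> Poly_Mapping.single t c = (\<Sum>i\<in>UNIV. coord i * g i)"
    if t: "int (mon_deg t) = d" for t and c :: 'k
  proof -
    from t assms(2) obtain i where i: "Poly_Mapping.lookup t i > 0"
      unfolding mon_deg_def by (metis gr0I less_irrefl of_nat_0 sum.neutral)
    define s where "s = t - Poly_Mapping.single i 1"
    have ts: "t = Poly_Mapping.single i 1 + s"
      using i by (intro poly_mapping_eqI) (auto simp: s_def lookup_add lookup_minus lookup_single when_def)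
    then have ms: "int (mon_deg s) = d - 1" using t by (simp add: mon_deg_add)
    define g where "g = (\<lambda>j. if j = i then Poly_Mapping.single s c else 0)"
    have "(\<Sum>j\<in>UNIV. coord j * g j) = (\<Sum>j\<in>UNIV. if j = i then coord j * Poly_Mapping.single s c else 0)"
      by (intro sum.cong) (auto simp: g_def)
    also have "\<dots> = coord i * Poly_Mapping.single s c" by simp
    also have "\<dots> = Poly_Mapping.single t c" by (simp add: mult_single ts)
    finally show ?thesis using ms
      by (intro exI[of _ g]) (auto simp: g_def homogeneous_iff lookup_single when_def)
  qed
  let ?m = "\<lambda>t. Poly_Mapping.single t (Poly_Mapping.lookup f t)"
  have "\<forall>t\<in>Poly_Mapping.keys f. \<exists>g. (\<forall>i. homogeneous (d - 1) (g i)) \<and> ?m t = (\<Sum>i\<in>UNIV. coord i * g i)"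
    using assms(1) mono by (auto simp: homogeneous_def)
  from bchoice[OF this] obtain G where
    "\<forall>t\<in>Poly_Mapping.keys f. (\<forall>i. homogeneous (d - 1) (G t i)) \<and> ?m t = (\<Sum>i\<in>UNIV. coord i * G t i)"
    by blast
  then have G: "\<And>t i. t \<in> Poly_Mapping.keys f \<Longrightarrow> homogeneous (d - 1) (G t i)"
    "\<And>t. t \<in> Poly_Mapping.keys f \<Longrightarrow> ?m t = (\<Sum>i\<in>UNIV. coord i * G t i)"
    by blast+
  define g where "g = (\<lambda>i. \<Sum>t\<in>Poly_Mapping.keys f. G t i)"
  have "f = (\<Sum>t\<in>Poly_Mapping.keys f. ?m t)" by (rule sum_monomials[symmetric])
  also have "\<dots> = (\<Sum>t\<in>Poly_Mapping.keys f. \<Sum>i\<in>UNIV. coord i * G t i)"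
    by (intro sum.cong refl G)
  also have "\<dots> = (\<Sum>i\<in>UNIV. coord i * g i)"
    by (subst sum.swap) (simp add: g_def sum_distrib_left)
  finally have "f = (\<Sum>i\<in>UNIV. coord i * g i)" .
  moreover have "homogeneous (d - 1) (g i)" for i
    unfolding g_def by (rule homogeneous_sum) (rule G(1))
  ultimately show thesis using that by blast
qed

interpretation ring: Modules.module "(*) :: 'a::comm_ring_1 \<Rightarrow> 'a \<Rightarrow> 'a"
  by (rule module_times)

text \<open>
  In a ring regarded as a module over itself, this rewrite rule reassociates products to the left
  and loops together with the usual normalisation of products.
\<close>

declare ring.scale_scale [simp del]

lemma homogeneous_pos_irrelevant:
  "homogeneous d f \<Longrightarrow> d > 0 \<Longrightarrow> f \<in> irrelevant_ideal" for f :: "'k::field poly3"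
proof (erule homogeneous_pos_decomp)
  fix g assume f: "f = (\<Sum>i\<in>UNIV. coord i * g i)"
  have "g i * coord i \<in> irrelevant_ideal" for i
    unfolding irrelevant_ideal_def by (intro ring.span_scale ring.span_base) auto
  then show "f \<in> irrelevant_ideal"
    unfolding f irrelevant_ideal_def by (intro ring.span_sum) (simp add: mult.commute)
qed

section \<open>Free resolutions over finite index sets\<close>

lemma ideal_gen_image:
  assumes "finite S"
  shows "ideal_gen (e ` S) = {\<Sum>s\<in>S. e s * x s | x. True}"
proof (rule equalityI; rule subsetI)
  fix f assume "f \<in> ideal_gen (e ` S)"
  then show "f \<in> {\<Sum>s\<in>S. e s * x s | x. True}"
  proof (induction rule: ring.span_induct_alt)
    case base
    then show ?case by (auto intro!: exI[of _ "\<lambda>_. 0"])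
  next
    case (step c g f)
    then obtain s x where s: "s \<in> S" "g = e s" and f: "f = (\<Sum>s\<in>S. e s * x s)" by auto
    have "c * g + f = (\<Sum>r\<in>S. e r * (if r = s then c else 0) + e r * x r)"
      using s assms by (simp add: f sum.distrib if_distrib[of "\<lambda>u. e _ * u"] mult.commute cong: if_cong)
    then show ?case by (auto simp: distrib_left intro!: exI[of _ "\<lambda>r. (if r = s then c else 0) + x r"])
  qed
next
  fix f assume "f \<in> {\<Sum>s\<in>S. e s * x s | x. True}"
  then obtain x where f: "f = (\<Sum>s\<in>S. x s * e s)" by (auto simp: mult.commute)
  show "f \<in> ideal_gen (e ` S)"
    unfolding f by (intro ring.span_sum ring.span_scale ring.span_base) auto
qed

text \<open>
  Basis vectors are indexed below by whatever they stand for, such as generators or relations.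
  Positions in a list only appear in the translation to matrices.
\<close>

definition matrix_on :: "'a list \<Rightarrow> 'b list \<Rightarrow> ('a \<Rightarrow> 'b \<Rightarrow> 'r) \<Rightarrow> 'r mat" where
  "matrix_on as bs A = mat (length as) (length bs) (\<lambda>(i, j). A (as ! i) (bs ! j))"

definition vector_on :: "'b list \<Rightarrow> ('b \<Rightarrow> 'r) \<Rightarrow> 'r vec" where
  "vector_on bs x = vec (length bs) (\<lambda>j. x (bs ! j))"

lemma vector_on_carrier [simp]: "vector_on bs x \<in> carrier_vec (length bs)"
  by (simp add: vector_on_def)

lemma vector_onE:
  assumes "distinct bs" "w \<in> carrier_vec (length bs)"
  obtains x where "w = vector_on bs x"
proof -
  define x where "x = (\<lambda>b. w $ (THE j. j < length bs \<and> bs ! j = b))"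
  have "(THE j. j < length bs \<and> bs ! j = bs ! i) = i" if "i < length bs" for i
    using that assms(1) by (auto simp: nth_eq_iff_index_eq intro!: the_equality)
  then have "w = vector_on bs x"
    using assms(2) by (intro eq_vecI) (auto simp: vector_on_def x_def)
  then show thesis by (rule that)
qed

lemma vector_on_eq_iff: "vector_on bs x = vector_on bs x' \<longleftrightarrow> (\<forall>b\<in>set bs. x b = x' b)"
  by (auto simp: vector_on_def vec_eq_iff all_set_conv_all_nth)

lemma matrix_on_mult_vec:
  fixes A :: "'a \<Rightarrow> 'b \<Rightarrow> 'r::comm_ring_1"
  assumes "distinct bs"
  shows "matrix_on as bs A *\<^sub>v vector_on bs x = vector_on as (\<lambda>a. \<Sum>b\<in>set bs. A a b * x b)"
proof (rule eq_vecI)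
  fix i assume "i < dim_vec (vector_on as (\<lambda>a. \<Sum>b\<in>set bs. A a b * x b))"
  then have i: "i < length as" by (simp add: vector_on_def)
  have "(matrix_on as bs A *\<^sub>v vector_on bs x) $ i
    = (\<Sum>j<length bs. A (as ! i) (bs ! j) * x (bs ! j))"
    using i by (simp add: matrix_on_def vector_on_def scalar_prod_def atLeast0LessThan)
  also have "\<dots> = (\<Sum>b\<in>set bs. A (as ! i) b * x b)"
    using bij_betw_nth[OF assms refl refl]
    by (intro sum.reindex_bij_betw[of "(!) bs" "{..<length bs}" "set bs" "\<lambda>b. A (as ! i) b * x b"]) simp
  finally show "(matrix_on as bs A *\<^sub>v vector_on bs x) $ i
     = vector_on as (\<lambda>a. \<Sum>b\<in>set bs. A a b * x b) $ i"
    using i by (simp add: vector_on_def)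
qed (simp add: matrix_on_def vector_on_def)

lemma mat_image_matrix_on:
  fixes A :: "'a \<Rightarrow> 'b \<Rightarrow> 'r::comm_ring_1"
  assumes "distinct bs"
  shows "mat_image (matrix_on as bs A) = {vector_on as (\<lambda>a. \<Sum>b\<in>set bs. A a b * x b) | x. True}"
proof -
  have dim: "dim_col (matrix_on as bs A) = length bs" by (simp add: matrix_on_def)
  show ?thesis
  proof (rule equalityI; rule subsetI)
    fix v assume "v \<in> mat_image (matrix_on as bs A)"
    then obtain w where w: "v = matrix_on as bs A *\<^sub>v w" "w \<in> carrier_vec (length bs)"
      unfolding mat_image_def dim by blast
    obtain x where "w = vector_on bs x" by (rule vector_onE[OF assms w(2)])
    then show "v \<in> {vector_on as (\<lambda>a. \<Sum>b\<in>set bs. A a b * x b) | x. True}"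
      using w(1) matrix_on_mult_vec[OF assms] by blast
  next
    fix v assume "v \<in> {vector_on as (\<lambda>a. \<Sum>b\<in>set bs. A a b * x b) | x. True}"
    then obtain x where "v = vector_on as (\<lambda>a. \<Sum>b\<in>set bs. A a b * x b)" by blast
    then have "v = matrix_on as bs A *\<^sub>v vector_on bs x"
      by (simp add: matrix_on_mult_vec[OF assms])
    then show "v \<in> mat_image (matrix_on as bs A)"
      unfolding mat_image_def dim using vector_on_carrier by blast
  qed
qed

lemma mat_kernel_matrix_on:
  fixes A :: "'a \<Rightarrow> 'b \<Rightarrow> 'r::comm_ring_1"
  assumes "distinct bs"
  shows "mat_kernel (matrix_on as bs A) = {vector_on bs x | x. \<forall>a\<in>set as. (\<Sum>b\<in>set bs. A a b * x b) = 0}"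
proof -
  have dims: "dim_col (matrix_on as bs A) = length bs" "dim_row (matrix_on as bs A) = length as"
    by (simp_all add: matrix_on_def)
  have "0\<^sub>v (length as) = vector_on as (\<lambda>_. 0 :: 'r)" by (auto simp: vector_on_def)
  then have "matrix_on as bs A *\<^sub>v vector_on bs x = 0\<^sub>v (length as) \<longleftrightarrow>
      (\<forall>a\<in>set as. (\<Sum>b\<in>set bs. A a b * x b) = 0)" for x
    by (simp add: matrix_on_mult_vec assms vector_on_eq_iff)
  note ker = this
  show ?thesis
  proof (rule equalityI; rule subsetI)
    fix v assume "v \<in> mat_kernel (matrix_on as bs A)"
    then have v: "v \<in> carrier_vec (length bs)" "matrix_on as bs A *\<^sub>v v = 0\<^sub>v (length as)"
      unfolding mat_kernel_def dims by auto
    obtain x where "v = vector_on bs x" by (rule vector_onE[OF assms v(1)])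
    then show "v \<in> {vector_on bs x | x. \<forall>a\<in>set as. (\<Sum>b\<in>set bs. A a b * x b) = 0}"
      using v(2) ker by blast
  next
    fix v assume "v \<in> {vector_on bs x | x. \<forall>a\<in>set as. (\<Sum>b\<in>set bs. A a b * x b) = 0}"
    then show "v \<in> mat_kernel (matrix_on as bs A)"
      unfolding mat_kernel_def dims using ker vector_on_carrier by blast
  qed
qed

text \<open>
  The maps are graded, so the equations split into their homogeneous components, which can be
  solved one degree at a time.
\<close>

lemma exact_from_homogeneous:
  fixes A :: "'a \<Rightarrow> 'b \<Rightarrow> 'k::field poly3" and B :: "'b \<Rightarrow> 'c \<Rightarrow> 'k poly3"
  assumes S: "finite S1"
    and hom: "\<And>a b. a \<in> S0 \<Longrightarrow> b \<in> S1 \<Longrightarrow> homogeneous (d1 b - d0 a) (A a b)"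
    and exact: "\<And>t x. (\<And>b. b \<in> S1 \<Longrightarrow> homogeneous (t - d1 b) (x b)) \<Longrightarrow>
       (\<And>a. a \<in> S0 \<Longrightarrow> (\<Sum>b\<in>S1. A a b * x b) = 0) \<Longrightarrow> \<exists>u. \<forall>b\<in>S1. x b = (\<Sum>c\<in>S2. B b c * u c)"
    and x: "\<And>a. a \<in> S0 \<Longrightarrow> (\<Sum>b\<in>S1. A a b * x b) = 0"
  shows "\<exists>u. \<forall>b\<in>S1. x b = (\<Sum>c\<in>S2. B b c * u c)"
proof -
  have "\<exists>u. \<forall>b\<in>S1. component (t - d1 b) (x b) = (\<Sum>c\<in>S2. B b c * u c)" for t
  proof (rule exact[of t])
    fix a assume a: "a \<in> S0"
    have "(\<Sum>b\<in>S1. A a b * component (t - d1 b) (x b)) = (\<Sum>b\<in>S1. component (t - d0 a) (A a b * x b))"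
      by (intro sum.cong refl) (subst component_mult_left[OF hom[OF a]], auto simp: algebra_simps)
    also have "\<dots> = 0" using x[OF a] by (simp flip: component_sum)
    finally show "(\<Sum>b\<in>S1. A a b * component (t - d1 b) (x b)) = 0" .
  qed simp
  then obtain u where u: "\<And>t b. b \<in> S1 \<Longrightarrow> component (t - d1 b) (x b) = (\<Sum>c\<in>S2. B b c * u t c)"
    by metis
  define T where "T = (\<Union>b\<in>S1. (\<lambda>d. d + d1 b) ` degrees (x b))"
  have "x b = (\<Sum>c\<in>S2. B b c * (\<Sum>t\<in>T. u t c))" if b: "b \<in> S1" for b
  proof -
    have "(\<Sum>t\<in>T. component (t - d1 b) (x b)) = (\<Sum>d\<in>(\<lambda>t. t - d1 b) ` T. component d (x b))"
      by (subst sum.reindex) (auto simp: inj_on_def)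
    also have "\<dots> = x b"
    proof (rule sum_components)
      show "finite ((\<lambda>t. t - d1 b) ` T)" using S by (simp add: T_def)
      show "degrees (x b) \<subseteq> (\<lambda>t. t - d1 b) ` T"
      proof
        fix d assume "d \<in> degrees (x b)"
        then have "d + d1 b \<in> T" using b unfolding T_def by blast
        then show "d \<in> (\<lambda>t. t - d1 b) ` T" by (intro image_eqI[of _ _ "d + d1 b"]) auto
      qed
    qed
    finally have "x b = (\<Sum>t\<in>T. \<Sum>c\<in>S2. B b c * u t c)" using u[OF b] by simp
    also have "\<dots> = (\<Sum>c\<in>S2. B b c * (\<Sum>t\<in>T. u t c))"
      by (subst sum.swap) (simp add: sum_distrib_left)
    finally show ?thesis .
  qed
  then show ?thesis by (intro exI[of _ "\<lambda>c. \<Sum>t\<in>T. u t c"] ballI)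
qed

lemma exact_matrix_on:
  fixes A :: "'a \<Rightarrow> 'b \<Rightarrow> 'k::field poly3" and B :: "'b \<Rightarrow> 'c \<Rightarrow> 'k poly3"
  assumes dist: "distinct bs" "distinct cs"
    and hom: "\<And>a b. a \<in> set as \<Longrightarrow> b \<in> set bs \<Longrightarrow> homogeneous (d1 b - d0 a) (A a b)"
    and complex: "\<And>a c. a \<in> set as \<Longrightarrow> c \<in> set cs \<Longrightarrow> (\<Sum>b\<in>set bs. A a b * B b c) = 0"
    and exact: "\<And>t x. (\<And>b. b \<in> set bs \<Longrightarrow> homogeneous (t - d1 b) (x b)) \<Longrightarrow>
       (\<And>a. a \<in> set as \<Longrightarrow> (\<Sum>b\<in>set bs. A a b * x b) = 0) \<Longrightarrow> \<exists>u. \<forall>b\<in>set bs. x b = (\<Sum>c\<in>set cs. B b c * u c)"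
  shows "mat_image (matrix_on bs cs B) = mat_kernel (matrix_on as bs A)"
proof (rule equalityI; rule subsetI)
  fix v assume "v \<in> mat_image (matrix_on bs cs B)"
  then obtain u where v: "v = vector_on bs (\<lambda>b. \<Sum>c\<in>set cs. B b c * u c)"
    by (auto simp: mat_image_matrix_on[OF dist(2)])
  have "(\<Sum>b\<in>set bs. A a b * (\<Sum>c\<in>set cs. B b c * u c)) = 0" if a: "a \<in> set as" for a
  proof -
    have "(\<Sum>b\<in>set bs. A a b * (\<Sum>c\<in>set cs. B b c * u c)) = (\<Sum>c\<in>set cs. (\<Sum>b\<in>set bs. A a b * B b c) * u c)"
      unfolding sum_distrib_left sum_distrib_right by (subst sum.swap) (simp add: mult.assoc)
    also have "\<dots> = 0" using complex[OF a] by (intro sum.neutral) auto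
    finally show ?thesis .
  qed
  then show "v \<in> mat_kernel (matrix_on as bs A)"
    unfolding mat_kernel_matrix_on[OF dist(1)] v by blast
next
  fix v assume "v \<in> mat_kernel (matrix_on as bs A)"
  then obtain x where v: "v = vector_on bs x" and x: "\<And>a. a \<in> set as \<Longrightarrow> (\<Sum>b\<in>set bs. A a b * x b) = 0"
    by (auto simp: mat_kernel_matrix_on[OF dist(1)])
  have "\<exists>u. \<forall>b\<in>set bs. x b = (\<Sum>c\<in>set cs. B b c * u c)"
    by (rule exact_from_homogeneous[OF _ hom exact x]) auto
  then show "v \<in> mat_image (matrix_on bs cs B)"
    unfolding mat_image_matrix_on[OF dist(2)] v by (auto simp: vector_on_eq_iff)
qed

lemma all_nat_split4:
  "P 0 \<Longrightarrow> P (Suc 0) \<Longrightarrow> P (Suc (Suc 0)) \<Longrightarrow> (\<And>n. P (Suc (Suc (Suc n)))) \<Longrightarrow> \<forall>j. P j"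
  by (metis nat.exhaust)

text \<open>
  Exactness has to be checked on homogeneous vectors only. The last exactness condition is
  injectivity, which is exactness in front of a zero module.
\<close>

lemma resolution_from_sets:
  fixes e :: "'a \<Rightarrow> 'k::field poly3" and M1 :: "'a \<Rightarrow> 'b \<Rightarrow> 'k poly3" and M2 :: "'b \<Rightarrow> 'c \<Rightarrow> 'k poly3"
  assumes fin: "finite S0" "finite S1" "finite S2"
    and gen: "J = ideal_gen (e ` S0)"
    and hom0: "\<And>a. a \<in> S0 \<Longrightarrow> homogeneous (d0 a) (e a)"
    and hom1: "\<And>a b. a \<in> S0 \<Longrightarrow> b \<in> S1 \<Longrightarrow> homogeneous (d1 b - d0 a) (M1 a b)"
    and hom2: "\<And>b c. b \<in> S1 \<Longrightarrow> c \<in> S2 \<Longrightarrow> homogeneous (d2 c - d1 b) (M2 b c)"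
    and complex1: "\<And>b. b \<in> S1 \<Longrightarrow> (\<Sum>a\<in>S0. e a * M1 a b) = 0"
    and complex2: "\<And>a c. a \<in> S0 \<Longrightarrow> c \<in> S2 \<Longrightarrow> (\<Sum>b\<in>S1. M1 a b * M2 b c) = 0"
    and exact1: "\<And>t x. (\<And>a. a \<in> S0 \<Longrightarrow> homogeneous (t - d0 a) (x a)) \<Longrightarrow> (\<Sum>a\<in>S0. e a * x a) = 0 \<Longrightarrow>
      \<exists>u. \<forall>a\<in>S0. x a = (\<Sum>b\<in>S1. M1 a b * u b)"
    and exact2: "\<And>t x. (\<And>b. b \<in> S1 \<Longrightarrow> homogeneous (t - d1 b) (x b)) \<Longrightarrow>
      (\<And>a. a \<in> S0 \<Longrightarrow> (\<Sum>b\<in>S1. M1 a b * x b) = 0) \<Longrightarrow>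
      \<exists>u. \<forall>b\<in>S1. x b = (\<Sum>c\<in>S2. M2 b c * u c)"
    and exact3: "\<And>t x. (\<And>c. c \<in> S2 \<Longrightarrow> homogeneous (t - d2 c) (x c)) \<Longrightarrow>
      (\<And>b. b \<in> S1 \<Longrightarrow> (\<Sum>c\<in>S2. M2 b c * x c) = 0) \<Longrightarrow> \<forall>c\<in>S2. x c = 0"
    and min1: "\<And>a b. a \<in> S0 \<Longrightarrow> b \<in> S1 \<Longrightarrow> M1 a b \<in> irrelevant_ideal"
    and min2: "\<And>b c. b \<in> S1 \<Longrightarrow> c \<in> S2 \<Longrightarrow> M2 b c \<in> irrelevant_ideal"
  obtains sh \<phi> where "minimal_graded_free_resolution J sh \<phi>"
    "set (sh 0) = d0 ` S0" "set (sh 1) = d1 ` S1" "set (sh 2) = d2 ` S2" "\<And>j. j > 2 \<Longrightarrow> sh j = []"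
proof -
  obtain as bs cs where as: "set as = S0" "distinct as" and bs: "set bs = S1" "distinct bs"
    and cs: "set cs = S2" "distinct cs"
    using fin by (meson finite_distinct_list)
  define sh where "sh = case_nat (map d0 as) (case_nat (map d1 bs) (case_nat (map d2 cs) (\<lambda>_. [])))"
  \<comment> \<open>The augmentation is a matrix with one row. The map out of the first zero module has as many rows as there are elements of \<open>S2\<close>; all later maps are empty.\<close>
  define \<phi> where "\<phi> = case_nat (matrix_on [()] as (\<lambda>_. e)) (case_nat (matrix_on as bs M1)
    (case_nat (matrix_on bs cs M2)
      (\<lambda>n. matrix_on (if n = 0 then cs else []) ([] :: unit list) (\<lambda>_ _. 0))))"
  have img0: "mat_image (\<phi> 0) = {vec 1 (\<lambda>_. f) | f. f \<in> J}"
    unfolding gen ideal_gen_image[OF fin(1)] using mat_image_matrix_on[OF as(2), of "[()]" "\<lambda>_. e"]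
    by (auto simp: \<phi>_def vector_on_def as)
  have ex0: "mat_image (matrix_on as bs M1) = mat_kernel (matrix_on [()] as (\<lambda>_. e))"
  proof (rule exact_matrix_on[where ?d0.0 = "\<lambda>_. 0" and ?d1.0 = d0, OF as(2) bs(2)])
    fix t x assume "\<And>a. a \<in> set as \<Longrightarrow> homogeneous (t - d0 a) (x a)"
      "\<And>a. a \<in> set [()] \<Longrightarrow> (\<Sum>b\<in>set as. e b * x b) = 0"
    then show "\<exists>u. \<forall>a\<in>set as. x a = (\<Sum>b\<in>set bs. M1 a b * u b)"
      unfolding as(1) bs(1) by (intro exact1) auto
  qed (use as bs hom0 complex1 in auto)
  have ex1: "mat_image (matrix_on bs cs M2) = mat_kernel (matrix_on as bs M1)"
    by (rule exact_matrix_on[where ?d0.0 = d0 and ?d1.0 = d1, OF bs(2) cs(2)])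
      (unfold as(1) bs(1) cs(1), fact hom1, fact complex2, fact exact2)
  have ex2: "mat_image (matrix_on cs ([] :: unit list) (\<lambda>_ _. 0)) = mat_kernel (matrix_on bs cs M2)"
  proof (rule exact_matrix_on[where ?d0.0 = d1 and ?d1.0 = d2, OF cs(2)])
    fix t x assume "\<And>c. c \<in> set cs \<Longrightarrow> homogeneous (t - d2 c) (x c)"
      "\<And>b. b \<in> set bs \<Longrightarrow> (\<Sum>c\<in>set cs. M2 b c * x c) = 0"
    then have "\<forall>c\<in>S2. x c = 0" unfolding bs(1) cs(1) by (rule exact3)
    then show "\<exists>u. \<forall>c\<in>set cs. x c = (\<Sum>d\<in>set []. 0 * u d)" using cs(1) by simp
  qed (use bs cs hom2 in auto)
  have ex3: "mat_image (matrix_on ([] :: unit list) ([] :: unit list) (\<lambda>_ _. 0))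
     = mat_kernel (matrix_on xs ([] :: unit list) (\<lambda>_ _. 0 :: 'k poly3))" for xs :: "'c list"
    by (rule exact_matrix_on) auto
  have ex3': "mat_image (matrix_on ([] :: 'c list) ([] :: unit list) (\<lambda>_ _. 0))
     = mat_image (matrix_on ([] :: unit list) ([] :: unit list) (\<lambda>_ _. 0 :: 'k poly3))"
    by (simp add: matrix_on_def)
  have exact: "\<forall>j. mat_image (\<phi> (Suc j)) = mat_kernel (\<phi> j)"
    by (rule all_nat_split4) (use ex0 ex1 ex2 ex3 ex3' in \<open>auto simp: \<phi>_def\<close>)
  have carrier: "\<forall>j. \<phi> j \<in> carrier_mat (length (target_shifts sh j)) (length (sh j))"
    by (rule all_nat_split4) (auto simp: \<phi>_def sh_def matrix_on_def split: nat.split)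
  have hom: "\<forall>j. \<forall>a<length (target_shifts sh j). \<forall>b<length (sh j).
        homogeneous (sh j ! b - target_shifts sh j ! a) (\<phi> j $$ (a, b))"
    by (rule all_nat_split4)
      (use as bs cs hom0 hom1 hom2 in \<open>auto simp: \<phi>_def sh_def matrix_on_def split: nat.splits\<close>)
  have min: "\<forall>j. \<forall>a<length (sh j). \<forall>b<length (sh (Suc j)). \<phi> (Suc j) $$ (a, b) \<in> irrelevant_ideal"
    by (rule all_nat_split4)
      (use as bs cs min1 min2 in \<open>auto simp: \<phi>_def sh_def matrix_on_def split: nat.splits\<close>)
  have tail: "sh j = []" if "j > 2" for j
  proof -
    from that obtain n where "j = Suc (Suc (Suc n))" by (metis less_imp_Suc_add numeral_2_eq_2 add_Suc)
    then show ?thesis by (simp add: sh_def)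
  qed
  show thesis
  proof (rule that[of sh \<phi>])
    show "minimal_graded_free_resolution J sh \<phi>"
      unfolding minimal_graded_free_resolution_def graded_free_resolution_def
      using img0 exact carrier hom min tail by blast
  qed (use as bs cs tail in \<open>auto simp: sh_def numeral_2_eq_2\<close>)
qed

section \<open>Binary forms as residues modulo a linear form\<close>

text \<open>
  The last two axioms say that \<open>h\<close>, \<open>y\<close>, \<open>z\<close> generate the irrelevant ideal and that the monomials
  in \<open>y\<close> and \<open>z\<close> stay linearly independent modulo \<open>h\<close>. So the residue ring modulo \<open>h\<close> is the
  polynomial ring in \<open>y\<close> and \<open>z\<close>.
\<close>

locale plane_coords =
  fixes h y z :: "'k::field poly3"
  assumes hom_h: "homogeneous 1 h" and hom_y: "homogeneous 1 y" and hom_z: "homogeneous 1 z"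
    and h_nonzero: "h \<noteq> 0"
    and pos_decomp: "homogeneous t f \<Longrightarrow> t > 0 \<Longrightarrow> \<exists>p q r. homogeneous (t - 1) p \<and> homogeneous (t - 1) q
      \<and> homogeneous (t - 1) r \<and> f = y * p + z * q + h * r"
    and indep: "h dvd (\<Sum>i\<le>n. const_poly (c i) * (y ^ i * z ^ (n - i))) \<Longrightarrow> i \<le> n \<Longrightarrow> c i = 0"
begin

text \<open>
  The coefficient of \<open>y^i\<close> sits at index \<open>i\<close>, so that multiplication by \<open>z\<close> extends the
  coefficient sequence by zero and multiplication by \<open>y\<close> shifts it.
\<close>

definition binary_form :: "nat \<Rightarrow> (nat \<Rightarrow> 'k) \<Rightarrow> 'k poly3" where
  "binary_form n c = (\<Sum>i\<le>n. const_poly (c i) * (y ^ i * z ^ (n - i)))"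

lemma hom_y_mult: "homogeneous (t - 1) f \<Longrightarrow> homogeneous t (y * f)"
  by (erule homogeneous_mult'[OF hom_y]) simp

lemma hom_z_mult: "homogeneous (t - 1) f \<Longrightarrow> homogeneous t (z * f)"
  by (erule homogeneous_mult'[OF hom_z]) simp

lemma hom_h_mult: "homogeneous (t - 1) f \<Longrightarrow> homogeneous t (h * f)"
  by (erule homogeneous_mult'[OF hom_h]) simp

lemma dvd_homE:
  assumes "h dvd f" "homogeneous t f"
  obtains q where "homogeneous (t - 1) q" "f = h * q"
  using homogeneous_dvdE[OF assms(1) hom_h assms(2) h_nonzero] .

lemma hom_monomial: "homogeneous (int i + int j) (y ^ i * z ^ j)"
  by (intro homogeneous_mult homogeneous_power[OF hom_y] homogeneous_power[OF hom_z]) auto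

lemma hom_binary_form: "homogeneous (int n) (binary_form n c)"
  unfolding binary_form_def
proof (rule homogeneous_sum)
  fix i assume "i \<in> {..n}"
  then show "homogeneous (int n) (const_poly (c i) * (y ^ i * z ^ (n - i)))"
    using hom_monomial[of i "n - i"] by (intro homogeneous_const_mult) simp
qed

lemma binary_form_zero: "h dvd binary_form n c \<Longrightarrow> i \<le> n \<Longrightarrow> c i = 0"
  unfolding binary_form_def by (rule indep)

lemma binary_form_cong: "(\<And>i. i \<le> n \<Longrightarrow> c i = e i) \<Longrightarrow> binary_form n c = binary_form n e"
  unfolding binary_form_def by (intro sum.cong) auto

lemma binary_form_0: "(\<And>i. i \<le> n \<Longrightarrow> c i = 0) \<Longrightarrow> binary_form n c = 0"
  unfolding binary_form_def by (intro sum.neutral) auto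

lemma binary_form_add: "binary_form n c + binary_form n e = binary_form n (\<lambda>i. c i + e i)"
  unfolding binary_form_def by (simp only: single_add distrib_right sum.distrib)

lemma z_binary_form: "z * binary_form n c = binary_form (Suc n) (\<lambda>i. if i \<le> n then c i else 0)"
proof -
  have "z * binary_form n c = (\<Sum>i\<le>n. const_poly (c i) * (y ^ i * z ^ (Suc n - i)))"
    unfolding binary_form_def sum_distrib_left by (intro sum.cong) (auto simp: Suc_diff_le algebra_simps)
  then show ?thesis unfolding binary_form_def by simp
qed

lemma y_binary_form: "y * binary_form n c = binary_form (Suc n) (case_nat 0 c)"
proof -
  have "y * binary_form n c = (\<Sum>i\<le>n. const_poly (c i) * (y ^ Suc i * z ^ (Suc n - Suc i)))"
    unfolding binary_form_def sum_distrib_left by (intro sum.cong) (auto simp: algebra_simps)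
  then show ?thesis unfolding binary_form_def by (subst sum.atMost_Suc_shift) simp
qed

lemma binary_form_mod:
  assumes "homogeneous (int n) f" shows "\<exists>c. h dvd f - binary_form n c"
  using assms
proof (induction n arbitrary: f)
  case 0
  then have "f = const_poly (Poly_Mapping.lookup f 0)" by (intro homogeneous_0_const) simp
  also have "\<dots> = binary_form 0 (\<lambda>_. Poly_Mapping.lookup f 0)" by (simp add: binary_form_def)
  finally show ?case by (intro exI[of _ "\<lambda>_. Poly_Mapping.lookup f 0"]) simp
next
  case (Suc n)
  obtain p q r where pqr: "homogeneous (int n) p" "homogeneous (int n) q" "f = y * p + z * q + h * r"
    using pos_decomp[OF Suc.prems] by auto
  obtain c e where "h dvd p - binary_form n c" "h dvd q - binary_form n e"
    using Suc.IH pqr by blast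
  then have "h dvd y * (p - binary_form n c) + z * (q - binary_form n e) + h * r" by simp
  also have "y * (p - binary_form n c) + z * (q - binary_form n e) + h * r
    = f - (y * binary_form n c + z * binary_form n e)"
    by (simp add: pqr algebra_simps)
  finally show ?case
    unfolding z_binary_form y_binary_form binary_form_add by blast
qed

lemma dvd_minus_iff: "h dvd f - g \<Longrightarrow> h dvd f \<longleftrightarrow> h dvd g"
  by (metis diff_add_cancel dvd_add_right_iff)

lemma y_cancel:
  assumes "homogeneous t f" "h dvd y * f" shows "h dvd f"
proof (cases "t < 0")
  case True with homogeneous_neg[OF assms(1)] show ?thesis by simp
next
  case False
  then obtain n where n: "t = int n" by (metis int_nat_eq linorder_not_less)
  then obtain c where c: "h dvd f - binary_form n c" using binary_form_mod assms(1) by blast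
  then have "h dvd y * f - y * binary_form n c" by (metis dvd_mult right_diff_distrib)
  then have "h dvd binary_form (Suc n) (case_nat 0 c)"
    using assms(2) dvd_minus_iff unfolding y_binary_form by blast
  then have "c i = 0" if "i \<le> n" for i using binary_form_zero[of "Suc n" _ "Suc i"] that by fastforce
  then show ?thesis using c by (simp add: binary_form_0)
qed

lemma z_cancel:
  assumes "homogeneous t f" "h dvd z * f" shows "h dvd f"
proof (cases "t < 0")
  case True with homogeneous_neg[OF assms(1)] show ?thesis by simp
next
  case False
  then obtain n where n: "t = int n" by (metis int_nat_eq linorder_not_less)
  then obtain c where c: "h dvd f - binary_form n c" using binary_form_mod assms(1) by blast
  then have "h dvd z * f - z * binary_form n c" by (metis dvd_mult right_diff_distrib)
  then have "h dvd binary_form (Suc n) (\<lambda>i. if i \<le> n then c i else 0)"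
    using assms(2) dvd_minus_iff unfolding z_binary_form by blast
  then have "c i = 0" if "i \<le> n" for i using binary_form_zero[of "Suc n" _ i] that by fastforce
  then show ?thesis using c by (simp add: binary_form_0)
qed

text \<open>
  This is exactness of the Koszul complex of \<open>y\<close>, \<open>z\<close> modulo \<open>h\<close>. Comparing coefficients in
  \<open>y p + z q\<close> shows that the coefficients of \<open>q\<close> are those of \<open>- p\<close> shifted by one, so \<open>r\<close> can be
  read off from \<open>p\<close>.
\<close>

lemma koszul:
  assumes p: "homogeneous t p" and q: "homogeneous t q" and d: "h dvd y * p + z * q"
  obtains r where "homogeneous (t - 1) r" "h dvd p - z * r" "h dvd q + y * r"
proof (cases "t < 0")
  case True with homogeneous_neg[OF p] homogeneous_neg[OF q] show ?thesis using that[of 0] by simp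
next
  case False
  then obtain n where n: "t = int n" by (metis int_nat_eq linorder_not_less)
  obtain c e where c: "h dvd p - binary_form n c" and e: "h dvd q - binary_form n e"
    using binary_form_mod p q n by blast
  then have "h dvd y * (p - binary_form n c) + z * (q - binary_form n e)" by simp
  then have "h dvd (y * p + z * q) - (y * binary_form n c + z * binary_form n e)"
    by (simp add: algebra_simps)
  then have "h dvd y * binary_form n c + z * binary_form n e"
    using d dvd_minus_iff by blast
  then have "h dvd binary_form (Suc n) (\<lambda>i. case_nat 0 c i + (if i \<le> n then e i else 0))"
    unfolding y_binary_form z_binary_form binary_form_add .
  note zero = binary_form_zero[OF this]
  have e0: "e 0 = 0" using zero[of 0] by simp
  have ce: "c i + e (Suc i) = 0" if "i < n" for i using zero[of "Suc i"] that by simp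
  have cn: "c n = 0" using zero[of "Suc n"] by simp
  show thesis
  proof (cases n)
    case 0
    then have "binary_form n c = 0" "binary_form n e = 0" using e0 cn by (auto intro: binary_form_0)
    then show thesis using that[of 0] c e by simp
  next
    case (Suc m)
    have "z * binary_form m c = binary_form n c"
      unfolding z_binary_form Suc using cn Suc by (intro binary_form_cong) (auto simp: le_Suc_eq)
    moreover have "y * binary_form m c + binary_form n e = 0"
      unfolding y_binary_form Suc binary_form_add using ce e0 Suc
      by (intro binary_form_0) (auto split: nat.split)
    then have "y * binary_form m c = - binary_form n e" by (simp add: eq_neg_iff_add_eq_0)
    ultimately show thesis using that[of "binary_form m c"] c e n Suc hom_binary_form[of m c] by simp
  qed
qed

text \<open>
  Modulo \<open>h\<close> and \<open>z\<close> only the powers of \<open>y\<close> remain.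
\<close>

lemma lead_decomp:
  assumes "homogeneous (int n) f"
  obtains c p q where "homogeneous (int n - 1) p" "homogeneous (int n - 1) q"
    "f = const_poly c * y ^ n + h * p + z * q"
proof -
  obtain c where "h dvd f - binary_form n c" using binary_form_mod[OF assms] by blast
  then obtain p where p: "homogeneous (int n - 1) p" "f - binary_form n c = h * p"
    using homogeneous_diff[OF assms hom_binary_form] by (metis dvd_homE)
  then have f: "f = binary_form n c + h * p" by (metis add.commute diff_add_cancel)
  show thesis
  proof (cases n)
    case 0
    then show thesis using that[of p 0 "c 0"] p f by (simp add: binary_form_def)
  next
    case (Suc m)
    have "binary_form n c = const_poly (c n) * y ^ n + z * binary_form m c"
      unfolding z_binary_form by (simp add: binary_form_def Suc)
    then show thesis using that[of p "binary_form m c" "c n"] p f Suc hom_binary_form[of m c]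
      by (simp add: algebra_simps)
  qed
qed

lemma lead_unique:
  assumes "const_poly c * y ^ n = h * p + z * q" shows "c = 0"
proof -
  have "homogeneous (int n) (const_poly c * y ^ n)"
    by (intro homogeneous_const_mult homogeneous_power[OF hom_y]) simp
  then have eq: "const_poly c * y ^ n = h * component (int n - 1) p + z * component (int n - 1) q"
    using assms component_same
    by (metis component_add component_mult_left[OF hom_h] component_mult_left[OF hom_z])
  show ?thesis
  proof (cases n)
    case 0
    then have "component (int n - 1) f = 0" for f :: "'k poly3"
      by (intro homogeneous_neg[OF homogeneous_component]) simp
    then show ?thesis using eq 0 by simp
  next
    case (Suc m)
    obtain e where e: "h dvd component (int m) q - binary_form m e"
      using binary_form_mod[OF homogeneous_component] by blast
    then have "h dvd z * component (int m) q - z * binary_form m e"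
      by (metis dvd_mult right_diff_distrib)
    moreover have "h dvd const_poly c * y ^ n - z * component (int m) q"
      using eq Suc by simp
    ultimately have "h dvd (z * component (int m) q - z * binary_form m e)
        + (const_poly c * y ^ n - z * component (int m) q)"
      by (rule dvd_add)
    then have "h dvd const_poly c * y ^ n - z * binary_form m e" by simp
    moreover have "const_poly c * y ^ n = binary_form n (\<lambda>i. if i = n then c else 0)"
      unfolding binary_form_def
      by (subst sum.remove[of _ n]) (auto intro!: sum.neutral)
    moreover have "- (z * binary_form m e) = binary_form n (\<lambda>i. if i \<le> m then - e i else 0)"
    proof -
      have "z * binary_form m e + binary_form n (\<lambda>i. if i \<le> m then - e i else 0) = 0"
        unfolding z_binary_form Suc binary_form_add by (rule binary_form_0) simp
      then show ?thesis by (simp add: neg_eq_iff_add_eq_0)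
    qed
    ultimately have "h dvd binary_form n (\<lambda>i. (if i = n then c else 0) + (if i \<le> m then - e i else 0))"
      unfolding binary_form_add[symmetric] by (metis add_uminus_conv_diff)
    from binary_form_zero[OF this, of n] show ?thesis using Suc by simp
  qed
qed

lemma y_z_power_cancel:
  assumes "homogeneous t p" "homogeneous (t + int n - 1) q" "h dvd y * q + z ^ n * p"
  shows "\<exists>r. homogeneous (t - 1) r \<and> h dvd p - y * r"
  using assms(2,3)
proof (induction n arbitrary: q)
  case 0
  then show ?case by (intro exI[of _ "-q"]) (auto simp: homogeneous_uminus algebra_simps)
next
  case (Suc n)
  have "homogeneous (t + int n) (z ^ n * p)"
    by (rule homogeneous_mult'[OF homogeneous_power[OF hom_z refl] assms(1)]) simp
  moreover have "homogeneous (t + int n) q" using Suc.prems(1) by (simp add: algebra_simps)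
  moreover have "h dvd y * q + z * (z ^ n * p)" using Suc.prems(2) by (simp add: algebra_simps)
  ultimately obtain r where "homogeneous (t + int n - 1) r" "h dvd z ^ n * p + y * r"
    by (metis koszul)
  then show ?case using Suc.IH[of r] by (simp add: add.commute)
qed

text \<open>
  Modulo \<open>h\<close>, the syzygies of the monomials of degree \<open>k\<close> are generated by the relations between
  neighbours. By induction on \<open>k\<close>: modulo \<open>h\<close> the coefficient \<open>a 0\<close> of \<open>z^k\<close> must be a multiple of \<open>y\<close>;
  once it has been removed by a multiple of the first relation, all remaining terms contain \<open>y\<close>, and
  cancelling it leaves a syzygy of the monomials of degree \<open>k - 1\<close>.
\<close>

lemma power_syzygy:
  assumes "\<And>i. i \<le> k \<Longrightarrow> homogeneous t (a i)" "h dvd (\<Sum>i\<le>k. a i * (y ^ i * z ^ (k - i)))"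
  shows "\<exists>u. (\<forall>i<k. homogeneous (t - 1) (u i)) \<and>
    (\<forall>i\<le>k. h dvd a i - ((if i = 0 then 0 else z * u (i - 1)) - (if i = k then 0 else y * u i)))"
  using assms
proof (induction k arbitrary: a)
  case 0
  then show ?case by simp
next
  case (Suc k)
  define b where "b = (\<Sum>i\<le>k. a (Suc i) * (y ^ i * z ^ (k - i)))"
  have homm: "homogeneous (t + int k) (f * (y ^ i * z ^ (k - i)))" if "homogeneous t f" "i \<le> k" for f i
    using homogeneous_mult[OF that(1) hom_monomial[of i "k - i"]] that(2) by simp
  have hb: "homogeneous (t + int k) b"
    unfolding b_def by (intro homogeneous_sum homm Suc.prems) auto
  have sum: "(\<Sum>i\<le>Suc k. a i * (y ^ i * z ^ (Suc k - i))) = y * b + z ^ Suc k * a 0"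
    unfolding b_def by (subst sum.atMost_Suc_shift) (simp add: sum_distrib_left algebra_simps)
  then obtain r where r: "homogeneous (t - 1) r" "h dvd a 0 - y * r"
    using y_z_power_cancel[of t "a 0" "Suc k" b] Suc.prems hb by auto
  define a' where "a' = (\<lambda>i. if i = 0 then a 1 + z * r else a (Suc i))"
  have ha': "homogeneous t (a' i)" if "i \<le> k" for i
    using that Suc.prems(1) hom_z_mult[OF r(1)] by (auto simp: a'_def intro: homogeneous_add)
  have suma': "(\<Sum>i\<le>k. a' i * (y ^ i * z ^ (k - i))) = b + z * r * z ^ k"
  proof -
    have "(\<Sum>i\<le>k. a' i * (y ^ i * z ^ (k - i)))
       = (\<Sum>i\<le>k. a (Suc i) * (y ^ i * z ^ (k - i)) + (if i = 0 then z * r * z ^ k else 0))"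
      by (intro sum.cong) (auto simp: a'_def algebra_simps)
    then show ?thesis by (simp add: sum.distrib b_def)
  qed
  have "h dvd (y * b + z ^ Suc k * a 0) - z ^ Suc k * (a 0 - y * r)"
    using Suc.prems(2) r(2) unfolding sum by (simp add: dvd_diff)
  then have "h dvd y * (\<Sum>i\<le>k. a' i * (y ^ i * z ^ (k - i)))"
    unfolding suma' by (simp add: algebra_simps)
  then have "h dvd (\<Sum>i\<le>k. a' i * (y ^ i * z ^ (k - i)))"
    by (rule y_cancel[of "t + int k", rotated]) (intro homogeneous_sum homm ha', auto)
  from Suc.IH[OF ha' this] obtain u where u: "\<And>i. i < k \<Longrightarrow> homogeneous (t - 1) (u i)"
    "\<And>i. i \<le> k \<Longrightarrow> h dvd a' i - ((if i = 0 then 0 else z * u (i - 1)) - (if i = k then 0 else y * u i))"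
    by blast
  define v where "v = case_nat (-r) u"
  show ?case
  proof (intro exI[of _ v] conjI allI impI)
    fix i assume "i < Suc k"
    then show "homogeneous (t - 1) (v i)"
      using u(1) r(1) by (cases i) (auto simp: v_def homogeneous_uminus)
  next
    fix i assume i: "i \<le> Suc k"
    show "h dvd a i - ((if i = 0 then 0 else z * v (i - 1)) - (if i = Suc k then 0 else y * v i))"
    proof (cases i)
      case 0
      then show ?thesis using r by (simp add: v_def)
    next
      case (Suc j)
      show ?thesis using u(2)[of j] i Suc
        by (cases j) (auto simp: v_def a'_def algebra_simps)
    qed
  qed
qed

end

section \<open>Lifting exactness modulo a linear form\<close>

interpretation poly_vs: vector_space "\<lambda>(c::'k::field) (f::'k poly3). const_poly c * f"
  by unfold_locales (auto simp: algebra_simps single_add mult_single simp flip: mult.assoc)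

declare poly_vs.scale_scale [simp del]

context plane_coords
begin

text \<open>
  Multiplying a spanning set of one degree by \<open>y\<close>, \<open>z\<close> and \<open>h\<close> gives one of the next degree.
\<close>

lemma homogeneous_finite_dim:
  "\<exists>T :: 'k poly3 set. finite T \<and> (\<forall>f. homogeneous (int n) f \<longrightarrow> f \<in> poly_vs.span T)"
proof (induction n)
  case 0
  have "f \<in> poly_vs.span {1}" if "homogeneous (int 0) f" for f :: "'k poly3"
  proof -
    have "const_poly (Poly_Mapping.lookup f 0) * 1 \<in> poly_vs.span {1}"
      by (intro poly_vs.span_scale poly_vs.span_base) simp
    then show ?thesis using homogeneous_0_const[of f, symmetric] that by simp
  qed
  then show ?case by (intro exI[of _ "{1}"]) auto
next
  case (Suc n)
  then obtain T :: "'k poly3 set" where T: "finite T" "\<And>f. homogeneous (int n) f \<Longrightarrow> f \<in> poly_vs.span T" by blast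
  define T' where "T' = (*) y ` T \<union> (*) z ` T \<union> (*) h ` T"
  have mult: "g * f \<in> poly_vs.span T'" if g: "(*) g ` T \<subseteq> T'" and f: "homogeneous (int n) f" for f g
    using T(2)[OF f]
  proof (induction rule: poly_vs.span_induct_alt)
    case (step c x f)
    have "g * x \<in> poly_vs.span T'" using step(1) g by (intro poly_vs.span_base) auto
    then have "const_poly c * (g * x) + g * f \<in> poly_vs.span T'"
      using step by (intro poly_vs.span_add poly_vs.span_scale) auto
    then show ?case by (simp add: algebra_simps)
  qed (simp add: poly_vs.span_zero)
  have "f \<in> poly_vs.span T'" if f: "homogeneous (int (Suc n)) f" for f :: "'k poly3"
  proof -
    obtain p q r where "homogeneous (int n) p" "homogeneous (int n) q" "homogeneous (int n) r"
      "f = y * p + z * q + h * r" using pos_decomp[OF f] by auto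
    moreover from this have "y * p \<in> poly_vs.span T'" "z * q \<in> poly_vs.span T'" "h * r \<in> poly_vs.span T'"
      using mult[of y p] mult[of z q] mult[of h r] unfolding T'_def by blast+
    ultimately show ?thesis by (auto intro: poly_vs.span_add)
  qed
  then show ?case using T(1) by (intro exI[of _ T']) (auto simp: T'_def)
qed

lemma finite_independent_homogeneous:
  fixes B :: "'k poly3 set"
  assumes "poly_vs.independent B" "\<And>f. f \<in> B \<Longrightarrow> homogeneous (int n) f"
  shows "finite B"
proof -
  obtain T :: "'k poly3 set" where "finite T" "\<And>f. homogeneous (int n) f \<Longrightarrow> f \<in> poly_vs.span T"
    using homogeneous_finite_dim by blast
  then show ?thesis using poly_vs.independent_span_bound[of T B] assms by blast
qed

lemma dvd_sum_cong:
  assumes "\<And>j. j \<in> S \<Longrightarrow> h dvd a j - b j"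
  shows "h dvd (\<Sum>j\<in>S. a j * u j) - (\<Sum>j\<in>S. b j * u j)"
proof -
  have "h dvd (\<Sum>j\<in>S. (a j - b j) * u j)" using assms by (intro dvd_sum) auto
  then show ?thesis by (simp add: left_diff_distrib sum_subtractf)
qed

lemma dvd_diff_trans: "h dvd a - b \<Longrightarrow> h dvd b - c \<Longrightarrow> h dvd a - c"
  using dvd_add[of h "a - b" "b - c"] by simp

lemma dvd_diff_sym: "h dvd a - b \<Longrightarrow> h dvd b - a"
  by (metis Rings.dvd_minus_iff minus_diff_eq)

text \<open>
  Subtracting an image from an element of the kernel leaves a multiple \<open>h * x'\<close>. As \<open>h\<close> is not a
  zero divisor, \<open>x'\<close> lies in the kernel too, and its degree is smaller by one. The induction
  starts because there are no nonzero forms of negative degree.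
\<close>

lemma lift_exact:
  fixes A :: "'r \<Rightarrow> 's \<Rightarrow> 'k poly3" and M :: "'s \<Rightarrow> 'j \<Rightarrow> 'k poly3"
  assumes hom: "\<And>s j. s \<in> S0 \<Longrightarrow> j \<in> S1 \<Longrightarrow> homogeneous 1 (M s j)"
    and complex: "\<And>r j. r \<in> Q \<Longrightarrow> j \<in> S1 \<Longrightarrow> (\<Sum>s\<in>S0. A r s * M s j) = 0"
    and exact_mod: "\<And>t x. (\<And>s. s \<in> S0 \<Longrightarrow> homogeneous t (x s)) \<Longrightarrow>
      (\<And>r. r \<in> Q \<Longrightarrow> (\<Sum>s\<in>S0. A r s * x s) = 0) \<Longrightarrow>
      \<exists>u. (\<forall>j\<in>S1. homogeneous (t - 1) (u j)) \<and> (\<forall>s\<in>S0. h dvd x s - (\<Sum>j\<in>S1. M s j * u j))"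
    and x: "\<And>s. s \<in> S0 \<Longrightarrow> homogeneous t (x s)" "\<And>r. r \<in> Q \<Longrightarrow> (\<Sum>s\<in>S0. A r s * x s) = 0"
  shows "\<exists>u. (\<forall>j\<in>S1. homogeneous (t - 1) (u j)) \<and> (\<forall>s\<in>S0. x s = (\<Sum>j\<in>S1. M s j * u j))"
proof -
  have "t < int n \<Longrightarrow> ?thesis" for n
    using x
  proof (induction n arbitrary: t x)
    case 0
    then have "x s = 0" if "s \<in> S0" for s using homogeneous_neg that by auto
    then show ?case by (intro exI[of _ "\<lambda>_. 0"]) auto
  next
    case (Suc n)
    obtain u where u: "\<And>j. j \<in> S1 \<Longrightarrow> homogeneous (t - 1) (u j)"
      "\<And>s. s \<in> S0 \<Longrightarrow> h dvd x s - (\<Sum>j\<in>S1. M s j * u j)"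
      using exact_mod[OF Suc.prems(2,3)] by blast
    have "\<exists>x'. homogeneous (t - 1) x' \<and> x s - (\<Sum>j\<in>S1. M s j * u j) = h * x'" if s: "s \<in> S0" for s
    proof -
      have "homogeneous t (x s - (\<Sum>j\<in>S1. M s j * u j))"
        using s by (intro homogeneous_diff homogeneous_sum Suc.prems(2)
            homogeneous_mult'[OF hom u(1)]) auto
      then obtain q where "homogeneous (t - 1) q" "x s - (\<Sum>j\<in>S1. M s j * u j) = h * q"
        by (rule dvd_homE[OF u(2)[OF s]])
      then show ?thesis by (intro exI[of _ q] conjI)
    qed
    then obtain x' where x': "\<And>s. s \<in> S0 \<Longrightarrow> homogeneous (t - 1) (x' s)"
      "\<And>s. s \<in> S0 \<Longrightarrow> x s - (\<Sum>j\<in>S1. M s j * u j) = h * x' s" by metis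
    have Ax': "(\<Sum>s\<in>S0. A r s * x' s) = 0" if r: "r \<in> Q" for r
    proof -
      have "(\<Sum>s\<in>S0. A r s * (\<Sum>j\<in>S1. M s j * u j)) = (\<Sum>j\<in>S1. (\<Sum>s\<in>S0. A r s * M s j) * u j)"
        unfolding sum_distrib_left sum_distrib_right by (subst sum.swap) (simp add: mult.assoc)
      also have "\<dots> = 0" using complex[OF r] by (intro sum.neutral) auto
      finally have 0: "(\<Sum>s\<in>S0. A r s * (\<Sum>j\<in>S1. M s j * u j)) = 0" .
      have "h * (\<Sum>s\<in>S0. A r s * x' s) = (\<Sum>s\<in>S0. A r s * (h * x' s))"
        by (simp add: sum_distrib_left algebra_simps)
      also have "\<dots> = (\<Sum>s\<in>S0. A r s * (x s - (\<Sum>j\<in>S1. M s j * u j)))"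
        using x'(2) by (intro sum.cong) auto
      also have "\<dots> = 0" using Suc.prems(3)[OF r] 0 by (simp add: right_diff_distrib sum_subtractf)
      finally show ?thesis using h_nonzero by simp
    qed
    have "t - 1 < int n" using Suc.prems(1) by simp
    from Suc.IH[OF this x'(1) Ax'] obtain u' where u': "\<And>j. j \<in> S1 \<Longrightarrow> homogeneous (t - 1 - 1) (u' j)"
      "\<And>s. s \<in> S0 \<Longrightarrow> x' s = (\<Sum>j\<in>S1. M s j * u' j)"
      by blast
    show ?case
    proof (intro exI[of _ "\<lambda>j. u j + h * u' j"] conjI ballI)
      fix j assume "j \<in> S1"
      then show "homogeneous (t - 1) (u j + h * u' j)"
        by (intro homogeneous_add u hom_h_mult u')
    next
      fix s assume s: "s \<in> S0"
      have "x s = (\<Sum>j\<in>S1. M s j * u j) + h * x' s" using x'(2)[OF s] by (simp add: algebra_simps)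
      also have "\<dots> = (\<Sum>j\<in>S1. M s j * (u j + h * u' j))"
        by (simp add: u'(2)[OF s] algebra_simps sum.distrib sum_distrib_left)
      finally show "x s = (\<Sum>j\<in>S1. M s j * (u j + h * u' j))" .
    qed
  qed
  from this[of "nat (t + 1)"] show ?thesis by auto
qed

end

section \<open>Ideals with linear resolutions\<close>

context plane_coords
begin

text \<open>
  Let \<open>J\<close> be the ideal generated by \<open>V\<close>. Modulo \<open>h J\<close>, the elements of \<open>V\<close> that are divisible by
  \<open>h\<close> are killed by \<open>y\<close> and \<open>z\<close> (assumption \<open>torsion\<close>), so they contribute copies of the residue
  field; the other elements of \<open>V\<close> contribute the ideal \<open>(y,z)^k\<close>. The assumptions \<open>torsion\<close> and
  \<open>steps\<close> state that the linear relations of these two pieces lift modulo \<open>h J\<close>. The three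
  exactness statements come from exactness modulo \<open>h\<close> by \<open>lift_exact\<close>.
\<close>

lemma linear_resolution:
  assumes V: "poly_vs.subspace V" and homV: "\<And>f. f \<in> V \<Longrightarrow> homogeneous (int k) f"
    and monomials: "\<And>i. i \<le> k \<Longrightarrow> \<exists>w\<in>V. h dvd w - y ^ i * z ^ (k - i)"
    and torsion: "\<And>b. b \<in> V \<Longrightarrow> h dvd b \<Longrightarrow> (\<exists>v\<in>V. y * b = h * v) \<and> (\<exists>v\<in>V. z * b = h * v)"
    and steps: "\<And>i. i < k \<Longrightarrow> \<exists>w\<in>V. \<exists>w'\<in>V. \<exists>v\<in>V. h dvd w - y ^ i * z ^ (k - i) \<and>
      h dvd w' - y ^ Suc i * z ^ (k - Suc i) \<and> z * w' - y * w = h * v"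
  shows "has_linear_resolution (ideal_gen V)"
proof -
  obtain w where wV: "\<And>i. i \<le> k \<Longrightarrow> w i \<in> V" and w: "\<And>i. i \<le> k \<Longrightarrow> h dvd w i - y ^ i * z ^ (k - i)"
    using monomials by metis
  \<comment> \<open>The generators are lifts \<open>w i\<close> of the monomials and a basis \<open>B\<close> of the elements divisible by \<open>h\<close>.\<close>
  obtain B where B: "B \<subseteq> {b \<in> V. h dvd b}" "poly_vs.independent B" "{b \<in> V. h dvd b} \<subseteq> poly_vs.span B"
    by (rule poly_vs.maximal_independent_subset)
  have finB: "finite B"
    using B homV by (intro finite_independent_homogeneous[of B k]) auto
  have BV: "b \<in> V" "h dvd b" if "b \<in> B" for b using B(1) that by auto
  define S0 where "S0 = {..k} <+> B"
  define S1 where "S1 = {..<k} <+> (B <+> B)"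
  define e where "e = case_sum w (\<lambda>b. b)"
  have fin: "finite S0" "finite S1" using finB by (auto simp: S0_def S1_def)
  have sum0: "(\<Sum>s\<in>S0. g s) = (\<Sum>i\<le>k. g (Inl i)) + (\<Sum>b\<in>B. g (Inr b))" for g :: "nat + 'k poly3 \<Rightarrow> 'k poly3"
    unfolding S0_def using finB by (simp add: sum.Plus)
  have sum1: "(\<Sum>s\<in>S1. g s) = (\<Sum>i<k. g (Inl i)) + ((\<Sum>b\<in>B. g (Inr (Inl b))) + (\<Sum>b\<in>B. g (Inr (Inr b))))"
    for g :: "nat + ('k poly3 + 'k poly3) \<Rightarrow> 'k poly3"
    unfolding S1_def using finB by (simp add: sum.Plus)
  have eV: "e s \<in> V" if "s \<in> S0" for s
    using that wV BV by (auto simp: S0_def e_def)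
  have combo: "\<exists>c. v = (\<Sum>s\<in>S0. e s * const_poly (c s))" if v: "v \<in> V" for v
  proof -
    obtain c where c: "h dvd v - binary_form k c" using binary_form_mod[OF homV[OF v]] by blast
    define v' where "v' = v - (\<Sum>i\<le>k. const_poly (c i) * w i)"
    have "v' \<in> V"
      unfolding v'_def by (intro poly_vs.subspace_diff V v poly_vs.subspace_sum poly_vs.subspace_scale wV) auto
    moreover have "h dvd v'"
    proof -
      have "h dvd (\<Sum>i\<le>k. const_poly (c i) * (w i - y ^ i * z ^ (k - i)))"
        using w by (intro dvd_sum) auto
      then have "h dvd (\<Sum>i\<le>k. const_poly (c i) * w i) - binary_form k c"
        by (simp add: binary_form_def right_diff_distrib sum_subtractf)
      then show ?thesis unfolding v'_def using c dvd_diff_trans dvd_diff_sym by blast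
    qed
    ultimately have "v' \<in> poly_vs.span B" using B(3) by blast
    then obtain d where d: "v' = (\<Sum>b\<in>B. const_poly (d b) * b)"
      using poly_vs.span_finite[OF finB] by auto
    have "v = (\<Sum>i\<le>k. const_poly (c i) * w i) + v'" by (simp add: v'_def)
    then have "v = (\<Sum>s\<in>S0. e s * const_poly (case_sum c d s))"
      by (simp add: sum0 e_def d mult.commute)
    then show ?thesis by blast
  qed
  \<comment> \<open>The relations modulo \<open>h\<close>: one between neighbouring monomials for each \<open>j < k\<close>, and the products of \<open>y\<close> and of \<open>z\<close> with the basis vector of each element of \<open>B\<close>.\<close>
  define \<sigma> :: "nat + 'k poly3 \<Rightarrow> nat + ('k poly3 + 'k poly3) \<Rightarrow> 'k poly3" where
    "\<sigma> s j = (case j of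
        Inl j \<Rightarrow> (case s of Inl i \<Rightarrow> (if i = Suc j then z else 0) - (if i = j then y else 0) | Inr b \<Rightarrow> 0)
      | Inr (Inl b') \<Rightarrow> (case s of Inl i \<Rightarrow> 0 | Inr b \<Rightarrow> if b = b' then y else 0)
      | Inr (Inr b') \<Rightarrow> (case s of Inl i \<Rightarrow> 0 | Inr b \<Rightarrow> if b = b' then z else 0))" for s j
  have hom\<sigma>: "homogeneous 1 (\<sigma> s j)" for s j
    using hom_y hom_z by (auto simp: \<sigma>_def homogeneous_diff homogeneous_uminus split: sum.split)
  have lead: "\<exists>v\<in>V. (\<Sum>s\<in>S0. e s * \<sigma> s j) = h * v" if j: "j \<in> S1" for j
  proof -
    consider (1) i where "j = Inl i" "i < k" | (2) b where "j = Inr (Inl b)" "b \<in> B"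
      | (3) b where "j = Inr (Inr b)" "b \<in> B"
      using j by (auto simp: S1_def)
    then show ?thesis
    proof cases
      case 1
      obtain W W' v where W: "W \<in> V" "W' \<in> V" "v \<in> V" "h dvd W - y ^ i * z ^ (k - i)"
        "h dvd W' - y ^ Suc i * z ^ (k - Suc i)" "z * W' - y * W = h * v"
        using steps[OF 1(2)] by blast
      have "w i - W \<in> V" "h dvd w i - W"
        using wV[of i] w[of i] W 1 V by (auto intro: poly_vs.subspace_diff dvd_diff_trans dvd_diff_sym)
      then obtain v1 where v1: "v1 \<in> V" "y * (w i - W) = h * v1" using torsion by blast
      have "w (Suc i) - W' \<in> V" "h dvd w (Suc i) - W'"
        using wV[of "Suc i"] w[of "Suc i"] W 1 V by (auto intro: poly_vs.subspace_diff dvd_diff_trans dvd_diff_sym)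
      then obtain v2 where v2: "v2 \<in> V" "z * (w (Suc i) - W') = h * v2" using torsion by blast
      have "(\<Sum>s\<in>S0. e s * \<sigma> s j)
        = (\<Sum>i'\<le>k. (if i' = Suc i then z * w i' else 0) - (if i' = i then y * w i' else 0))"
        unfolding sum0 by (simp add: e_def \<sigma>_def 1) (intro sum.cong, auto simp: algebra_simps)
      also have "\<dots> = z * w (Suc i) - y * w i" using 1 by (simp add: sum_subtractf)
      also have "\<dots> = (z * W' - y * W) + z * (w (Suc i) - W') - y * (w i - W)" by (simp add: algebra_simps)
      also have "\<dots> = h * (v + v2 - v1)" unfolding W v1 v2 by (simp add: algebra_simps)
      finally show ?thesis
        using W v1 v2 V by (intro bexI[of _ "v + v2 - v1"]) (auto intro: poly_vs.subspace_diff poly_vs.subspace_add)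
    next
      case 2
      have "(\<Sum>s\<in>S0. e s * \<sigma> s j) = (\<Sum>b'\<in>B. if b' = b then y * b else 0)"
        unfolding sum0 by (simp add: e_def \<sigma>_def 2) (intro sum.cong, auto simp: algebra_simps)
      also have "\<dots> = y * b" using 2 finB by simp
      finally show ?thesis using torsion[OF BV[OF 2(2)]] by auto
    next
      case 3
      have "(\<Sum>s\<in>S0. e s * \<sigma> s j) = (\<Sum>b'\<in>B. if b' = b then z * b else 0)"
        unfolding sum0 by (simp add: e_def \<sigma>_def 3) (intro sum.cong, auto simp: algebra_simps)
      also have "\<dots> = z * b" using 3 finB by simp
      finally show ?thesis using torsion[OF BV[OF 3(2)]] by auto
    qed
  qed
  have "\<forall>j\<in>S1. \<exists>c. (\<Sum>s\<in>S0. e s * \<sigma> s j) = h * (\<Sum>s\<in>S0. e s * const_poly (c s))"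
  proof
    fix j assume "j \<in> S1"
    then obtain v where v: "v \<in> V" "(\<Sum>s\<in>S0. e s * \<sigma> s j) = h * v" using lead by blast
    obtain c where "v = (\<Sum>s\<in>S0. e s * const_poly (c s))" using combo[OF v(1)] ..
    then show "\<exists>c. (\<Sum>s\<in>S0. e s * \<sigma> s j) = h * (\<Sum>s\<in>S0. e s * const_poly (c s))"
      using v(2) by (intro exI[of _ c]) simp
  qed
  from bchoice[OF this] obtain c where
    "\<forall>j\<in>S1. (\<Sum>s\<in>S0. e s * \<sigma> s j) = h * (\<Sum>s\<in>S0. e s * const_poly (c j s))" ..
  then have c: "\<And>j. j \<in> S1 \<Longrightarrow> (\<Sum>s\<in>S0. e s * \<sigma> s j) = h * (\<Sum>s\<in>S0. e s * const_poly (c j s))"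
    by (rule bspec)
  \<comment> \<open>The generators span \<open>V\<close> over the field, so the relations are corrected by constants times \<open>h\<close> and stay linear.\<close>
  define M where "M s j = \<sigma> s j - h * const_poly (c j s)" for s j
  have homM: "homogeneous 1 (M s j)" for s j
    unfolding M_def by (intro homogeneous_diff hom\<sigma> hom_h_mult) simp
  have Mmod: "h dvd M s j - \<sigma> s j" for s j by (simp add: M_def)
  have complexM: "(\<Sum>s\<in>S0. e s * M s j) = 0" if "j \<in> S1" for j
    using c[OF that] by (simp add: M_def right_diff_distrib sum_subtractf sum_distrib_left mult.left_commute)
  have \<sigma>_rows: "(\<Sum>j\<in>S1. \<sigma> (Inl i) j * u j)
      = (if i = 0 then 0 else z * u (Inl (i - 1))) - (if i = k then 0 else y * u (Inl i))" if "i \<le> k" for i u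
  proof -
    have "(\<Sum>j\<in>S1. \<sigma> (Inl i) j * u j)
      = (\<Sum>j<k. (if i = Suc j then z * u (Inl j) else 0) - (if i = j then y * u (Inl j) else 0))"
      unfolding sum1 by (simp add: \<sigma>_def) (intro sum.cong, auto simp: algebra_simps)
    also have "\<dots> = (\<Sum>j<k. if i = Suc j then z * u (Inl j) else 0) - (\<Sum>j<k. if i = j then y * u (Inl j) else 0)"
      by (simp add: sum_subtractf)
    also have "(\<Sum>j<k. if i = Suc j then z * u (Inl j) else 0) = (if i = 0 then 0 else z * u (Inl (i - 1)))"
      using that by (cases i) auto
    also have "(\<Sum>j<k. if i = j then y * u (Inl j) else 0) = (if i = k then 0 else y * u (Inl i))"
      using that by auto
    finally show ?thesis .
  qed
  have \<sigma>_rows': "(\<Sum>j\<in>S1. \<sigma> (Inr b) j * u j) = y * u (Inr (Inl b)) + z * u (Inr (Inr b))" if "b \<in> B" for b u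
  proof -
    have "(\<Sum>j\<in>S1. \<sigma> (Inr b) j * u j)
      = (\<Sum>b'\<in>B. if b = b' then y * u (Inr (Inl b')) else 0) + (\<Sum>b'\<in>B. if b = b' then z * u (Inr (Inr b')) else 0)"
      unfolding sum1 by (simp add: \<sigma>_def) (intro arg_cong2[of _ _ _ _ "(+)"] sum.cong, auto)
    then show ?thesis using that finB by simp
  qed
  have exact1_mod: "\<exists>u. (\<forall>j\<in>S1. homogeneous (t - 1) (u j)) \<and> (\<forall>s\<in>S0. h dvd x s - (\<Sum>j\<in>S1. M s j * u j))"
    if x: "\<And>s. s \<in> S0 \<Longrightarrow> homogeneous t (x s)" and 0: "(\<Sum>s\<in>S0. e s * x s) = 0" for t x
  proof -
    have xI: "homogeneous t (x (Inl i))" if "i \<le> k" for i using x that by (auto simp: S0_def)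
    have xB: "homogeneous t (x (Inr b))" if "b \<in> B" for b using x that by (auto simp: S0_def)
    have "h dvd (\<Sum>i\<le>k. w i * x (Inl i))"
    proof -
      have "(\<Sum>i\<le>k. w i * x (Inl i)) = - (\<Sum>b\<in>B. b * x (Inr b))"
        using 0 by (simp add: sum0 e_def eq_neg_iff_add_eq_0)
      also have "h dvd \<dots>" using BV by (auto intro!: dvd_sum)
      finally show ?thesis .
    qed
    moreover have "h dvd (\<Sum>i\<le>k. w i * x (Inl i)) - (\<Sum>i\<le>k. (y ^ i * z ^ (k - i)) * x (Inl i))"
      by (rule dvd_sum_cong) (use w in auto)
    ultimately have "h dvd (\<Sum>i\<le>k. (y ^ i * z ^ (k - i)) * x (Inl i))"
      using dvd_minus_iff by blast
    then have "h dvd (\<Sum>i\<le>k. x (Inl i) * (y ^ i * z ^ (k - i)))"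
      by (simp add: mult.commute)
    from power_syzygy[OF xI this] obtain u where u: "\<And>i. i < k \<Longrightarrow> homogeneous (t - 1) (u i)"
      "\<And>i. i \<le> k \<Longrightarrow> h dvd x (Inl i) - ((if i = 0 then 0 else z * u (i - 1)) - (if i = k then 0 else y * u i))"
      by blast
    have "\<exists>p q. homogeneous (t - 1) p \<and> homogeneous (t - 1) q \<and> h dvd x (Inr b) - (y * p + z * q)" if b: "b \<in> B" for b
    proof (cases "t > 0")
      case True
      then obtain p q r where "homogeneous (t - 1) p" "homogeneous (t - 1) q" "x (Inr b) = y * p + z * q + h * r"
        using pos_decomp[OF xB[OF b]] by blast
      then show ?thesis by (intro exI[of _ p] exI[of _ q]) auto
    next
      case False
      \<comment> \<open>The coefficients are constants: those at the \<open>w i\<close> vanish, since a constant divisible by \<open>h\<close> is zero, and those at \<open>B\<close> vanish by linear independence.\<close>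
      have u0: "u i = 0" if "i < k" for i using homogeneous_neg[OF u(1)[OF that]] False by simp
      have "x (Inl i) = 0" if i: "i \<le> k" for i
      proof -
        have "h dvd x (Inl i)"
          using u(2)[OF i] u0[of i] u0[of "i - 1"] i by (auto split: if_splits)
        then obtain q where "homogeneous (t - 1) q" "x (Inl i) = h * q" using xI[OF i] by (rule dvd_homE)
        then show ?thesis using homogeneous_neg[of "t - 1" q] False by simp
      qed
      then have sumB: "(\<Sum>b\<in>B. b * x (Inr b)) = 0" using 0 by (simp add: sum0 e_def)
      have xc: "x (Inr b) = const_poly (Poly_Mapping.lookup (x (Inr b)) 0)" if "b \<in> B" for b
      proof (cases "t = 0")
        case True then show ?thesis using xB[OF that] by (intro homogeneous_0_const) simp
      next
        case False
        then show ?thesis using homogeneous_neg[OF xB[OF that]] \<open>\<not> t > 0\<close> by simp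
      qed
      have "(\<Sum>b\<in>B. const_poly (Poly_Mapping.lookup (x (Inr b)) 0) * b) = (\<Sum>b\<in>B. b * x (Inr b))"
        by (intro sum.cong refl) (subst (2) xc, simp_all add: mult.commute)
      then have "Poly_Mapping.lookup (x (Inr b)) 0 = 0"
        using poly_vs.independentD[OF B(2) finB subset_refl _ b, of "\<lambda>b. Poly_Mapping.lookup (x (Inr b)) 0"]
          sumB by simp
      then have "x (Inr b) = 0" using xc[OF b] by simp
      then show ?thesis by (intro exI[of _ 0]) simp
    qed
    then obtain p q where pq: "\<And>b. b \<in> B \<Longrightarrow> homogeneous (t - 1) (p b)" "\<And>b. b \<in> B \<Longrightarrow> homogeneous (t - 1) (q b)"
      "\<And>b. b \<in> B \<Longrightarrow> h dvd x (Inr b) - (y * p b + z * q b)" by metis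
    define U where "U = case_sum u (case_sum p q)"
    have "h dvd x s - (\<Sum>j\<in>S1. \<sigma> s j * U j)" if s: "s \<in> S0" for s
    proof (cases s)
      case (Inl i)
      then have "i \<le> k" using s by (auto simp: S0_def)
      from u(2)[OF this] show ?thesis unfolding Inl \<sigma>_rows[OF \<open>i \<le> k\<close>] by (simp only: U_def sum.case)
    next
      case (Inr b)
      then have "b \<in> B" using s by (auto simp: S0_def)
      from pq(3)[OF this] show ?thesis unfolding Inr \<sigma>_rows'[OF \<open>b \<in> B\<close>] by (simp only: U_def sum.case)
    qed
    moreover have "h dvd (\<Sum>j\<in>S1. \<sigma> s j * U j) - (\<Sum>j\<in>S1. M s j * U j)" for s
      by (rule dvd_sum_cong) (rule dvd_diff_sym[OF Mmod])
    ultimately have "\<forall>s\<in>S0. h dvd x s - (\<Sum>j\<in>S1. M s j * U j)"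
      using dvd_diff_trans by blast
    moreover have "\<forall>j\<in>S1. homogeneous (t - 1) (U j)" using u pq by (auto simp: S1_def U_def)
    ultimately show ?thesis by (intro exI[of _ U] conjI)
  qed
  have exact1: "\<exists>u. (\<forall>j\<in>S1. homogeneous (t - 1) (u j)) \<and> (\<forall>s\<in>S0. x s = (\<Sum>j\<in>S1. M s j * u j))"
    if x: "\<And>s. s \<in> S0 \<Longrightarrow> homogeneous t (x s)" and 0: "(\<Sum>s\<in>S0. e s * x s) = 0" for t x
    by (rule lift_exact[where A = "\<lambda>_. e" and Q = "{()}", OF homM complexM exact1_mod x 0]) auto

  \<comment> \<open>The second syzygies modulo \<open>h\<close> are the Koszul relations between the two relations of each \<open>b\<close>.\<close>
  define \<tau> :: "nat + ('k poly3 + 'k poly3) \<Rightarrow> 'k poly3 \<Rightarrow> 'k poly3" where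
    "\<tau> j b = (case j of Inl i \<Rightarrow> 0 | Inr (Inl b') \<Rightarrow> if b' = b then z else 0 | Inr (Inr b') \<Rightarrow> if b' = b then - y else 0)"
    for j b
  have hom\<tau>: "homogeneous 1 (\<tau> j b)" for j b
    using hom_y hom_z by (auto simp: \<tau>_def homogeneous_uminus split: sum.split)
  have "\<forall>b\<in>B. \<exists>u. (\<forall>j\<in>S1. homogeneous 0 (u j)) \<and>
      (\<forall>s\<in>S0. (\<Sum>j\<in>S1. M s j * \<tau> j b) = h * (\<Sum>j\<in>S1. M s j * u j))"
  proof
    fix b assume b: "b \<in> B"
    \<comment> \<open>Applying the first map to a Koszul relation gives \<open>h\<close> times the syzygy \<open>x\<close>. It is linear, so it is a combination of the columns of \<open>M\<close> with constant coefficients.\<close>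
    define x where "x s = y * const_poly (c (Inr (Inr b)) s) - z * const_poly (c (Inr (Inl b)) s)" for s
    have M\<tau>: "(\<Sum>j\<in>S1. M s j * \<tau> j b) = h * x s" for s
    proof -
      have "(\<Sum>j\<in>S1. M s j * \<tau> j b) = (\<Sum>b'\<in>B. if b' = b then M s (Inr (Inl b)) * z else 0)
         + (\<Sum>b'\<in>B. if b' = b then - (M s (Inr (Inr b)) * y) else 0)"
        unfolding sum1 by (simp add: \<tau>_def) (intro arg_cong2[of _ _ _ _ "(+)"] sum.cong, auto)
      also have "\<dots> = M s (Inr (Inl b)) * z - M s (Inr (Inr b)) * y" using b finB by simp
      also have "\<dots> = h * x s"
        by (cases s) (auto simp: M_def x_def \<sigma>_def algebra_simps)
      finally show ?thesis .
    qed
    have "h * (\<Sum>s\<in>S0. e s * x s) = (\<Sum>s\<in>S0. e s * (\<Sum>j\<in>S1. M s j * \<tau> j b))"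
      unfolding M\<tau> by (simp add: sum_distrib_left algebra_simps)
    also have "\<dots> = (\<Sum>j\<in>S1. (\<Sum>s\<in>S0. e s * M s j) * \<tau> j b)"
      unfolding sum_distrib_left sum_distrib_right by (subst sum.swap) (simp add: mult.assoc)
    also have "\<dots> = 0" using complexM by (intro sum.neutral) auto
    finally have "(\<Sum>s\<in>S0. e s * x s) = 0" using h_nonzero by simp
    moreover have "homogeneous 1 (x s)" for s
      unfolding x_def by (intro homogeneous_diff hom_y_mult hom_z_mult) auto
    ultimately obtain u where "\<forall>j\<in>S1. homogeneous (1 - 1) (u j)" "\<forall>s\<in>S0. x s = (\<Sum>j\<in>S1. M s j * u j)"
      using exact1[of 1 x] by blast
    then show "\<exists>u. (\<forall>j\<in>S1. homogeneous 0 (u j)) \<and>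
      (\<forall>s\<in>S0. (\<Sum>j\<in>S1. M s j * \<tau> j b) = h * (\<Sum>j\<in>S1. M s j * u j))"
      unfolding M\<tau> by (intro exI[of _ u]) simp
  qed
  from bchoice[OF this] obtain u where "\<forall>b\<in>B. (\<forall>j\<in>S1. homogeneous 0 (u b j)) \<and>
      (\<forall>s\<in>S0. (\<Sum>j\<in>S1. M s j * \<tau> j b) = h * (\<Sum>j\<in>S1. M s j * u b j))" ..
  then have u: "\<And>b j. b \<in> B \<Longrightarrow> j \<in> S1 \<Longrightarrow> homogeneous 0 (u b j)"
    "\<And>b s. b \<in> B \<Longrightarrow> s \<in> S0 \<Longrightarrow> (\<Sum>j\<in>S1. M s j * \<tau> j b) = h * (\<Sum>j\<in>S1. M s j * u b j)" by simp_all
  define N where "N j b = \<tau> j b - h * u b j" for j b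
  have homN: "homogeneous 1 (N j b)" if "j \<in> S1" "b \<in> B" for j b
    unfolding N_def using u(1)[OF that(2,1)] by (intro homogeneous_diff hom\<tau> hom_h_mult) simp
  have Nmod: "h dvd N j b - \<tau> j b" for j b by (simp add: N_def)
  have complexN: "(\<Sum>j\<in>S1. M s j * N j b) = 0" if "s \<in> S0" "b \<in> B" for s b
    using u(2)[OF that(2,1)] by (simp add: N_def right_diff_distrib sum_subtractf sum_distrib_left mult.left_commute)
  have \<tau>_rows: "(\<Sum>b'\<in>B. \<tau> (Inr (Inl b)) b' * r b') = z * r b" "(\<Sum>b'\<in>B. \<tau> (Inr (Inr b)) b' * r b') = - (y * r b)"
    if "b \<in> B" for b r
  proof -
    have "(\<Sum>b'\<in>B. \<tau> (Inr (Inl b)) b' * r b') = (\<Sum>b'\<in>B. if b = b' then z * r b' else 0)"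
      "(\<Sum>b'\<in>B. \<tau> (Inr (Inr b)) b' * r b') = (\<Sum>b'\<in>B. if b = b' then - (y * r b') else 0)"
      by (intro sum.cong, auto simp: \<tau>_def)+
    then show "(\<Sum>b'\<in>B. \<tau> (Inr (Inl b)) b' * r b') = z * r b" "(\<Sum>b'\<in>B. \<tau> (Inr (Inr b)) b' * r b') = - (y * r b)"
      using that finB by simp_all
  qed
  have exact2_mod: "\<exists>r. (\<forall>b\<in>B. homogeneous (t - 1) (r b)) \<and> (\<forall>j\<in>S1. h dvd x j - (\<Sum>b\<in>B. N j b * r b))"
    if x: "\<And>j. j \<in> S1 \<Longrightarrow> homogeneous t (x j)" and 0: "\<And>s. s \<in> S0 \<Longrightarrow> (\<Sum>j\<in>S1. M s j * x j) = 0" for t x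
  proof -
    have mod0: "h dvd (\<Sum>j\<in>S1. \<sigma> s j * x j)" if "s \<in> S0" for s
    proof -
      have "h dvd (\<Sum>j\<in>S1. \<sigma> s j * x j) - (\<Sum>j\<in>S1. M s j * x j)"
        by (rule dvd_sum_cong) (rule dvd_diff_sym[OF Mmod])
      then show ?thesis using 0[OF that] by simp
    qed
    have xI: "h dvd x (Inl i)" if "i < k" for i
      using that
    proof (induction i)
      case 0
      have "h dvd (\<Sum>j\<in>S1. \<sigma> (Inl 0) j * x j)" by (rule mod0) (auto simp: S0_def)
      then have "h dvd y * x (Inl 0)" using 0 by (simp add: \<sigma>_rows)
      then show ?case by (rule y_cancel[rotated, of _ t]) (use x 0 in \<open>auto simp: S1_def\<close>)
    next
      case (Suc i)
      have "h dvd (\<Sum>j\<in>S1. \<sigma> (Inl (Suc i)) j * x j)" by (rule mod0) (use Suc in \<open>auto simp: S0_def\<close>)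
      then have "h dvd z * x (Inl i) - y * x (Inl (Suc i))" using Suc.prems by (simp add: \<sigma>_rows)
      moreover have "h dvd z * x (Inl i)" using Suc by simp
      ultimately have "h dvd y * x (Inl (Suc i))" using dvd_minus_iff by blast
      then show ?case by (rule y_cancel[rotated, of _ t]) (use x Suc in \<open>auto simp: S1_def\<close>)
    qed
    have "\<exists>r. homogeneous (t - 1) r \<and> h dvd x (Inr (Inl b)) - z * r \<and> h dvd x (Inr (Inr b)) + y * r"
      if b: "b \<in> B" for b
    proof -
      have "h dvd y * x (Inr (Inl b)) + z * x (Inr (Inr b))"
        using mod0[of "Inr b"] b unfolding S0_def by (auto simp: \<sigma>_rows')
      then show ?thesis
        by (rule koszul[rotated 2, of _ _ t]) (use x b in \<open>auto simp: S1_def\<close>)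
    qed
    then obtain r where r: "\<And>b. b \<in> B \<Longrightarrow> homogeneous (t - 1) (r b)"
      "\<And>b. b \<in> B \<Longrightarrow> h dvd x (Inr (Inl b)) - z * r b" "\<And>b. b \<in> B \<Longrightarrow> h dvd x (Inr (Inr b)) + y * r b"
      by metis
    have "h dvd x j - (\<Sum>b\<in>B. \<tau> j b * r b)" if j: "j \<in> S1" for j
    proof -
      consider (1) i where "j = Inl i" "i < k" | (2) b where "j = Inr (Inl b)" "b \<in> B"
        | (3) b where "j = Inr (Inr b)" "b \<in> B"
        using j by (auto simp: S1_def)
      then show ?thesis
      proof cases
        case 1 then show ?thesis using xI by (simp add: \<tau>_def)
      next
        case 2 then show ?thesis using r(2) by (simp add: \<tau>_rows)
      next
        case 3 then show ?thesis using r(3) by (simp add: \<tau>_rows)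
      qed
    qed
    moreover have "h dvd (\<Sum>b\<in>B. \<tau> j b * r b) - (\<Sum>b\<in>B. N j b * r b)" for j
      by (rule dvd_sum_cong) (rule dvd_diff_sym[OF Nmod])
    ultimately have "\<forall>j\<in>S1. h dvd x j - (\<Sum>b\<in>B. N j b * r b)" using dvd_diff_trans by blast
    then show ?thesis using r(1) by (intro exI[of _ r] conjI) auto
  qed
  have exact2: "\<exists>u. (\<forall>b\<in>B. homogeneous (t - 1) (u b)) \<and> (\<forall>j\<in>S1. x j = (\<Sum>b\<in>B. N j b * u b))"
    if x: "\<And>j. j \<in> S1 \<Longrightarrow> homogeneous t (x j)" and 0: "\<And>s. s \<in> S0 \<Longrightarrow> (\<Sum>j\<in>S1. M s j * x j) = 0" for t x
    by (rule lift_exact[where A = M and Q = S0, OF homN complexN exact2_mod x 0]) auto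

  have exact3: "\<forall>b\<in>B. x b = 0"
    if x: "\<And>b. b \<in> B \<Longrightarrow> homogeneous t (x b)" and 0: "\<And>j. j \<in> S1 \<Longrightarrow> (\<Sum>b\<in>B. N j b * x b) = 0" for t x
  proof -
    have "\<exists>u. (\<forall>j\<in>({} :: unit set). homogeneous (t - 1) (u j)) \<and> (\<forall>b\<in>B. x b = (\<Sum>j\<in>({} :: unit set). 0 * u j))"
    proof (rule lift_exact[where A = N and Q = S1, OF _ _ _ x 0])
      fix t x assume x: "\<And>b. b \<in> B \<Longrightarrow> homogeneous t (x b)" and 0: "\<And>j. j \<in> S1 \<Longrightarrow> (\<Sum>b\<in>B. N j b * x b) = 0"
      have "h dvd x b" if b: "b \<in> B" for b
      proof -
        have j: "Inr (Inl b) \<in> S1" using b by (auto simp: S1_def)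
        have "h dvd (\<Sum>b'\<in>B. \<tau> (Inr (Inl b)) b' * x b') - (\<Sum>b'\<in>B. N (Inr (Inl b)) b' * x b')"
          by (rule dvd_sum_cong) (rule dvd_diff_sym[OF Nmod])
        then have "h dvd z * x b" using 0[OF j] b by (simp add: \<tau>_rows)
        then show ?thesis using z_cancel[OF x[OF b]] by blast
      qed
      then show "\<exists>u. (\<forall>j\<in>({} :: unit set). homogeneous (t - 1) (u j)) \<and> (\<forall>b\<in>B. h dvd x b - (\<Sum>j\<in>({} :: unit set). 0 * u j))"
        by simp
    qed auto
    then show ?thesis by simp
  qed

  have gen: "ideal_gen V = ideal_gen (e ` S0)"
  proof (rule equalityI)
    show "ideal_gen (e ` S0) \<subseteq> ideal_gen V" using eV by (intro ring.span_mono) auto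
    have "v \<in> ideal_gen (e ` S0)" if "v \<in> V" for v
    proof -
      obtain c where "v = (\<Sum>s\<in>S0. e s * const_poly (c s))" using combo[OF \<open>v \<in> V\<close>] ..
      then show ?thesis
        unfolding ideal_gen_image[OF fin(1)] by (intro CollectI exI[of _ "\<lambda>s. const_poly (c s)"]) simp
    qed
    then show "ideal_gen V \<subseteq> ideal_gen (e ` S0)" by (intro ring.span_minimal) auto
  qed
  obtain sh \<phi> where res: "minimal_graded_free_resolution (ideal_gen V) sh \<phi>"
    "set (sh 0) = (\<lambda>_. int k) ` S0" "set (sh 1) = (\<lambda>_. int k + 1) ` S1" "set (sh 2) = (\<lambda>_. int k + 2) ` B"
    "\<And>j. j > 2 \<Longrightarrow> sh j = []"
  proof (rule resolution_from_sets[OF fin finB gen, of "\<lambda>_. int k" "\<lambda>_. int k + 1" M "\<lambda>_. int k + 2" N])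
    show "homogeneous (int k) (e s)" if "s \<in> S0" for s using homV eV that by blast
    show "homogeneous (int k + 1 - int k) (M s j)" for s j using homM by simp
    show "homogeneous (int k + 2 - (int k + 1)) (N j b)" if "j \<in> S1" "b \<in> B" for j b using homN that by simp
    show "M s j \<in> irrelevant_ideal" for s j by (rule homogeneous_pos_irrelevant[OF homM]) simp
    show "N j b \<in> irrelevant_ideal" if "j \<in> S1" "b \<in> B" for j b
      by (rule homogeneous_pos_irrelevant[OF homN[OF that]]) simp
    show "\<exists>u. \<forall>s\<in>S0. x s = (\<Sum>j\<in>S1. M s j * u j)"
      if "\<And>s. s \<in> S0 \<Longrightarrow> homogeneous (t - int k) (x s)" "(\<Sum>s\<in>S0. e s * x s) = 0" for t x
      using exact1[OF that] by blast
    show "\<exists>u. \<forall>j\<in>S1. x j = (\<Sum>b\<in>B. N j b * u b)"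
      if "\<And>j. j \<in> S1 \<Longrightarrow> homogeneous (t - (int k + 1)) (x j)" "\<And>s. s \<in> S0 \<Longrightarrow> (\<Sum>j\<in>S1. M s j * x j) = 0" for t x
      using exact2[OF that] by blast
    show "\<forall>b\<in>B. x b = 0"
      if "\<And>b. b \<in> B \<Longrightarrow> homogeneous (t - (int k + 2)) (x b)" "\<And>j. j \<in> S1 \<Longrightarrow> (\<Sum>b\<in>B. N j b * x b) = 0" for t x
      by (rule exact3[OF that])
  qed (use complexM complexN in auto)
  have "\<forall>d\<in>set (sh j). d = int k + int j" for j
  proof -
    consider "j = 0" | "j = 1" | "j = 2" | "j > 2" by linarith
    then show ?thesis by cases (use res in auto)
  qed
  then show ?thesis unfolding has_linear_resolution_def using res(1) by blast
qed

end

section \<open>Products of lifted monomials\<close>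

lemma ideal_gen_mult:
  "ideal_gen {f * g | f g. f \<in> ideal_gen A \<and> g \<in> ideal_gen B} = ideal_gen {a * b | a b. a \<in> A \<and> b \<in> B}"
  (is "?L = ideal_gen ?P")
proof (rule equalityI)
  show "ideal_gen ?P \<subseteq> ?L"
    by (intro ring.span_mono) (blast intro: ring.span_base)
  have 1: "a * g \<in> ideal_gen ?P" if "a \<in> A" "g \<in> ideal_gen B" for a g
    using that(2)
  proof (induction rule: ring.span_induct_alt)
    case (step c b g)
    have "a * b \<in> ideal_gen ?P" using step(1) that(1) by (intro ring.span_base) blast
    from ring.span_add[OF ring.span_scale[OF this] step(2)]
    have "c * (a * b) + a * g \<in> ideal_gen ?P" .
    then show ?case by (simp add: algebra_simps)
  qed (simp add: ring.span_zero)
  have 2: "f * g \<in> ideal_gen ?P" if "f \<in> ideal_gen A" "g \<in> ideal_gen B" for f g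
    using that(1)
  proof (induction rule: ring.span_induct_alt)
    case (step c a f)
    from ring.span_add[OF ring.span_scale[OF 1[OF step(1) that(2)]] step(2)]
    have "c * (a * g) + f * g \<in> ideal_gen ?P" .
    then show ?case by (simp add: algebra_simps)
  qed (simp add: ring.span_zero)
  show "?L \<subseteq> ideal_gen ?P" by (intro ring.span_minimal) (use 2 in auto)
qed

text \<open>
  If \<open>f i\<close> lifts \<open>y^i z^(d-i)\<close>, then the weight, which is the sum of the indices, is the exponent
  of \<open>y\<close> in the residue of the product.
\<close>

inductive weighted_product :: "(nat \<Rightarrow> 'a::comm_ring_1) \<Rightarrow> nat \<Rightarrow> nat \<Rightarrow> nat \<Rightarrow> 'a \<Rightarrow> bool" for f d where
  empty: "weighted_product f d 0 0 1"
| factor: "i \<le> d \<Longrightarrow> weighted_product f d m w p \<Longrightarrow> weighted_product f d (Suc m) (i + w) (f i * p)"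

lemma weighted_product_Suc_iff:
  "weighted_product f d (Suc m) w p \<longleftrightarrow> (\<exists>i v q. i \<le> d \<and> w = i + v \<and> p = f i * q \<and> weighted_product f d m v q)"
  by (subst weighted_product.simps) auto

lemma weighted_product_0_iff: "weighted_product f d 0 w p \<longleftrightarrow> w = 0 \<and> p = 1"
  by (subst weighted_product.simps) auto

lemma weighted_product_exists: "w \<le> d * m \<Longrightarrow> \<exists>p. weighted_product f d m w p"
proof (induction m arbitrary: w)
  case (Suc m)
  have "w - min d w \<le> d * m" using Suc.prems by auto
  then obtain p where "weighted_product f d m (w - min d w) p" using Suc.IH by blast
  then have "weighted_product f d (Suc m) (min d w + (w - min d w)) (f (min d w) * p)"
    by (intro weighted_product.factor) auto
  then show ?case by auto
qed (auto simp: weighted_product_0_iff)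

text \<open>
  A product of positive weight has a factor of positive index. It is written in front, so that it
  can take part in an exchange.
\<close>

lemma weighted_product_decrease:
  assumes "weighted_product f d m w p" "w > 0"
  obtains i m' w' q where "m = Suc m'" "i < d" "w = Suc i + w'" "weighted_product f d m' w' q" "p = f (Suc i) * q"
proof -
  have "\<exists>i m' w' q. m = Suc m' \<and> i < d \<and> w = Suc i + w' \<and> weighted_product f d m' w' q \<and> p = f (Suc i) * q"
    using assms
  proof (induction rule: weighted_product.induct)
    case (factor i m w p)
    show ?case
    proof (cases i)
      case 0
      then obtain i' m' w' q where q: "m = Suc m'" "i' < d" "w = Suc i' + w'" "weighted_product f d m' w' q"
        "p = f (Suc i') * q" using factor by auto
      then have "weighted_product f d (Suc m') (0 + w') (f 0 * q)" by (intro weighted_product.factor) auto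
      with q 0 show ?thesis
        by (intro exI[of _ i'] exI[of _ m] exI[of _ w'] exI[of _ "f 0 * q"]) (auto simp: algebra_simps)
    next
      case (Suc i')
      with factor show ?thesis by (intro exI[of _ i'] exI[of _ m] exI[of _ w] exI[of _ p]) auto
    qed
  qed simp
  then show thesis using that by blast
qed

lemma ideal_power_weighted_products:
  "ideal_power (ideal_gen (f ` {..d})) m = ideal_gen {p. \<exists>w. weighted_product f d m w p}"
proof (induction m)
  case 0
  have "g \<in> ideal_gen {p. \<exists>w. weighted_product f d 0 w p}" for g :: 'a
  proof -
    have "g * 1 \<in> ideal_gen {p. \<exists>w. weighted_product f d 0 w p}"
      by (intro ring.span_scale ring.span_base) (auto simp: weighted_product_0_iff)
    then show ?thesis by simp
  qed
  then show ?case by auto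
next
  case (Suc m)
  have "{a * b | a b. a \<in> f ` {..d} \<and> b \<in> {p. \<exists>w. weighted_product f d m w p}}
    = {p. \<exists>w. weighted_product f d (Suc m) w p}"
    by (auto simp: weighted_product_Suc_iff)
  then show ?case by (simp add: Suc ideal_mult_def ideal_gen_mult)
qed

context plane_coords
begin

text \<open>
  If \<open>V\<close> generates the ideal \<open>J\<close>, these elements have residues in \<open>J / h J\<close> that are killed by \<open>y\<close>
  and \<open>z\<close>.
\<close>

definition torsion_elements :: "'k poly3 set \<Rightarrow> 'k poly3 set" where
  "torsion_elements V = {g \<in> V. (\<exists>v\<in>V. y * g = h * v) \<and> (\<exists>v\<in>V. z * g = h * v)}"

lemma torsion_elements_subspace:
  assumes V: "poly_vs.subspace V" shows "poly_vs.subspace (torsion_elements V)"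
proof (rule poly_vs.subspaceI)
  show "0 \<in> torsion_elements V"
    using poly_vs.subspace_0[OF V] by (auto simp: torsion_elements_def intro!: bexI[of _ 0])
next
  fix a b assume "a \<in> torsion_elements V" "b \<in> torsion_elements V"
  then obtain a1 a2 b1 b2 where ab: "a \<in> V" "b \<in> V" "a1 \<in> V" "a2 \<in> V" "b1 \<in> V" "b2 \<in> V"
    "y * a = h * a1" "z * a = h * a2" "y * b = h * b1" "z * b = h * b2"
    unfolding torsion_elements_def by blast
  then have "y * (a + b) = h * (a1 + b1)" "z * (a + b) = h * (a2 + b2)" by (simp_all add: distrib_left)
  then show "a + b \<in> torsion_elements V"
    unfolding torsion_elements_def using ab poly_vs.subspace_add[OF V] by blast
next
  fix c a assume "a \<in> torsion_elements V"
  then obtain a1 a2 where a: "a \<in> V" "a1 \<in> V" "a2 \<in> V" "y * a = h * a1" "z * a = h * a2"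
    unfolding torsion_elements_def by blast
  then have "y * (const_poly c * a) = h * (const_poly c * a1)" "z * (const_poly c * a) = h * (const_poly c * a2)"
    by (metis mult.left_commute)+
  then show "const_poly c * a \<in> torsion_elements V"
    unfolding torsion_elements_def using a poly_vs.subspace_scale[OF V] by blast
qed

end

text \<open>
  The polynomials \<open>f i\<close> lift the monomials of degree \<open>d\<close>, and the relations between neighbouring
  monomials lift to linear relations between them.
\<close>

locale binary_lifts = plane_coords h y z for h y z :: "'k::field poly3" +
  fixes f :: "nat \<Rightarrow> 'k poly3" and d :: nat
  assumes hom_f: "i \<le> d \<Longrightarrow> homogeneous (int d) (f i)"
    and f_mod: "i \<le> d \<Longrightarrow> h dvd f i - y ^ i * z ^ (d - i)"
    and f_step: "i < d \<Longrightarrow> \<exists>c. z * f (Suc i) - y * f i = h * (\<Sum>j\<le>d. const_poly (c j) * f j)"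
begin

abbreviation "wp \<equiv> weighted_product f d"

definition product_space :: "nat \<Rightarrow> 'k poly3 set" where
  "product_space m = poly_vs.span {p. \<exists>w. wp m w p}"

lemma product_space_subspace [simp]: "poly_vs.subspace (product_space m)"
  by (simp add: product_space_def poly_vs.subspace_span)

lemma wp_in_product_space: "wp m w p \<Longrightarrow> p \<in> product_space m"
  unfolding product_space_def by (intro poly_vs.span_base) auto

lemma wp_mod:
  assumes "wp m w p"
  shows "homogeneous (int (d * m)) p \<and> w \<le> d * m \<and> h dvd p - y ^ w * z ^ (d * m - w)"
  using assms
proof (induction rule: weighted_product.induct)
  case (factor i m w p)
  have "homogeneous (int d + int (d * m)) (f i * p)"
    using factor by (intro homogeneous_mult hom_f) auto
  moreover have "h dvd (f i - y ^ i * z ^ (d - i)) * p + (y ^ i * z ^ (d - i)) * (p - y ^ w * z ^ (d * m - w))"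
    using factor f_mod[of i] by simp
  then have "h dvd f i * p - (y ^ i * y ^ w) * (z ^ (d - i) * z ^ (d * m - w))"
    by (simp add: algebra_simps)
  then have "h dvd f i * p - y ^ (i + w) * z ^ (d - i + (d * m - w))"
    by (simp only: power_add)
  moreover have "d - i + (d * m - w) = d * Suc m - (i + w)" using factor by auto
  ultimately show ?case using factor by auto
qed simp

lemma product_space_homogeneous:
  assumes "v \<in> product_space m" shows "homogeneous (int (d * m)) v"
  using assms unfolding product_space_def
proof (induction rule: poly_vs.span_induct_alt)
  case (step c x v)
  then show ?case using wp_mod by (intro homogeneous_add homogeneous_const_mult) auto
qed simp

lemma factor_product_space:
  assumes i: "i \<le> d" and v: "v \<in> product_space m" shows "f i * v \<in> product_space (Suc m)"
  using v unfolding product_space_def[of m]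
proof (induction rule: poly_vs.span_induct_alt)
  case base
  then show ?case by (simp add: poly_vs.subspace_0)
next
  case (step c x v)
  then have "const_poly c * (f i * x) + f i * v \<in> product_space (Suc m)"
    using weighted_product.factor[OF i, of f m _ x]
    by (intro poly_vs.subspace_add poly_vs.subspace_scale product_space_subspace)
      (auto intro: wp_in_product_space)
  then show ?case by (simp add: algebra_simps)
qed

lemma factor_step:
  assumes "wp m w q" "i < d"
  obtains v where "v \<in> product_space (Suc m)" "z * (f (Suc i) * q) - y * (f i * q) = h * v"
proof -
  obtain c where c: "z * f (Suc i) - y * f i = h * (\<Sum>j\<le>d. const_poly (c j) * f j)"
    using f_step[OF assms(2)] ..
  define v where "v = (\<Sum>j\<le>d. const_poly (c j) * (f j * q))"
  have "z * (f (Suc i) * q) - y * (f i * q) = (z * f (Suc i) - y * f i) * q" by (simp add: algebra_simps)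
  also have "\<dots> = h * v" by (simp add: c v_def sum_distrib_right mult.assoc)
  finally have "z * (f (Suc i) * q) - y * (f i * q) = h * v" .
  moreover have "v \<in> product_space (Suc m)"
    unfolding v_def using assms(1)
    by (intro poly_vs.subspace_sum poly_vs.subspace_scale product_space_subspace factor_product_space)
      (auto intro: wp_in_product_space)
  ultimately show thesis using that by blast
qed

text \<open>
  Multiplied by \<open>y\<close> or by \<open>z\<close>, the two products agree up to \<open>h\<close> times elements of the product
  space: with \<open>y\<close>, both agree with \<open>z f(i+1) f(j+1) q\<close>, and with \<open>z\<close>, both agree with
  \<open>y f(i) f(j) q\<close>.
\<close>

lemma exchange:
  assumes q: "wp m w q" and "i < d" "j < d"
  shows "f i * (f (Suc j) * q) - f (Suc i) * (f j * q) \<in> torsion_elements (product_space (Suc (Suc m)))"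
proof -
  have fq: "wp (Suc m) (l + w) (f l * q)" if "l \<le> d" for l using that q by (rule weighted_product.factor)
  obtain v1 where v1: "v1 \<in> product_space (Suc (Suc m))"
    "z * (f (Suc i) * (f (Suc j) * q)) - y * (f i * (f (Suc j) * q)) = h * v1"
    by (rule factor_step[OF fq[of "Suc j"] \<open>i < d\<close>]) (use assms in auto)
  obtain v2 where v2: "v2 \<in> product_space (Suc (Suc m))"
    "z * (f (Suc j) * (f (Suc i) * q)) - y * (f j * (f (Suc i) * q)) = h * v2"
    by (rule factor_step[OF fq[of "Suc i"] \<open>j < d\<close>]) (use assms in auto)
  obtain v3 where v3: "v3 \<in> product_space (Suc (Suc m))"
    "z * (f (Suc j) * (f i * q)) - y * (f j * (f i * q)) = h * v3"
    by (rule factor_step[OF fq[of i] \<open>j < d\<close>]) (use assms in auto)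
  obtain v4 where v4: "v4 \<in> product_space (Suc (Suc m))"
    "z * (f (Suc i) * (f j * q)) - y * (f i * (f j * q)) = h * v4"
    by (rule factor_step[OF fq[of j] \<open>i < d\<close>]) (use assms in auto)
  let ?g = "f i * (f (Suc j) * q) - f (Suc i) * (f j * q)"
  have "y * ?g = (z * (f (Suc j) * (f (Suc i) * q)) - y * (f j * (f (Suc i) * q)))
      - (z * (f (Suc i) * (f (Suc j) * q)) - y * (f i * (f (Suc j) * q)))"
    by (simp add: algebra_simps)
  then have "y * ?g = h * (v2 - v1)" unfolding v1 v2 by (simp add: right_diff_distrib)
  moreover have "z * ?g = (z * (f (Suc j) * (f i * q)) - y * (f j * (f i * q)))
      - (z * (f (Suc i) * (f j * q)) - y * (f i * (f j * q)))"
    by (simp add: algebra_simps)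
  then have "z * ?g = h * (v3 - v4)" unfolding v3 v4 by (simp add: right_diff_distrib)
  moreover have "?g \<in> product_space (Suc (Suc m))"
    using assms by (intro poly_vs.subspace_diff product_space_subspace factor_product_space wp_in_product_space[OF q]) auto
  ultimately show ?thesis
    unfolding torsion_elements_def
    using poly_vs.subspace_diff[OF product_space_subspace v2(1) v1(1)]
      poly_vs.subspace_diff[OF product_space_subspace v3(1) v4(1)] by blast
qed

lemma factor_torsion:
  assumes i: "i \<le> d" and g: "g \<in> torsion_elements (product_space m)"
  shows "f i * g \<in> torsion_elements (product_space (Suc m))"
proof -
  obtain a b where ab: "g \<in> product_space m" "a \<in> product_space m" "b \<in> product_space m"
    "y * g = h * a" "z * g = h * b"
    using g unfolding torsion_elements_def by blast
  have "y * (f i * g) = h * (f i * a)" "z * (f i * g) = h * (f i * b)"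
    using ab(4,5) by (metis mult.left_commute)+
  then show ?thesis
    unfolding torsion_elements_def using ab factor_product_space[OF i] by blast
qed

text \<open>
  Let the first factors have indices \<open>i\<close> and \<open>i + s\<close>. If \<open>s > 0\<close>, the cofactor of \<open>f i\<close> has positive
  weight, and an exchange with one of its factors raises \<open>i\<close> by one. So \<open>s\<close> can be
  brought down to zero, where the common factor splits off and induction on the number of
  factors applies.
\<close>

lemma same_weight_torsion:
  assumes "wp m w p" "wp m w p'" shows "p - p' \<in> torsion_elements (product_space m)"
  using assms
proof (induction m arbitrary: w p p')
  case 0
  then show ?case
    using poly_vs.subspace_0[OF torsion_elements_subspace[OF product_space_subspace[of 0]]]
    by (simp add: weighted_product_0_iff)
next
  case (Suc m)
  \<comment> \<open>The factor indices differ by \<open>s\<close>; the case of the opposite order follows by a change of sign.\<close>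
  have main: "f i * q - f (i + s) * q' \<in> torsion_elements (product_space (Suc m))"
    if "wp m v q" "wp m v' q'" "v = s + v'" "i + s \<le> d" for i s q v q' v'
    using that
  proof (induction s arbitrary: i q v)
    case 0
    then have "q - q' \<in> torsion_elements (product_space m)" using Suc.IH by auto
    then have "f i * (q - q') \<in> torsion_elements (product_space (Suc m))"
      using 0 by (intro factor_torsion) auto
    then show ?case by (simp add: right_diff_distrib)
  next
    case (Suc s)
    then have "v > 0" by simp
    then obtain j m' w' r where r: "m = Suc m'" "j < d" "v = Suc j + w'" "wp m' w' r" "q = f (Suc j) * r"
      using weighted_product_decrease[OF Suc.prems(1)] by metis
    have 1: "f i * q - f (Suc i) * (f j * r) \<in> torsion_elements (product_space (Suc m))"
      unfolding r using r(4,2) Suc.prems(4) by (intro exchange) auto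
    have "wp m (j + w') (f j * r)" unfolding r(1) using r(2,4) by (intro weighted_product.factor) auto
    then have 2: "f (Suc i) * (f j * r) - f (Suc i + s) * q' \<in> torsion_elements (product_space (Suc m))"
      using r Suc.prems by (intro Suc.IH[of "j + w'"]) auto
    have "(f i * q - f (Suc i) * (f j * r)) + (f (Suc i) * (f j * r) - f (Suc i + s) * q')
       \<in> torsion_elements (product_space (Suc m))"
      by (rule poly_vs.subspace_add[OF torsion_elements_subspace[OF product_space_subspace] 1 2])
    then show ?case by simp
  qed
  obtain i v q where q: "i \<le> d" "w = i + v" "p = f i * q" "wp m v q"
    using Suc.prems(1) unfolding weighted_product_Suc_iff by blast
  obtain i' v' q' where q': "i' \<le> d" "w = i' + v'" "p' = f i' * q'" "wp m v' q'"
    using Suc.prems(2) unfolding weighted_product_Suc_iff by blast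
  show ?case
  proof (cases "i \<le> i'")
    case True
    then show ?thesis using main[OF q(4) q'(4), of "i' - i" i] q q' by simp
  next
    case False
    then have "p' - p \<in> torsion_elements (product_space (Suc m))"
      using main[OF q'(4) q(4), of "i - i'" i'] q q' by simp
    then have "- (p' - p) \<in> torsion_elements (product_space (Suc m))"
      by (intro poly_vs.subspace_neg torsion_elements_subspace product_space_subspace)
    then show ?thesis by simp
  qed
qed

text \<open>
  Modulo torsion elements, every product may be replaced by a fixed representative of its weight.
  The representatives have linearly independent residues modulo \<open>h\<close>, and torsion elements are
  divisible by \<open>h\<close>, so an element divisible by \<open>h\<close> involves no representative.
\<close>

lemma torsion_if_dvd:
  assumes b: "b \<in> product_space m" and hb: "h dvd b"
  shows "b \<in> torsion_elements (product_space m)"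
proof -
  let ?T = "torsion_elements (product_space m)"
  have T: "poly_vs.subspace ?T" by (rule torsion_elements_subspace) simp
  have "\<exists>P. \<forall>w. w \<le> d * m \<longrightarrow> wp m w (P w)"
    using weighted_product_exists[of _ d m f] by metis
  then obtain P where P: "\<And>w. w \<le> d * m \<Longrightarrow> wp m w (P w)" by blast
  have "\<exists>c. b - (\<Sum>w\<le>d * m. const_poly (c w) * P w) \<in> ?T"
    using b[unfolded product_space_def]
  proof (induction rule: poly_vs.span_induct_alt)
    case base
    show ?case using poly_vs.subspace_0[OF T] by (intro exI[of _ "\<lambda>_. 0"]) simp
  next
    case (step a p b)
    then obtain v where v: "wp m v p" by blast
    obtain c where c: "b - (\<Sum>w\<le>d * m. const_poly (c w) * P w) \<in> ?T" using step.IH ..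
    have vle: "v \<le> d * m" using wp_mod[OF v] by blast
    define c' where "c' = (\<lambda>w. c w + (if w = v then a else 0))"
    have "(\<Sum>w\<le>d * m. const_poly (c' w) * P w)
       = (\<Sum>w\<le>d * m. const_poly (c w) * P w + (if w = v then const_poly a * P w else 0))"
      by (intro sum.cong) (auto simp: c'_def single_add distrib_right)
    also have "\<dots> = (\<Sum>w\<le>d * m. const_poly (c w) * P w) + const_poly a * P v"
      using vle by (simp add: sum.distrib)
    finally have "const_poly a * p + b - (\<Sum>w\<le>d * m. const_poly (c' w) * P w)
       = const_poly a * (p - P v) + (b - (\<Sum>w\<le>d * m. const_poly (c w) * P w))"
      by (simp add: algebra_simps)
    also have "\<dots> \<in> ?T"
      using same_weight_torsion[OF v P[OF vle]] c
      by (intro poly_vs.subspace_add[OF T] poly_vs.subspace_scale[OF T])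
    finally show ?case by (intro exI[of _ c'])
  qed
  then obtain c where c: "b - (\<Sum>w\<le>d * m. const_poly (c w) * P w) \<in> ?T" ..
  let ?s = "\<Sum>w\<le>d * m. const_poly (c w) * P w"
  from c obtain v where v: "y * (b - ?s) = h * v" "b - ?s \<in> product_space m"
    unfolding torsion_elements_def by blast
  have "h dvd b - ?s" using y_cancel[OF product_space_homogeneous[OF v(2)]] v(1) by simp
  then have "h dvd ?s" using hb dvd_minus_iff by blast
  moreover have "h dvd (\<Sum>w\<le>d * m. const_poly (c w) * (P w - y ^ w * z ^ (d * m - w)))"
    using wp_mod[OF P] by (intro dvd_sum) auto
  then have "h dvd ?s - binary_form (d * m) c"
    by (simp add: binary_form_def right_diff_distrib sum_subtractf)
  ultimately have "h dvd binary_form (d * m) c" using dvd_minus_iff by blast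
  then have "c w = 0" if "w \<le> d * m" for w using binary_form_zero that by blast
  then have "?s = 0" by (intro sum.neutral) auto
  with c show ?thesis by simp
qed

lemma power_linear_resolution:
  assumes "m \<ge> 1"
  shows "has_linear_resolution (ideal_power (ideal_gen (f ` {..d})) m)"
proof -
  have "has_linear_resolution (ideal_gen (product_space m))"
  proof (rule linear_resolution[of _ "d * m"])
    fix i assume "i \<le> d * m"
    then obtain p where "wp m i p" using weighted_product_exists by blast
    then show "\<exists>w\<in>product_space m. h dvd w - y ^ i * z ^ (d * m - i)"
      using wp_mod wp_in_product_space by blast
  next
    fix b assume "b \<in> product_space m" "h dvd b"
    then show "(\<exists>v\<in>product_space m. y * b = h * v) \<and> (\<exists>v\<in>product_space m. z * b = h * v)"
      using torsion_if_dvd unfolding torsion_elements_def by blast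
  next
    fix i assume "i < d * m"
    then obtain p where p: "wp m (Suc i) p" using weighted_product_exists[of "Suc i" d m f] by auto
    then obtain j m' w' q where q: "m = Suc m'" "j < d" "Suc i = Suc j + w'" "wp m' w' q" "p = f (Suc j) * q"
      by (rule weighted_product_decrease) auto
    have p': "wp m i (f j * q)" using weighted_product.factor[of j d f m' w' q] q by simp
    obtain v where v: "v \<in> product_space m" "z * p - y * (f j * q) = h * v"
      using factor_step[OF q(4,2)] unfolding q(1,5) by blast
    show "\<exists>w\<in>product_space m. \<exists>w'\<in>product_space m. \<exists>v\<in>product_space m.
       h dvd w - y ^ i * z ^ (d * m - i) \<and> h dvd w' - y ^ Suc i * z ^ (d * m - Suc i) \<and> z * w' - y * w = h * v"
      using wp_mod[OF p] wp_mod[OF p'] wp_in_product_space[OF p] wp_in_product_space[OF p'] v by blast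
  qed (use product_space_homogeneous in simp_all)
  moreover have "ideal_gen (product_space m) = ideal_gen {p. \<exists>w. wp m w p}"
  proof (rule equalityI)
    have "v \<in> ideal_gen {p. \<exists>w. wp m w p}" if "v \<in> product_space m" for v
      using that unfolding product_space_def
      by (induction rule: poly_vs.span_induct_alt)
        (auto intro: ring.span_zero ring.span_add ring.span_scale ring.span_base)
    then show "ideal_gen (product_space m) \<subseteq> ideal_gen {p. \<exists>w. wp m w p}"
      by (intro ring.span_minimal) auto
    show "ideal_gen {p. \<exists>w. wp m w p} \<subseteq> ideal_gen (product_space m)"
      by (intro ring.span_mono) (auto intro: wp_in_product_space)
  qed
  ultimately show ?thesis by (simp add: ideal_power_weighted_products)
qed

end

section \<open>Generators of saturated ideals\<close>

lemma sum_fun_apply: "(\<Sum>v\<in>S. F v) g = (\<Sum>v\<in>S. F v g)"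
  for F :: "'i \<Rightarrow> 'a \<Rightarrow> 'b::comm_monoid_add"
  by (induction S rule: infinite_finite_induct) auto

interpretation fun_vs: vector_space "\<lambda>(c::'k::field) (v :: 'a \<Rightarrow> 'k) g. c * v g"
  by unfold_locales (auto simp: algebra_simps fun_eq_iff)

declare fun_vs.scale_scale [simp del]

context plane_coords
begin

text \<open>
  The scalar \<open>c\<close> is the coefficient of \<open>y^s\<close> in a form \<open>f\<close> of degree \<open>s\<close> modulo \<open>h\<close> and \<open>z\<close>. It
  is required to vanish in negative degrees, which makes it unique in all degrees.
\<close>

definition lead :: "int \<Rightarrow> 'k poly3 \<Rightarrow> 'k \<Rightarrow> bool" where
  "lead s f c \<longleftrightarrow> (if s < 0 then f = 0 \<and> c = 0 else
     \<exists>p q. homogeneous (s - 1) p \<and> homogeneous (s - 1) q \<and> f = const_poly c * y ^ nat s + h * p + z * q)"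

lemma lead_exists:
  assumes "homogeneous s f" shows "\<exists>c. lead s f c"
proof (cases "s < 0")
  case True
  then show ?thesis using homogeneous_neg[OF assms] by (auto simp: lead_def)
next
  case False
  then obtain n where n: "s = int n" by (metis int_nat_eq linorder_not_less)
  obtain c p q where "homogeneous (int n - 1) p" "homogeneous (int n - 1) q"
    "f = const_poly c * y ^ n + h * p + z * q" using lead_decomp assms n by blast
  then show ?thesis using n by (intro exI[of _ c]) (auto simp: lead_def)
qed

lemma lead_0 [simp]: "lead s 0 0"
  by (auto simp: lead_def intro!: exI[of _ 0])

lemma lead_add: "lead s f c \<Longrightarrow> lead s g e \<Longrightarrow> lead s (f + g) (c + e)"
proof (cases "s < 0")
  case False
  assume "lead s f c" "lead s g e"
  with False obtain p q p' q' where pq: "homogeneous (s - 1) p" "homogeneous (s - 1) q"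
    "homogeneous (s - 1) p'" "homogeneous (s - 1) q'"
    "f = const_poly c * y ^ nat s + h * p + z * q" "g = const_poly e * y ^ nat s + h * p' + z * q'"
    unfolding lead_def by auto
  then have "f + g = const_poly (c + e) * y ^ nat s + h * (p + p') + z * (q + q')"
    by (simp add: single_add algebra_simps)
  moreover have "homogeneous (s - 1) (p + p')" "homogeneous (s - 1) (q + q')"
    using pq by (auto intro: homogeneous_add)
  ultimately show ?thesis using False unfolding lead_def by auto
qed (auto simp: lead_def)

lemma lead_mult:
  assumes "lead s f c" "lead t g e" shows "lead (s + t) (f * g) (c * e)"
proof (cases "s < 0 \<or> t < 0")
  case True
  then have 0: "f * g = 0" "c * e = 0" using assms by (auto simp: lead_def)
  show ?thesis unfolding 0 by simp
next
  case False
  with assms obtain p q p' q' where pq: "homogeneous (s - 1) p" "homogeneous (s - 1) q"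
    "homogeneous (t - 1) p'" "homogeneous (t - 1) q'"
    "f = const_poly c * y ^ nat s + h * p + z * q" "g = const_poly e * y ^ nat t + h * p' + z * q'"
    unfolding lead_def by auto
  define a where "a = const_poly c * y ^ nat s"
  define b where "b = const_poly e * y ^ nat t"
  have ha: "homogeneous s a" and hb: "homogeneous t b"
    using False by (auto simp: a_def b_def intro!: homogeneous_const_mult homogeneous_power[OF hom_y])
  have "homogeneous (1 + (s - 1)) (h * p + z * q)"
    by (intro homogeneous_add homogeneous_mult hom_h hom_z pq)
  then have hf: "homogeneous s f" unfolding pq(5) a_def[symmetric] add.assoc
    using homogeneous_add[OF ha, of "h * p + z * q"] by simp
  have "f * g = a * b + h * (p * b + f * p') + z * (q * b + f * q')"
    unfolding pq(6) b_def[symmetric] by (subst (1) pq(5)) (simp add: a_def[symmetric] algebra_simps pq(5))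
  moreover have "a * b = const_poly (c * e) * y ^ nat (s + t)"
    using False by (simp add: a_def b_def nat_add_distrib power_add algebra_simps flip: const_poly_mult)
  moreover have "homogeneous (s + t - 1) (p * b + f * p')" "homogeneous (s + t - 1) (q * b + f * q')"
    by (intro homogeneous_add homogeneous_mult'[OF pq(1) hb] homogeneous_mult'[OF hf pq(3)]
        homogeneous_mult'[OF pq(2) hb] homogeneous_mult'[OF hf pq(4)]; simp)+
  ultimately show ?thesis using False unfolding lead_def by auto
qed

lemma lead_const: "lead 0 (const_poly c) c"
  unfolding lead_def by (auto intro!: exI[of _ 0])

lemma lead_y_power: "lead (int n) (y ^ n) 1"
  unfolding lead_def by (auto intro!: exI[of _ 0])

lemma lead_sum: "(\<And>i. i \<in> A \<Longrightarrow> lead s (F i) (C i)) \<Longrightarrow> lead s (\<Sum>i\<in>A. F i) (\<Sum>i\<in>A. C i)"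
  by (induction A rule: infinite_finite_induct) (auto intro: lead_add)

lemma lead_uminus: "lead s f c \<Longrightarrow> lead s (- f) (- c)"
  using lead_mult[OF lead_const[of "-1"], of s f c] by (simp add: single_uminus)

lemma lead_diff: "lead s f c \<Longrightarrow> lead s g e \<Longrightarrow> lead s (f - g) (c - e)"
  using lead_add[OF _ lead_uminus] by fastforce

lemma lead_zero_unique: "lead s 0 c \<Longrightarrow> c = 0"
proof (cases "s < 0")
  case False
  assume "lead s 0 c"
  then obtain p q where "0 = const_poly c * y ^ nat s + h * p + z * q"
    using False unfolding lead_def by auto
  then have "const_poly c * y ^ nat s = h * (- p) + z * (- q)" by (simp add: algebra_simps eq_neg_iff_add_eq_0)
  then show "c = 0" by (rule lead_unique)
qed (simp add: lead_def)

lemma lead_zeroE: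
  assumes "lead s f 0"
  obtains p q where "homogeneous (s - 1) p" "homogeneous (s - 1) q" "f = h * p + z * q"
  using assms that[of 0 0] unfolding lead_def by (auto split: if_splits)

text \<open>
  Taking the component of degree \<open>t\<close> does not change \<open>g\<close>, keeps \<open>f\<close> in the graded set \<open>I\<close>, and
  turns multiples of \<open>h\<close> into multiples of \<open>h\<close>.
\<close>

lemma dvd_homogeneous_lift:
  assumes g: "homogeneous t g" and f: "f \<in> I" "h dvd g - f"
    and comp: "\<And>f t. f \<in> I \<Longrightarrow> component t f \<in> I"
  shows "\<exists>f'\<in>I. homogeneous t f' \<and> h dvd g - f'"
proof (intro bexI conjI)
  show "component t f \<in> I" by (rule comp[OF f(1)])
  obtain q where "g - f = h * q" using f(2) by (elim dvdE)
  then have "g - component t f = h * component (t - 1) q"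
    by (metis component_diff component_mult_left[OF hom_h] component_same[OF g])
  then show "h dvd g - component t f" by simp
qed simp

end

text \<open>
  For the ideal of a set of points off the line \<open>h = 0\<close>, the last two axioms hold with products of
  lines through the points and through a fixed point of the line \<open>h = 0\<close>.
\<close>

locale saturated_ideal = plane_coords h y z for h y z :: "'k::field poly3" +
  fixes I :: "'k poly3 set" and N :: nat
  assumes ideal: "ring.subspace I"
    and graded: "f \<in> I \<Longrightarrow> component t f \<in> I"
    and saturated: "h * f \<in> I \<Longrightarrow> f \<in> I"
    and power_y: "\<exists>f\<in>I. h dvd y ^ N - f"
    and power_z: "\<exists>f\<in>I. h dvd z ^ N - f"
begin

lemma ideal_add: "f \<in> I \<Longrightarrow> g \<in> I \<Longrightarrow> f + g \<in> I"
  by (rule ring.subspace_add[OF ideal])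

lemma ideal_diff: "f \<in> I \<Longrightarrow> g \<in> I \<Longrightarrow> f - g \<in> I"
  by (rule ring.subspace_diff[OF ideal])

lemma ideal_mult_left: "g \<in> I \<Longrightarrow> f * g \<in> I"
  by (rule ring.subspace_scale[OF ideal])

lemma ideal_sum: "(\<And>i. i \<in> A \<Longrightarrow> F i \<in> I) \<Longrightarrow> (\<Sum>i\<in>A. F i) \<in> I"
  by (rule ring.subspace_sum[OF ideal])

text \<open>
  A monomial in \<open>y\<close> and \<open>z\<close> of degree at least \<open>2 N\<close> is divisible by \<open>y^N\<close> or by \<open>z^N\<close>.
\<close>

lemma large_degree:
  assumes g: "homogeneous t g" and t: "t \<ge> int (2 * N)"
  shows "\<exists>f\<in>I. homogeneous t f \<and> h dvd g - f"
proof -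
  define n where "n = nat t"
  have n: "t = int n" using t by (simp add: n_def)
  obtain F G where F: "F \<in> I" "h dvd y ^ N - F" and G: "G \<in> I" "h dvd z ^ N - G"
    using power_y power_z by blast
  obtain c where c: "h dvd g - binary_form n c" using binary_form_mod g n by blast
  have mon: "\<exists>f\<in>I. h dvd y ^ i * z ^ (n - i) - f" if "i \<le> n" for i
  proof (cases "i \<ge> N")
    case True
    then have yi: "y ^ i = y ^ (i - N) * y ^ N" by (simp flip: power_add)
    have "y ^ i * z ^ (n - i) - (y ^ (i - N) * z ^ (n - i)) * F = (y ^ (i - N) * z ^ (n - i)) * (y ^ N - F)"
      unfolding yi by (simp add: algebra_simps)
    then show ?thesis using F by (intro bexI[of _ "(y ^ (i - N) * z ^ (n - i)) * F"]) (auto intro: ideal_mult_left)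
  next
    case False
    then have "n - i \<ge> N" using t n that by simp
    then have zi: "z ^ (n - i) = z ^ (n - i - N) * z ^ N" by (metis le_add_diff_inverse2 power_add)
    have "y ^ i * z ^ (n - i) - (y ^ i * z ^ (n - i - N)) * G = (y ^ i * z ^ (n - i - N)) * (z ^ N - G)"
      unfolding zi by (simp add: algebra_simps)
    then show ?thesis using G by (intro bexI[of _ "(y ^ i * z ^ (n - i - N)) * G"]) (auto intro: ideal_mult_left)
  qed
  have "\<forall>i\<in>{..n}. \<exists>f. f \<in> I \<and> h dvd y ^ i * z ^ (n - i) - f" using mon by auto
  from bchoice[OF this] obtain E where E: "\<forall>i\<in>{..n}. E i \<in> I \<and> h dvd y ^ i * z ^ (n - i) - E i" ..
  define f where "f = (\<Sum>i\<le>n. const_poly (c i) * E i)"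
  have "f \<in> I" unfolding f_def using E by (intro ideal_sum ideal_mult_left) auto
  have "h dvd (\<Sum>i\<le>n. const_poly (c i) * (y ^ i * z ^ (n - i) - E i))" using E by (intro dvd_sum) auto
  then have "h dvd binary_form n c - f"
    by (simp add: binary_form_def f_def right_diff_distrib sum_subtractf)
  then have "h dvd g - f" using c dvd_diff_trans by blast
  then show ?thesis by (rule dvd_homogeneous_lift[OF g \<open>f \<in> I\<close>]) (rule graded)
qed

lemma ideal_from_homogeneous:
  assumes "\<And>n f. f \<in> I \<Longrightarrow> homogeneous (int n) f \<Longrightarrow> f \<in> ideal_gen G" "f \<in> I"
  shows "f \<in> ideal_gen G"
proof -
  have "component t f \<in> ideal_gen G" for t
  proof (cases "t < 0")
    case True
    then have "component t f = 0" using homogeneous_neg homogeneous_component by blast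
    then show ?thesis by (simp add: ring.span_zero)
  next
    case False
    then show ?thesis
      using assms(1)[of "component t f" "nat t"] graded[OF assms(2)] homogeneous_component[of t f] by simp
  qed
  then have "(\<Sum>t\<in>degrees f. component t f) \<in> ideal_gen G" by (intro ring.span_sum) auto
  then show ?thesis by (simp add: sum_components)
qed

text \<open>
  Bases of the components of degree at most \<open>2 N\<close> suffice. In higher degrees, an element is
  congruent modulo \<open>h\<close> to \<open>y p' + z q'\<close> with \<open>p'\<close>, \<open>q'\<close> in the ideal, and the difference is \<open>h\<close>
  times an element of the ideal, so only elements of smaller degree are needed.
\<close>

lemma finite_homogeneous_generators:
  "\<exists>G. finite G \<and> (\<forall>g\<in>G. \<exists>n. homogeneous (int n) g) \<and> ideal_gen G = I"
proof -
  have "\<forall>n. \<exists>B. finite B \<and> B \<subseteq> {f \<in> I. homogeneous (int n) f} \<and>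
      {f \<in> I. homogeneous (int n) f} \<subseteq> poly_vs.span B"
  proof
    fix n
    obtain B where "B \<subseteq> {f \<in> I. homogeneous (int n) f}" "poly_vs.independent B"
      "{f \<in> I. homogeneous (int n) f} \<subseteq> poly_vs.span B"
      by (rule poly_vs.maximal_independent_subset)
    moreover from this have "finite B" by (intro finite_independent_homogeneous[of B n]) auto
    ultimately show "\<exists>B. finite B \<and> B \<subseteq> {f \<in> I. homogeneous (int n) f} \<and>
      {f \<in> I. homogeneous (int n) f} \<subseteq> poly_vs.span B" by (intro exI[of _ B] conjI)
  qed
  from choice[OF this] obtain B where "\<forall>n. finite (B n) \<and> B n \<subseteq> {f \<in> I. homogeneous (int n) f} \<and>
      {f \<in> I. homogeneous (int n) f} \<subseteq> poly_vs.span (B n)" ..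
  then have B: "\<And>n. finite (B n)" "\<And>n. B n \<subseteq> {f \<in> I. homogeneous (int n) f}"
    "\<And>n. {f \<in> I. homogeneous (int n) f} \<subseteq> poly_vs.span (B n)" by simp_all
  define G where "G = (\<Union>n\<le>2 * N. B n)"
  have span: "poly_vs.span A \<subseteq> ideal_gen A" for A :: "'k poly3 set"
    by (intro poly_vs.span_minimal ring.span_superset poly_vs.subspaceI)
      (auto intro: ring.span_zero ring.span_add ring.span_scale)
  have gen: "f \<in> ideal_gen G" if "f \<in> I" "homogeneous (int n) f" for f n
    using that
  proof (induction n arbitrary: f)
    case 0
    then have "f \<in> ideal_gen (B 0)" using B(3) span by blast
    moreover have "ideal_gen (B 0) \<subseteq> ideal_gen G" by (intro ring.span_mono) (auto simp: G_def)
    ultimately show ?case by blast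
  next
    case (Suc n)
    show ?case
    proof (cases "Suc n \<le> 2 * N")
      case True
      have "f \<in> ideal_gen (B (Suc n))" using B(3) span Suc.prems by blast
      moreover have "ideal_gen (B (Suc n)) \<subseteq> ideal_gen G" using True by (intro ring.span_mono) (auto simp: G_def)
      ultimately show ?thesis by blast
    next
      case False
      then have n: "int n \<ge> int (2 * N)" by simp
      obtain p q r where pqr: "homogeneous (int n) p" "homogeneous (int n) q" "homogeneous (int n) r"
        "f = y * p + z * q + h * r" using pos_decomp[OF Suc.prems(2)] by auto
      obtain p' where p': "p' \<in> I" "homogeneous (int n) p'" "h dvd p - p'" using large_degree[OF pqr(1) n] by blast
      obtain q' where q': "q' \<in> I" "homogeneous (int n) q'" "h dvd q - q'" using large_degree[OF pqr(2) n] by blast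
      have "h dvd y * (p - p') + z * (q - q') + h * r" using p' q' by simp
      then have "h dvd f - (y * p' + z * q')" by (simp add: pqr(4) algebra_simps)
      moreover have "homogeneous (int (Suc n)) (f - (y * p' + z * q'))"
        by (intro homogeneous_diff homogeneous_add hom_y_mult hom_z_mult Suc.prems) (use p' q' in auto)
      ultimately obtain r' where r': "homogeneous (int (Suc n) - 1) r'" "f - (y * p' + z * q') = h * r'"
        by (rule dvd_homE)
      have "h * r' \<in> I" unfolding r'(2)[symmetric] using p' q' Suc.prems(1)
        by (intro ideal_diff ideal_add ideal_mult_left)
      then have "r' \<in> I" by (rule saturated)
      have "f = y * p' + z * q' + h * r'" using r'(2) by (simp add: algebra_simps)
      moreover have "p' \<in> ideal_gen G" "q' \<in> ideal_gen G" "r' \<in> ideal_gen G"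
        using Suc.IH p' q' \<open>r' \<in> I\<close> r'(1) by auto
      ultimately show ?thesis by (auto intro: ring.span_add ring.span_scale)
    qed
  qed
  have "ideal_gen G = I"
  proof (rule equalityI)
    show "ideal_gen G \<subseteq> I" using B(2) ideal by (intro ring.span_minimal) (auto simp: G_def)
    show "I \<subseteq> ideal_gen G"
    proof
      fix f assume "f \<in> I"
      then show "f \<in> ideal_gen G"
        by (rule ideal_from_homogeneous[rotated]) (rule gen, assumption+)
    qed
  qed
  moreover have "finite G" using B(1) by (auto simp: G_def)
  moreover have "\<forall>g\<in>G. \<exists>n. homogeneous (int n) g" using B(2) by (auto simp: G_def)
  ultimately show ?thesis by blast
qed

text \<open>
  A homogeneous generating set with the least number of elements is minimal in the graded sense:
  a constant nonzero coefficient in a syzygy would express one generator by the others.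
\<close>

lemma minimal_generators:
  obtains G dg where "finite G" "\<And>g. g \<in> G \<Longrightarrow> homogeneous (int (dg g)) g" "ideal_gen G = I"
    "\<And>t x g. (\<And>g. g \<in> G \<Longrightarrow> homogeneous (t - int (dg g)) (x g)) \<Longrightarrow> (\<Sum>g\<in>G. x g * g) = 0 \<Longrightarrow>
      g \<in> G \<Longrightarrow> x g \<in> irrelevant_ideal"
proof -
  define P where "P G \<longleftrightarrow> finite G \<and> (\<forall>g\<in>G. \<exists>n. homogeneous (int n) g) \<and> ideal_gen G = I" for G
  obtain G0 where "P G0" using finite_homogeneous_generators unfolding P_def by blast
  then obtain G where G: "P G" and min: "\<And>G'. P G' \<Longrightarrow> card G \<le> card G'"
    using ex_has_least_nat[of P G0 card] by blast
  have fin: "finite G" and gen: "ideal_gen G = I" using G unfolding P_def by auto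
  have "\<forall>g\<in>G. \<exists>n. homogeneous (int n) g" using G unfolding P_def by blast
  from bchoice[OF this] obtain dg where dg: "\<forall>g\<in>G. homogeneous (int (dg g)) g" ..
  show thesis
  proof (rule that[OF fin _ gen])
    show "homogeneous (int (dg g)) g" if "g \<in> G" for g using dg that by blast
  next
    fix t x g0 assume x: "\<And>g. g \<in> G \<Longrightarrow> homogeneous (t - int (dg g)) (x g)"
      and 0: "(\<Sum>g\<in>G. x g * g) = 0" and g0: "g0 \<in> G"
    consider "t - int (dg g0) < 0" | "t - int (dg g0) > 0" | "t - int (dg g0) = 0" by linarith
    then show "x g0 \<in> irrelevant_ideal"
    proof cases
      case 1
      then have "x g0 = 0" using homogeneous_neg[OF x[OF g0]] by simp
      then show ?thesis by (simp add: irrelevant_ideal_def ring.span_zero)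
    next
      case 2
      then show ?thesis using homogeneous_pos_irrelevant[OF x[OF g0]] by simp
    next
      case 3
      define c where "c = Poly_Mapping.lookup (x g0) 0"
      have xc: "x g0 = const_poly c"
        unfolding c_def using x[OF g0] 3 by (intro homogeneous_0_const) simp
      have "c = 0"
      proof (rule ccontr)
        assume c: "c \<noteq> 0"
        have "const_poly c * g0 = - (\<Sum>g\<in>G - {g0}. x g * g)"
          using 0 sum.remove[OF fin g0, of "\<lambda>g. x g * g"] by (simp add: xc eq_neg_iff_add_eq_0)
        also have "\<dots> \<in> ideal_gen (G - {g0})"
          by (intro ring.span_neg ring.span_sum ring.span_scale ring.span_base) auto
        finally have "const_poly (inverse c) * (const_poly c * g0) \<in> ideal_gen (G - {g0})"
          by (rule ring.span_scale)
        then have "g0 \<in> ideal_gen (G - {g0})"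
          using const_poly_inverse[OF c] by (simp flip: mult.assoc)
        then have "G \<subseteq> ideal_gen (G - {g0})" by (auto intro: ring.span_base)
        then have "ideal_gen G \<subseteq> ideal_gen (G - {g0})" by (intro ring.span_minimal) auto
        moreover have "ideal_gen (G - {g0}) \<subseteq> ideal_gen G" by (intro ring.span_mono) auto
        ultimately have "ideal_gen (G - {g0}) = I" using gen by blast
        then have "P (G - {g0})" using G unfolding P_def by blast
        then have "card G \<le> card (G - {g0})" by (rule min)
        moreover have "card (G - {g0}) < card G" by (rule card_Diff1_less[OF fin g0])
        ultimately show False by linarith
      qed
      then show ?thesis using xc by (simp add: irrelevant_ideal_def ring.span_zero)
    qed
  qed
qed

end

section \<open>Freeness of the syzygies\<close>

context saturated_ideal
begin

definition syzygy :: "'k poly3 set \<Rightarrow> ('k poly3 \<Rightarrow> nat) \<Rightarrow> int \<Rightarrow> ('k poly3 \<Rightarrow> 'k poly3) \<Rightarrow> bool" where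
  "syzygy G dg t x \<longleftrightarrow> (\<forall>g\<in>G. homogeneous (t - int (dg g)) (x g)) \<and> (\<Sum>g\<in>G. x g * g) = 0"

lemma homogeneous_representation:
  assumes "finite G" "\<And>g. g \<in> G \<Longrightarrow> homogeneous (int (dg g)) g" "ideal_gen G = I" "f \<in> I" "homogeneous s f"
  shows "\<exists>u. (\<forall>g\<in>G. homogeneous (s - int (dg g)) (u g)) \<and> f = (\<Sum>g\<in>G. u g * g)"
proof -
  have "f \<in> {\<Sum>g\<in>G. g * x g | x. True}"
    using ideal_gen_image[OF assms(1), of "\<lambda>g. g"] assms(3,4) by simp
  then obtain x where x: "f = (\<Sum>g\<in>G. g * x g)" by blast
  have "f = component s f" using component_same[OF assms(5)] by simp
  also have "\<dots> = (\<Sum>g\<in>G. component s (g * x g))" unfolding x by (rule component_sum)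
  also have "\<dots> = (\<Sum>g\<in>G. component (s - int (dg g)) (x g) * g)"
    using assms(2) by (intro sum.cong refl) (simp add: component_mult_left mult.commute)
  finally show ?thesis by (intro exI[of _ "\<lambda>g. component (s - int (dg g)) (x g)"]) simp
qed

text \<open>
  The syzygies stay saturated modulo \<open>h\<close>: if a syzygy is a combination of \<open>h\<close> and \<open>z\<close>, then the
  coefficient vectors can be chosen to be syzygies. The combination of the generators with
  coefficients \<open>q\<close> becomes divisible by \<open>h\<close> when multiplied by \<open>z\<close>, so it is \<open>h w\<close>. By
  saturation, \<open>w\<close> is in the ideal, hence comes from a vector \<open>u\<close>, and \<open>h u\<close> may be moved from
  \<open>z q\<close> to \<open>h p\<close>.
\<close>

lemma syzygy_split:
  assumes G: "finite G" "\<And>g. g \<in> G \<Longrightarrow> homogeneous (int (dg g)) g" "ideal_gen G = I"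
    and x: "syzygy G dg t x"
    and p: "\<And>g. g \<in> G \<Longrightarrow> homogeneous (t - 1 - int (dg g)) (p g)"
    and q: "\<And>g. g \<in> G \<Longrightarrow> homogeneous (t - 1 - int (dg g)) (q g)"
    and eq: "\<And>g. g \<in> G \<Longrightarrow> x g = h * p g + z * q g"
  obtains p' q' where "syzygy G dg (t - 1) p'" "syzygy G dg (t - 1) q'" "\<And>g. g \<in> G \<Longrightarrow> x g = h * p' g + z * q' g"
proof -
  let ?e = "\<lambda>u. \<Sum>g\<in>G. u g * g"
  have "0 = ?e x" using x by (simp add: syzygy_def)
  also have "\<dots> = h * ?e p + z * ?e q"
    using eq by (simp add: distrib_right sum.distrib sum_distrib_left mult.assoc)
  finally have 0: "z * ?e q = h * (- ?e p)" by (simp add: eq_neg_iff_add_eq_0 add.commute)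
  have hq: "homogeneous (t - 1) (?e q)"
  proof (rule homogeneous_sum)
    fix g assume "g \<in> G"
    then show "homogeneous (t - 1) (q g * g)" using homogeneous_mult[OF q[of g] G(2)[of g]] by simp
  qed
  have "h dvd z * ?e q" unfolding 0 by simp
  then have "h dvd ?e q" by (rule z_cancel[OF hq])
  then obtain w where w: "homogeneous (t - 1 - 1) w" "?e q = h * w" by (rule dvd_homE[OF _ hq])
  have "g \<in> I" if "g \<in> G" for g using G(3) that ring.span_base by blast
  then have "?e q \<in> I" by (intro ideal_sum ideal_mult_left)
  then have "w \<in> I" using saturated w(2) by simp
  from homogeneous_representation[OF G this w(1)] obtain u where
    "(\<forall>g\<in>G. homogeneous (t - 1 - 1 - int (dg g)) (u g)) \<and> w = ?e u" ..
  then have u: "\<And>g. g \<in> G \<Longrightarrow> homogeneous (t - 1 - 1 - int (dg g)) (u g)" "w = ?e u" by simp_all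
  have hu: "homogeneous (t - 1 - int (dg g)) (h * u g)" "homogeneous (t - 1 - int (dg g)) (z * u g)" if "g \<in> G" for g
    using u(1)[OF that] by (auto intro!: hom_h_mult hom_z_mult simp: algebra_simps)
  show thesis
  proof (rule that)
    have "h * (?e p + z * w) = 0" using 0 w(2) by (simp add: algebra_simps)
    then have "?e p + z * w = 0" using h_nonzero by simp
    moreover have "?e (\<lambda>g. p g + z * u g) = ?e p + z * w"
      unfolding u(2) by (simp add: distrib_right sum.distrib sum_distrib_left mult.assoc)
    ultimately show "syzygy G dg (t - 1) (\<lambda>g. p g + z * u g)"
      unfolding syzygy_def using p hu by (auto intro: homogeneous_add)
    have "?e (\<lambda>g. q g - h * u g) = ?e q - h * ?e u"
      by (simp add: left_diff_distrib sum_subtractf sum_distrib_left mult.assoc)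
    then show "syzygy G dg (t - 1) (\<lambda>g. q g - h * u g)"
      unfolding syzygy_def using q hu w u(2) by (auto intro: homogeneous_diff)
  qed (use eq in \<open>simp add: algebra_simps\<close>)
qed

text \<open>
  These leading vectors are the residues of the syzygies modulo \<open>h\<close> and \<open>z\<close>, with \<open>y\<close> set to one.
  In this form, vectors of different degrees live in the same finite-dimensional space, and
  multiplication by \<open>y\<close> becomes inclusion.
\<close>

definition lead_space :: "'k poly3 set \<Rightarrow> ('k poly3 \<Rightarrow> nat) \<Rightarrow> nat \<Rightarrow> ('k poly3 \<Rightarrow> 'k) set" where
  "lead_space G dg n = {v. (\<forall>g. g \<notin> G \<longrightarrow> v g = 0) \<and>
     (\<exists>x. syzygy G dg (int n) x \<and> (\<forall>g\<in>G. lead (int n - int (dg g)) (x g) (v g)))}"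

lemma lead_space_mono: "lead_space G dg n \<subseteq> lead_space G dg (Suc n)"
proof
  fix v assume "v \<in> lead_space G dg n"
  then obtain x where v: "\<forall>g. g \<notin> G \<longrightarrow> v g = 0"
    and x: "syzygy G dg (int n) x" "\<forall>g\<in>G. lead (int n - int (dg g)) (x g) (v g)"
    unfolding lead_space_def by blast
  have "syzygy G dg (int (Suc n)) (\<lambda>g. y * x g)"
    using x(1) by (auto simp: syzygy_def mult.assoc simp flip: sum_distrib_left intro!: hom_y_mult)
  moreover have "lead (int (Suc n) - int (dg g)) (y * x g) (v g)" if "g \<in> G" for g
  proof -
    have "lead (int 1 + (int n - int (dg g))) (y ^ 1 * x g) (1 * v g)"
      using x(2) that by (intro lead_mult lead_y_power) auto
    then show ?thesis by (simp add: algebra_simps)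
  qed
  ultimately show "v \<in> lead_space G dg (Suc n)"
    unfolding lead_space_def using v by (auto intro!: exI[of _ "\<lambda>g. y * x g"])
qed

text \<open>
  A basis of the syzygies modulo \<open>h\<close> and \<open>z\<close> comes from a basis adapted to the ascending chain of
  leading vectors: \<open>B\<close> is the set of its elements, \<open>db v\<close> is the degree in which \<open>v\<close> appears, and
  \<open>\<xi> v\<close> is a syzygy of that degree with leading vector \<open>v\<close>. The syzygies \<open>\<xi> v\<close> form a basis of the
  whole module: both for generation and for independence, subtracting leading terms leaves a
  combination of \<open>h\<close> and \<open>z\<close>, and \<open>syzygy_split\<close> reduces the degree.
\<close>

lemma syzygies_free:
  assumes G: "finite G" "\<And>g. g \<in> G \<Longrightarrow> homogeneous (int (dg g)) g" "ideal_gen G = I"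
  obtains B :: "('k poly3 \<Rightarrow> 'k) set" and db \<xi> where "finite B"
    "\<And>v. v \<in> B \<Longrightarrow> syzygy G dg (int (db v)) (\<xi> v)"
    "\<And>t x. syzygy G dg t x \<Longrightarrow> \<exists>c. \<forall>g\<in>G. x g = (\<Sum>v\<in>B. \<xi> v g * c v)"
    "\<And>t c. (\<And>v. v \<in> B \<Longrightarrow> homogeneous (t - int (db v)) (c v)) \<Longrightarrow>
       (\<And>g. g \<in> G \<Longrightarrow> (\<Sum>v\<in>B. \<xi> v g * c v) = 0) \<Longrightarrow> \<forall>v\<in>B. c v = 0"
proof -
  let ?V = "lead_space G dg"
  have "\<exists>f. \<forall>n. (f n \<subseteq> ?V n \<and> fun_vs.independent (f n) \<and> ?V n \<subseteq> fun_vs.span (f n)) \<and> f n \<subseteq> f (Suc n)"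
  proof (rule dependent_nat_choice)
    obtain B where "B \<subseteq> ?V 0" "fun_vs.independent B" "?V 0 \<subseteq> fun_vs.span B"
      by (rule fun_vs.maximal_independent_subset)
    then show "\<exists>B. B \<subseteq> ?V 0 \<and> fun_vs.independent B \<and> ?V 0 \<subseteq> fun_vs.span B"
      by (intro exI[of _ B] conjI)
  next
    fix B n assume B: "B \<subseteq> ?V n \<and> fun_vs.independent B \<and> ?V n \<subseteq> fun_vs.span B"
    then have "B \<subseteq> ?V (Suc n)" "fun_vs.independent B" using lead_space_mono[of G dg n] by auto
    then obtain B' where "B \<subseteq> B'" "B' \<subseteq> ?V (Suc n)" "fun_vs.independent B'" "?V (Suc n) \<subseteq> fun_vs.span B'"
      by (rule fun_vs.maximal_independent_subset_extend)
    then show "\<exists>B'. (B' \<subseteq> ?V (Suc n) \<and> fun_vs.independent B' \<and> ?V (Suc n) \<subseteq> fun_vs.span B') \<and> B \<subseteq> B'"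
      by (intro exI[of _ B'] conjI)
  qed
  then obtain Bn where "\<forall>n. (Bn n \<subseteq> ?V n \<and> fun_vs.independent (Bn n) \<and> ?V n \<subseteq> fun_vs.span (Bn n)) \<and> Bn n \<subseteq> Bn (Suc n)" ..
  then have Bn: "\<And>n. Bn n \<subseteq> ?V n" "\<And>n. fun_vs.independent (Bn n)" "\<And>n. ?V n \<subseteq> fun_vs.span (Bn n)"
    "\<And>n. Bn n \<subseteq> Bn (Suc n)" by simp_all
  have mono: "Bn m \<subseteq> Bn n" if "m \<le> n" for m n using lift_Suc_mono_le[of Bn, OF Bn(4) that] .
  define B where "B = (\<Union>n. Bn n)"
  have indep: "fun_vs.independent B"
    unfolding B_def
  proof (rule fun_vs.independent_Union_directed)
    fix c d assume "c \<in> range Bn" "d \<in> range Bn"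
    then obtain m n where "c = Bn m" "d = Bn n" by blast
    then show "c \<subseteq> d \<or> d \<subseteq> c" using mono[of m n] mono[of n m] by (cases "m \<le> n") auto
  qed (use Bn(2) in auto)
  have outside: "v g = 0" if "v \<in> B" "g \<notin> G" for v g
    using that Bn(1) unfolding B_def lead_space_def by blast
  \<comment> \<open>The leading vectors are supported on the finite set \<open>G\<close>.\<close>
  have finB: "finite B"
  proof -
    define T where "T = (\<lambda>g0 g. if g = g0 then 1 else 0 :: 'k) ` G"
    have "v \<in> fun_vs.span T" if v: "v \<in> B" for v
    proof -
      have "v = (\<Sum>g0\<in>G. (\<lambda>g. v g0 * (if g = g0 then 1 else 0)))"
      proof
        fix g
        have "(\<Sum>g0\<in>G. (\<lambda>g. v g0 * (if g = g0 then 1 else 0))) g = (\<Sum>g0\<in>G. if g0 = g then v g else 0)"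
          unfolding sum_fun_apply by (intro sum.cong) auto
        also have "\<dots> = v g" using G(1) outside[OF v, of g] by simp
        finally show "v g = (\<Sum>g0\<in>G. (\<lambda>g. v g0 * (if g = g0 then 1 else 0))) g" ..
      qed
      moreover have "(\<Sum>g0\<in>G. (\<lambda>g. v g0 * (if g = g0 then 1 else 0))) \<in> fun_vs.span T"
        by (intro fun_vs.span_sum fun_vs.span_scale fun_vs.span_base) (auto simp: T_def)
      ultimately show ?thesis by simp
    qed
    moreover have "finite T" using G(1) by (simp add: T_def)
    ultimately show ?thesis using fun_vs.independent_span_bound[OF _ indep] by blast
  qed
  define db where "db v = (LEAST n. v \<in> Bn n)" for v
  have db_le: "v \<in> Bn n \<Longrightarrow> db v \<le> n" for v n unfolding db_def by (rule Least_le)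
  have Bn_db: "v \<in> Bn (db v)" if "v \<in> B" for v
    using that unfolding db_def B_def by (auto intro: LeastI)
  have "\<forall>v\<in>B. \<exists>x. syzygy G dg (int (db v)) x \<and> (\<forall>g\<in>G. lead (int (db v) - int (dg g)) (x g) (v g))"
    using Bn_db Bn(1) unfolding lead_space_def by blast
  from bchoice[OF this] obtain \<xi> where "\<forall>v\<in>B. syzygy G dg (int (db v)) (\<xi> v) \<and>
      (\<forall>g\<in>G. lead (int (db v) - int (dg g)) (\<xi> v g) (v g))" ..
  then have \<xi>: "\<And>v. v \<in> B \<Longrightarrow> syzygy G dg (int (db v)) (\<xi> v)"
    "\<And>v g. v \<in> B \<Longrightarrow> g \<in> G \<Longrightarrow> lead (int (db v) - int (dg g)) (\<xi> v g) (v g)" by simp_all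
  have hom\<xi>: "homogeneous (int (db v) - int (dg g)) (\<xi> v g)" if "v \<in> B" "g \<in> G" for v g
    using \<xi>(1)[OF that(1)] that(2) unfolding syzygy_def by blast
  have \<xi>0: "(\<Sum>g\<in>G. \<xi> v g * g) = 0" if "v \<in> B" for v
    using \<xi>(1)[OF that] unfolding syzygy_def by blast

  have generate: "\<exists>c. (\<forall>v\<in>B. homogeneous (t - int (db v)) (c v)) \<and> (\<forall>g\<in>G. x g = (\<Sum>v\<in>B. \<xi> v g * c v))"
    if "syzygy G dg t x" "t < int n" for n t x
    using that
  proof (induction n arbitrary: t x)
    case 0
    have "x g = 0" if "g \<in> G" for g
      using 0 that homogeneous_neg[of "t - int (dg g)" "x g"] by (auto simp: syzygy_def)
    then show ?case by (intro exI[of _ "\<lambda>_. 0"]) auto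
  next
    case (Suc n)
    show ?case
    proof (cases "t < int n")
      case True
      with Suc show ?thesis by blast
    next
      case False
      then have t: "t = int n" using Suc.prems by simp
      have "\<forall>g\<in>G. \<exists>l. lead (t - int (dg g)) (x g) l"
        using Suc.prems(1) lead_exists unfolding syzygy_def by blast
      from bchoice[OF this] obtain l0 where l0: "\<forall>g\<in>G. lead (t - int (dg g)) (x g) (l0 g)" ..
      define l where "l g = (if g \<in> G then l0 g else 0)" for g
      have "l \<in> ?V n"
        unfolding lead_space_def l_def using l0 Suc.prems(1) by (auto simp: t intro!: exI[of _ x])
      then have "l \<in> fun_vs.span (Bn n)" using Bn(3) by blast
      moreover have finBn: "finite (Bn n)" using finB by (rule finite_subset[rotated]) (auto simp: B_def)
      ultimately obtain a where a: "l = (\<Sum>v\<in>Bn n. (\<lambda>g. a v * v g))"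
        using fun_vs.span_finite[OF finBn] by blast
      have BnB: "v \<in> B" if "v \<in> Bn n" for v using that by (auto simp: B_def)
      \<comment> \<open>The combination of the \<open>\<xi> v\<close> with these coefficients has the same leading vector as \<open>x\<close>.\<close>
      define c where "c v = (if v \<in> Bn n then const_poly (a v) * y ^ (n - db v) else 0)" for v
      have homc: "homogeneous (t - int (db v)) (c v)" if "v \<in> B" for v
        using db_le[of v n] t
        by (auto simp: c_def of_nat_diff intro!: homogeneous_const_mult homogeneous_power[OF hom_y])
      have leadc: "lead (t - int (db v)) (c v) (if v \<in> Bn n then a v else 0)" for v
      proof (cases "v \<in> Bn n")
        case True
        then show ?thesis
          using lead_mult[OF lead_const[of "a v"] lead_y_power[of "n - db v"]] db_le[of v n] t
          by (simp add: c_def of_nat_diff)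
      qed (simp add: c_def)
      define x' where "x' g = x g - (\<Sum>v\<in>B. \<xi> v g * c v)" for g
      have syzc: "syzygy G dg t (\<lambda>g. \<Sum>v\<in>B. \<xi> v g * c v)"
        unfolding syzygy_def
      proof (intro conjI ballI)
        fix g assume "g \<in> G"
        then show "homogeneous (t - int (dg g)) (\<Sum>v\<in>B. \<xi> v g * c v)"
          by (intro homogeneous_sum homogeneous_mult'[OF hom\<xi> homc]) auto
      next
        have "(\<Sum>g\<in>G. (\<Sum>v\<in>B. \<xi> v g * c v) * g) = (\<Sum>v\<in>B. c v * (\<Sum>g\<in>G. \<xi> v g * g))"
          unfolding sum_distrib_left sum_distrib_right by (subst sum.swap) (simp add: algebra_simps)
        then show "(\<Sum>g\<in>G. (\<Sum>v\<in>B. \<xi> v g * c v) * g) = 0" using \<xi>0 by simp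
      qed
      have syzx': "syzygy G dg t x'"
        using Suc.prems(1) syzc unfolding syzygy_def x'_def
        by (auto simp: left_diff_distrib sum_subtractf intro: homogeneous_diff)
      have lead0: "lead (t - int (dg g)) (x' g) 0" if g: "g \<in> G" for g
      proof -
        have "lead (t - int (dg g)) (\<Sum>v\<in>B. \<xi> v g * c v) (\<Sum>v\<in>B. v g * (if v \<in> Bn n then a v else 0))"
        proof (rule lead_sum)
          fix v assume "v \<in> B"
          then show "lead (t - int (dg g)) (\<xi> v g * c v) (v g * (if v \<in> Bn n then a v else 0))"
            using lead_mult[OF \<xi>(2)[OF _ g] leadc, of v v] by (simp add: algebra_simps)
        qed
        also have "(\<Sum>v\<in>B. v g * (if v \<in> Bn n then a v else 0)) = (\<Sum>v\<in>Bn n. a v * v g)"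
          using finB BnB by (intro sum.mono_neutral_cong_right) auto
        also have "\<dots> = l g" unfolding a sum_fun_apply ..
        finally have "lead (t - int (dg g)) (x' g) (l0 g - l g)"
          unfolding x'_def using l0 g by (intro lead_diff) auto
        then show ?thesis using g by (simp add: l_def)
      qed
      have "\<forall>g\<in>G. \<exists>pq. homogeneous (t - 1 - int (dg g)) (fst pq) \<and> homogeneous (t - 1 - int (dg g)) (snd pq) \<and>
        x' g = h * fst pq + z * snd pq"
      proof
        fix g assume "g \<in> G"
        from lead_zeroE[OF lead0[OF this]] obtain p q where "homogeneous (t - int (dg g) - 1) p"
          "homogeneous (t - int (dg g) - 1) q" "x' g = h * p + z * q" .
        then show "\<exists>pq. homogeneous (t - 1 - int (dg g)) (fst pq) \<and> homogeneous (t - 1 - int (dg g)) (snd pq) \<and>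
          x' g = h * fst pq + z * snd pq"
          by (intro exI[of _ "(p, q)"]) (simp add: algebra_simps)
      qed
      from bchoice[OF this] obtain pq where "\<forall>g\<in>G. homogeneous (t - 1 - int (dg g)) (fst (pq g)) \<and>
        homogeneous (t - 1 - int (dg g)) (snd (pq g)) \<and> x' g = h * fst (pq g) + z * snd (pq g)" ..
      then obtain p' q' where p': "syzygy G dg (t - 1) p'" and q': "syzygy G dg (t - 1) q'"
        and x'eq: "\<And>g. g \<in> G \<Longrightarrow> x' g = h * p' g + z * q' g"
        using syzygy_split[OF G syzx', of "\<lambda>g. fst (pq g)" "\<lambda>g. snd (pq g)"] by auto
      have t1: "t - 1 < int n" using t by simp
      obtain c1 where c1: "\<forall>v\<in>B. homogeneous (t - 1 - int (db v)) (c1 v)" "\<forall>g\<in>G. p' g = (\<Sum>v\<in>B. \<xi> v g * c1 v)"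
        using Suc.IH[OF p' t1] by blast
      obtain c2 where c2: "\<forall>v\<in>B. homogeneous (t - 1 - int (db v)) (c2 v)" "\<forall>g\<in>G. q' g = (\<Sum>v\<in>B. \<xi> v g * c2 v)"
        using Suc.IH[OF q' t1] by blast
      show ?thesis
      proof (intro exI[of _ "\<lambda>v. c v + h * c1 v + z * c2 v"] conjI ballI)
        fix v assume v: "v \<in> B"
        have "homogeneous (t - int (db v) - 1) (c1 v)" "homogeneous (t - int (db v) - 1) (c2 v)"
          using c1(1) c2(1) v by (simp_all add: algebra_simps)
        then show "homogeneous (t - int (db v)) (c v + h * c1 v + z * c2 v)"
          by (intro homogeneous_add homc[OF v] hom_h_mult hom_z_mult)
      next
        fix g assume g: "g \<in> G"
        have "x g = (\<Sum>v\<in>B. \<xi> v g * c v) + x' g" by (simp add: x'_def)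
        also have "\<dots> = (\<Sum>v\<in>B. \<xi> v g * c v) + (h * (\<Sum>v\<in>B. \<xi> v g * c1 v) + z * (\<Sum>v\<in>B. \<xi> v g * c2 v))"
          using x'eq[OF g] c1(2) c2(2) g by simp
        also have "\<dots> = (\<Sum>v\<in>B. \<xi> v g * (c v + h * c1 v + z * c2 v))"
          unfolding sum_distrib_left sum.distrib[symmetric] by (intro sum.cong) (simp_all add: algebra_simps)
        finally show "x g = (\<Sum>v\<in>B. \<xi> v g * (c v + h * c1 v + z * c2 v))" .
      qed
    qed
  qed

  have inject: "\<forall>v\<in>B. c v = 0"
    if "\<And>v. v \<in> B \<Longrightarrow> homogeneous (t - int (db v)) (c v)" "\<And>g. g \<in> G \<Longrightarrow> (\<Sum>v\<in>B. \<xi> v g * c v) = 0" "t < int n"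
    for n t c
    using that
  proof (induction n arbitrary: t c)
    case 0
    then show ?case using homogeneous_neg by force
  next
    case (Suc n)
    have "\<forall>v\<in>B. \<exists>l. lead (t - int (db v)) (c v) l" using Suc.prems(1) lead_exists by blast
    from bchoice[OF this] obtain l where l: "\<forall>v\<in>B. lead (t - int (db v)) (c v) (l v)" ..
    have vl: "(\<Sum>v\<in>B. v g * l v) = 0" if g: "g \<in> G" for g
    proof -
      have "lead (t - int (dg g)) (\<Sum>v\<in>B. \<xi> v g * c v) (\<Sum>v\<in>B. v g * l v)"
      proof (rule lead_sum)
        fix v assume v: "v \<in> B"
        show "lead (t - int (dg g)) (\<xi> v g * c v) (v g * l v)"
          using lead_mult[OF \<xi>(2)[OF v g] l[rule_format, OF v]] by simp
      qed
      then show ?thesis using Suc.prems(2)[OF g] lead_zero_unique by simp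
    qed
    have "(\<Sum>v\<in>B. (\<lambda>g. l v * v g)) = 0"
    proof
      fix g
      have "(\<Sum>v\<in>B. (\<lambda>g. l v * v g)) g = (\<Sum>v\<in>B. v g * l v)"
        unfolding sum_fun_apply by (simp add: mult.commute)
      also have "\<dots> = 0"
      proof (cases "g \<in> G")
        case False
        with outside show ?thesis by (intro sum.neutral) simp
      qed (rule vl)
      finally show "(\<Sum>v\<in>B. (\<lambda>g. l v * v g)) g = 0 g" by simp
    qed
    then have l0: "l v = 0" if "v \<in> B" for v
      using fun_vs.independentD[OF indep finB subset_refl _ that, of l] by simp
    have "\<forall>v\<in>B. \<exists>pq. homogeneous (t - 1 - int (db v)) (fst pq) \<and> homogeneous (t - 1 - int (db v)) (snd pq) \<and>
        c v = h * fst pq + z * snd pq"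
    proof
      fix v assume v: "v \<in> B"
      have "lead (t - int (db v)) (c v) 0" using l v l0[OF v] by auto
      from lead_zeroE[OF this] obtain p q where "homogeneous (t - int (db v) - 1) p"
        "homogeneous (t - int (db v) - 1) q" "c v = h * p + z * q" .
      then show "\<exists>pq. homogeneous (t - 1 - int (db v)) (fst pq) \<and> homogeneous (t - 1 - int (db v)) (snd pq) \<and>
          c v = h * fst pq + z * snd pq"
        by (intro exI[of _ "(p, q)"]) (simp add: algebra_simps)
    qed
    from bchoice[OF this] obtain pq where pq: "\<forall>v\<in>B. homogeneous (t - 1 - int (db v)) (fst (pq v)) \<and>
        homogeneous (t - 1 - int (db v)) (snd (pq v)) \<and> c v = h * fst (pq v) + z * snd (pq v)" ..
    define p q where "p v = fst (pq v)" and "q v = snd (pq v)" for v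
    have p: "homogeneous (t - 1 - int (db v)) (p v)" and q: "homogeneous (t - 1 - int (db v)) (q v)"
      and c: "c v = h * p v + z * q v" if "v \<in> B" for v
      using pq that by (auto simp: p_def q_def)
    have "(\<Sum>v\<in>B. \<xi> v g * c v) = h * (\<Sum>v\<in>B. \<xi> v g * p v) + z * (\<Sum>v\<in>B. \<xi> v g * q v)" for g
      unfolding sum_distrib_left sum.distrib[symmetric] using c by (intro sum.cong) (simp_all add: algebra_simps)
    then have 0: "h * (\<Sum>v\<in>B. \<xi> v g * p v) + z * (\<Sum>v\<in>B. \<xi> v g * q v) = 0" if "g \<in> G" for g
      using Suc.prems(2)[OF that] by simp
    have "\<forall>g\<in>G. \<exists>u. homogeneous (t - 2 - int (dg g)) u \<and> (\<Sum>v\<in>B. \<xi> v g * q v) = h * u"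
    proof
      fix g assume g: "g \<in> G"
      have hq: "homogeneous (t - 1 - int (dg g)) (\<Sum>v\<in>B. \<xi> v g * q v)"
        using g by (intro homogeneous_sum homogeneous_mult'[OF hom\<xi> q]) auto
      have "z * (\<Sum>v\<in>B. \<xi> v g * q v) = h * (- (\<Sum>v\<in>B. \<xi> v g * p v))"
        using 0[OF g] by (simp add: eq_neg_iff_add_eq_0 add.commute)
      then have "h dvd z * (\<Sum>v\<in>B. \<xi> v g * q v)" by (simp only: dvd_triv_left)
      then have "h dvd (\<Sum>v\<in>B. \<xi> v g * q v)" by (rule z_cancel[OF hq])
      from dvd_homE[OF this hq] obtain u where "homogeneous (t - 1 - int (dg g) - 1) u"
        "(\<Sum>v\<in>B. \<xi> v g * q v) = h * u" .
      then show "\<exists>u. homogeneous (t - 2 - int (dg g)) u \<and> (\<Sum>v\<in>B. \<xi> v g * q v) = h * u"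
        by (intro exI[of _ u]) (simp add: algebra_simps)
    qed
    from bchoice[OF this] obtain u where
      u: "\<forall>g\<in>G. homogeneous (t - 2 - int (dg g)) (u g) \<and> (\<Sum>v\<in>B. \<xi> v g * q v) = h * u g" ..
    have "h * (\<Sum>g\<in>G. u g * g) = (\<Sum>g\<in>G. (\<Sum>v\<in>B. \<xi> v g * q v) * g)"
      using u by (simp add: sum_distrib_left mult.assoc)
    also have "\<dots> = (\<Sum>v\<in>B. q v * (\<Sum>g\<in>G. \<xi> v g * g))"
      unfolding sum_distrib_left sum_distrib_right by (subst sum.swap) (simp add: algebra_simps)
    also have "\<dots> = 0" using \<xi>0 by simp
    finally have u_syz: "syzygy G dg (t - 2) u" using h_nonzero u by (simp add: syzygy_def)
    have t2: "t - 2 < int n" using Suc.prems(3) by simp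
    obtain e where e: "\<forall>v\<in>B. homogeneous (t - 2 - int (db v)) (e v)"
      "\<forall>g\<in>G. u g = (\<Sum>v\<in>B. \<xi> v g * e v)" using generate[OF u_syz t2] by blast
    have t1: "t - 1 < int n" using Suc.prems(3) by simp
    have homhe: "homogeneous (t - 1 - int (db v)) (h * e v)" "homogeneous (t - 1 - int (db v)) (z * e v)" if "v \<in> B" for v
    proof -
      have "homogeneous (t - 1 - int (db v) - 1) (e v)" using e(1) that by (simp add: algebra_simps)
      then show "homogeneous (t - 1 - int (db v)) (h * e v)" "homogeneous (t - 1 - int (db v)) (z * e v)"
        by (auto intro: hom_h_mult hom_z_mult)
    qed
    have "\<forall>v\<in>B. q v - h * e v = 0"
    proof (rule Suc.IH[OF _ _ t1])
      fix v assume "v \<in> B"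
      then show "homogeneous (t - 1 - int (db v)) (q v - h * e v)" using q homhe by (intro homogeneous_diff)
    next
      fix g assume g: "g \<in> G"
      have "(\<Sum>v\<in>B. \<xi> v g * (q v - h * e v)) = (\<Sum>v\<in>B. \<xi> v g * q v) - h * (\<Sum>v\<in>B. \<xi> v g * e v)"
        by (simp add: right_diff_distrib sum_subtractf sum_distrib_left mult.left_commute)
      then show "(\<Sum>v\<in>B. \<xi> v g * (q v - h * e v)) = 0" using u e(2) g by simp
    qed
    then have qe: "q v = h * e v" if "v \<in> B" for v using that by simp
    have "\<forall>v\<in>B. p v + z * e v = 0"
    proof (rule Suc.IH[OF _ _ t1])
      fix v assume "v \<in> B"
      then show "homogeneous (t - 1 - int (db v)) (p v + z * e v)" using p homhe by (intro homogeneous_add)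
    next
      fix g assume g: "g \<in> G"
      have "h * (\<Sum>v\<in>B. \<xi> v g * (p v + z * e v)) = h * (\<Sum>v\<in>B. \<xi> v g * p v) + z * (\<Sum>v\<in>B. \<xi> v g * q v)"
        unfolding sum_distrib_left sum.distrib[symmetric] using qe by (intro sum.cong) (simp_all add: algebra_simps)
      then show "(\<Sum>v\<in>B. \<xi> v g * (p v + z * e v)) = 0" using 0[OF g] h_nonzero by simp
    qed
    then have "h * (p v + z * e v) = 0" if "v \<in> B" for v using that by simp
    then show ?case using c qe by (simp add: algebra_simps)
  qed
  show thesis
  proof (rule that[OF finB \<xi>(1)])
    fix t x assume x: "syzygy G dg t x"
    have "t < int (nat (t + 1))" by simp
    from generate[OF x this] show "\<exists>c. \<forall>g\<in>G. x g = (\<Sum>v\<in>B. \<xi> v g * c v)" by blast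
  next
    fix t c assume "\<And>v. v \<in> B \<Longrightarrow> homogeneous (t - int (db v)) (c v)"
      "\<And>g. g \<in> G \<Longrightarrow> (\<Sum>v\<in>B. \<xi> v g * c v) = 0"
    then show "\<forall>v\<in>B. c v = 0" by (rule inject[of t c "nat (t + 1)"]) auto
  qed
qed

text \<open>
  The syzygies of a minimal system of generators are free, so the resolution stops after one step.
\<close>

lemma minimal_resolution_exists: "\<exists>sh \<phi>. minimal_graded_free_resolution I sh \<phi>"
proof -
  show ?thesis
  proof (rule minimal_generators)
    fix G dg assume G: "finite G" "\<And>g. g \<in> G \<Longrightarrow> homogeneous (int (dg g)) g" "ideal_gen G = I"
      and min: "\<And>t x g. (\<And>g. g \<in> G \<Longrightarrow> homogeneous (t - int (dg g)) (x g)) \<Longrightarrow> (\<Sum>g\<in>G. x g * g) = 0 \<Longrightarrow>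
        g \<in> G \<Longrightarrow> x g \<in> irrelevant_ideal"
    show ?thesis
    proof (rule syzygies_free[OF G])
      fix B :: "('k poly3 \<Rightarrow> 'k) set" and db \<xi> assume B: "finite B"
        and \<xi>: "\<And>v. v \<in> B \<Longrightarrow> syzygy G dg (int (db v)) (\<xi> v)"
        and gen: "\<And>t x. syzygy G dg t x \<Longrightarrow> \<exists>c. \<forall>g\<in>G. x g = (\<Sum>v\<in>B. \<xi> v g * c v)"
        and inj: "\<And>t c. (\<And>v. v \<in> B \<Longrightarrow> homogeneous (t - int (db v)) (c v)) \<Longrightarrow>
          (\<And>g. g \<in> G \<Longrightarrow> (\<Sum>v\<in>B. \<xi> v g * c v) = 0) \<Longrightarrow> \<forall>v\<in>B. c v = 0"
      have hom\<xi>: "homogeneous (int (db v) - int (dg g)) (\<xi> v g)" if "v \<in> B" "g \<in> G" for v g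
        using \<xi>[OF that(1)] that(2) unfolding syzygy_def by blast
      have \<xi>0: "(\<Sum>g\<in>G. \<xi> v g * g) = 0" if "v \<in> B" for v
        using \<xi>[OF that] unfolding syzygy_def by blast
      have "I = ideal_gen ((\<lambda>g. g) ` G)" using G(3) by simp
      from G(1) B finite.emptyI this obtain sh \<phi> where "minimal_graded_free_resolution I sh \<phi>"
      proof (rule resolution_from_sets[where ?d0.0 = "\<lambda>g. int (dg g)" and ?d1.0 = "\<lambda>v. int (db v)" and ?d2.0 = "\<lambda>_. 0"
            and ?M1.0 = "\<lambda>g v. \<xi> v g" and ?M2.0 = "\<lambda>v (_ :: unit). 0"])
        show "homogeneous (int (dg g)) g" if "g \<in> G" for g using G(2) that .
        show "homogeneous (int (db v) - int (dg g)) (\<xi> v g)" if "g \<in> G" "v \<in> B" for g v using hom\<xi> that by blast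
        show "(\<Sum>g\<in>G. g * \<xi> v g) = 0" if "v \<in> B" for v using \<xi>0[OF that] by (simp add: mult.commute)
        show "\<exists>u. \<forall>g\<in>G. x g = (\<Sum>v\<in>B. \<xi> v g * u v)"
          if "\<And>g. g \<in> G \<Longrightarrow> homogeneous (t - int (dg g)) (x g)" "(\<Sum>g\<in>G. g * x g) = 0" for t x
          by (rule gen[of t]) (use that in \<open>simp add: syzygy_def mult.commute\<close>)
        show "\<exists>u. \<forall>v\<in>B. c v = (\<Sum>j\<in>{}. 0 * u j)"
          if "\<And>v. v \<in> B \<Longrightarrow> homogeneous (t - int (db v)) (c v)" "\<And>g. g \<in> G \<Longrightarrow> (\<Sum>v\<in>B. \<xi> v g * c v) = 0" for t c
          using inj[OF that] by simp
        show "\<xi> v g \<in> irrelevant_ideal" if "g \<in> G" "v \<in> B" for g v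
          using min[of "int (db v)" "\<xi> v" g] hom\<xi> \<xi>0 that by blast
      qed auto
      then show ?thesis by blast
    qed
  qed
qed

end

section \<open>Regularity equal to the initial degree\<close>

lemma matrix_on_upt:
  assumes "A \<in> carrier_mat n m"
  shows "A = matrix_on [0..<n] [0..<m] (\<lambda>i j. A $$ (i, j))"
  using assms by (intro eq_matI) (auto simp: matrix_on_def)

lemma vec_singleton_eq_iff: "vec 1 (\<lambda>_. f) = vec 1 (\<lambda>_. g) \<longleftrightarrow> f = g"
  by (auto simp: vec_eq_iff)

lemma resolution_image:
  assumes "graded_free_resolution I sh \<phi>"
  shows "I = {\<Sum>b<length (sh 0). \<phi> 0 $$ (0, b) * w b | w. True}"
proof -
  define n where "n = length (sh 0)"
  have "\<phi> 0 \<in> carrier_mat (length (target_shifts sh 0)) (length (sh 0))"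
    using assms unfolding graded_free_resolution_def by blast
  then have "\<phi> 0 = matrix_on [0..<1] [0..<n] (\<lambda>i j. \<phi> 0 $$ (i, j))"
    by (intro matrix_on_upt) (simp add: n_def)
  then have "mat_image (\<phi> 0) = {vector_on [0..<1] (\<lambda>a. \<Sum>b\<in>set [0..<n]. \<phi> 0 $$ (a, b) * x b) | x. True}"
    using mat_image_matrix_on[of "[0..<n]" "[0..<1]" "\<lambda>i j. \<phi> 0 $$ (i, j)"] by simp
  also have "\<dots> = {vec 1 (\<lambda>_. \<Sum>b<n. \<phi> 0 $$ (0, b) * x b) | x. True}"
  proof -
    have "vector_on [0..<1] (\<lambda>a. \<Sum>b\<in>set [0..<n]. \<phi> 0 $$ (a, b) * x b) = vec 1 (\<lambda>_. \<Sum>b<n. \<phi> 0 $$ (0, b) * x b)" for x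
      by (intro eq_vecI) (auto simp: vector_on_def atLeast0LessThan)
    then show ?thesis by simp
  qed
  finally have eq: "{vec 1 (\<lambda>_. f) | f. f \<in> I} = {vec 1 (\<lambda>_. \<Sum>b<n. \<phi> 0 $$ (0, b) * x b) | x. True}"
    using assms unfolding graded_free_resolution_def by simp
  show ?thesis unfolding n_def[symmetric]
  proof (rule equalityI; rule subsetI)
    fix f assume "f \<in> I"
    then have "vec 1 (\<lambda>_. f) \<in> {vec 1 (\<lambda>_. \<Sum>b<n. \<phi> 0 $$ (0, b) * x b) | x. True}"
      unfolding eq[symmetric] by blast
    then obtain x where "vec 1 (\<lambda>_. f) = vec 1 (\<lambda>_. \<Sum>b<n. \<phi> 0 $$ (0, b) * x b)" by blast
    then show "f \<in> {\<Sum>b<n. \<phi> 0 $$ (0, b) * w b | w. True}" unfolding vec_singleton_eq_iff by blast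
  next
    fix f assume "f \<in> {\<Sum>b<n. \<phi> 0 $$ (0, b) * w b | w. True}"
    then have "vec 1 (\<lambda>_. f) \<in> {vec 1 (\<lambda>_. f) | f. f \<in> I}" unfolding eq by blast
    then obtain f' where "vec 1 (\<lambda>_. f) = vec 1 (\<lambda>_. f')" "f' \<in> I" by blast
    then show "f \<in> I" unfolding vec_singleton_eq_iff by simp
  qed
qed

lemma resolution_syzygies:
  assumes "graded_free_resolution I sh \<phi>"
  shows "(\<forall>a<length (target_shifts sh j). (\<Sum>b<length (sh j). \<phi> j $$ (a, b) * x b) = 0) \<longleftrightarrow>
    (\<exists>u. \<forall>b<length (sh j). x b = (\<Sum>c<length (sh (Suc j)). \<phi> (Suc j) $$ (b, c) * u c))"
proof -
  let ?l = "length (target_shifts sh j)" and ?n = "length (sh j)" and ?m = "length (sh (Suc j))"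
  have "\<phi> j \<in> carrier_mat ?l ?n" "\<phi> (Suc j) \<in> carrier_mat (length (target_shifts sh (Suc j))) ?m"
    using assms unfolding graded_free_resolution_def by blast+
  then have \<phi>: "\<phi> j = matrix_on [0..<?l] [0..<?n] (\<lambda>i j'. \<phi> j $$ (i, j'))"
    "\<phi> (Suc j) = matrix_on [0..<?n] [0..<?m] (\<lambda>i j'. \<phi> (Suc j) $$ (i, j'))"
    by (intro matrix_on_upt, simp)+
  have "mat_image (\<phi> (Suc j)) = mat_kernel (\<phi> j)"
    using assms unfolding graded_free_resolution_def by blast
  then have "{vector_on [0..<?n] (\<lambda>b. \<Sum>c\<in>set [0..<?m]. \<phi> (Suc j) $$ (b, c) * u c) | u. True}
    = {vector_on [0..<?n] x | x. \<forall>a\<in>set [0..<?l]. (\<Sum>b\<in>set [0..<?n]. \<phi> j $$ (a, b) * x b) = 0}"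
    using mat_image_matrix_on[of "[0..<?m]" "[0..<?n]" "\<lambda>i j'. \<phi> (Suc j) $$ (i, j')"]
      mat_kernel_matrix_on[of "[0..<?n]" "[0..<?l]" "\<lambda>i j'. \<phi> j $$ (i, j')"] \<phi> by simp
  note eq = this[unfolded set_upt atLeast0LessThan]
  show ?thesis
  proof
    assume "\<forall>a<?l. (\<Sum>b<?n. \<phi> j $$ (a, b) * x b) = 0"
    then have "vector_on [0..<?n] x \<in> {vector_on [0..<?n] (\<lambda>b. \<Sum>c<?m. \<phi> (Suc j) $$ (b, c) * u c) | u. True}"
      unfolding eq by blast
    then obtain u where "vector_on [0..<?n] x = vector_on [0..<?n] (\<lambda>b. \<Sum>c<?m. \<phi> (Suc j) $$ (b, c) * u c)" by blast
    then show "\<exists>u. \<forall>b<?n. x b = (\<Sum>c<?m. \<phi> (Suc j) $$ (b, c) * u c)"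
      unfolding vector_on_eq_iff by (intro exI[of _ u]) simp
  next
    assume "\<exists>u. \<forall>b<?n. x b = (\<Sum>c<?m. \<phi> (Suc j) $$ (b, c) * u c)"
    then obtain u where "\<forall>b<?n. x b = (\<Sum>c<?m. \<phi> (Suc j) $$ (b, c) * u c)" ..
    then have "vector_on [0..<?n] x = vector_on [0..<?n] (\<lambda>b. \<Sum>c<?m. \<phi> (Suc j) $$ (b, c) * u c)"
      unfolding vector_on_eq_iff by simp
    then have "vector_on [0..<?n] x \<in> {vector_on [0..<?n] x | x. \<forall>a\<in>{..<?l}. (\<Sum>b<?n. \<phi> j $$ (a, b) * x b) = 0}"
      unfolding eq[symmetric] by blast
    then obtain x' where x': "vector_on [0..<?n] x = vector_on [0..<?n] x'"
      "\<forall>a\<in>{..<?l}. (\<Sum>b<?n. \<phi> j $$ (a, b) * x' b) = 0" by blast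
    have "(\<Sum>b<?n. \<phi> j $$ (a, b) * x b) = (\<Sum>b<?n. \<phi> j $$ (a, b) * x' b)" for a
      using x'(1) unfolding vector_on_eq_iff by (intro sum.cong) auto
    then show "\<forall>a<?l. (\<Sum>b<?n. \<phi> j $$ (a, b) * x b) = 0" using x'(2) by simp
  qed
qed

text \<open>
  Once some minimal resolution exists, the shifts chosen in the definition of the regularity belong
  to one, and the maximum there runs over a finite set.
\<close>

lemma regularity_bounds_shifts:
  assumes "\<exists>sh \<phi>. minimal_graded_free_resolution I sh \<phi>"
  shows "\<exists>sh \<phi>. minimal_graded_free_resolution I sh \<phi> \<and> (\<forall>j. \<forall>s\<in>set (sh j). s \<le> regularity I + int j)"
proof -
  define sh where "sh = (SOME sh. \<exists>\<phi>. minimal_graded_free_resolution I sh \<phi>)"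
  have "\<exists>\<phi>. minimal_graded_free_resolution I sh \<phi>"
    unfolding sh_def using assms by (rule someI_ex)
  then obtain \<phi> where res: "minimal_graded_free_resolution I sh \<phi>" ..
  then have "graded_free_resolution I sh \<phi>" unfolding minimal_graded_free_resolution_def ..
  then have "\<exists>r. \<forall>j>r. sh j = []" unfolding graded_free_resolution_def ..
  then obtain r where r: "\<forall>j>r. sh j = []" ..
  let ?S = "{Max (set (sh j)) - int j | j. sh j \<noteq> []}"
  have "?S \<subseteq> (\<lambda>j. Max (set (sh j)) - int j) ` {..r}"
  proof
    fix v assume "v \<in> ?S"
    then obtain j where j: "v = Max (set (sh j)) - int j" "sh j \<noteq> []" by blast
    then have "j \<in> {..r}" using r by (cases "j > r") auto
    then show "v \<in> (\<lambda>j. Max (set (sh j)) - int j) ` {..r}" using j(1) by blast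
  qed
  then have fin: "finite ?S" by (rule finite_subset) simp
  have "s \<le> regularity I + int j" if s: "s \<in> set (sh j)" for s j
  proof -
    have "sh j \<noteq> []" using s by auto
    then have "Max (set (sh j)) - int j \<in> ?S" by blast
    then have "Max (set (sh j)) - int j \<le> regularity I"
      unfolding regularity_def Let_def sh_def[symmetric] by (rule Max_ge[OF fin])
    moreover have "s \<le> Max (set (sh j))" using s by (intro Max_ge) auto
    ultimately show ?thesis by linarith
  qed
  with res show ?thesis by (intro exI[of _ sh] exI[of _ \<phi>]) auto
qed

text \<open>
  Components of any solution of the right degrees form a homogeneous solution.
\<close>

lemma homogeneous_solution:
  fixes A :: "'a \<Rightarrow> 'b \<Rightarrow> 'k::field poly3"
  assumes A: "\<And>a b. a \<in> S \<Longrightarrow> b \<in> T \<Longrightarrow> homogeneous (db b - da a) (A a b)"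
    and x: "\<And>a. a \<in> S \<Longrightarrow> homogeneous (t - da a) (x a)"
    and u: "\<And>a. a \<in> S \<Longrightarrow> x a = (\<Sum>b\<in>T. A a b * u b)"
  shows "\<exists>u. (\<forall>b\<in>T. homogeneous (t - db b) (u b)) \<and> (\<forall>a\<in>S. x a = (\<Sum>b\<in>T. A a b * u b))"
proof (intro exI[of _ "\<lambda>b. component (t - db b) (u b)"] conjI ballI)
  fix a assume a: "a \<in> S"
  have "x a = component (t - da a) (x a)" using component_same[OF x[OF a]] by simp
  also have "\<dots> = (\<Sum>b\<in>T. component (t - da a) (A a b * u b))" unfolding u[OF a] by (rule component_sum)
  also have "\<dots> = (\<Sum>b\<in>T. A a b * component (t - db b) (u b))"
  proof (rule sum.cong[OF refl])
    fix b assume "b \<in> T"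
    from component_mult_left[OF A[OF a this], of "t - da a" "u b"]
    show "component (t - da a) (A a b * u b) = A a b * component (t - db b) (u b)" by simp
  qed
  finally show "x a = (\<Sum>b\<in>T. A a b * component (t - db b) (u b))" .
qed simp

context saturated_ideal
begin

text \<open>
  A socle argument, by descending induction on the degree from the range of \<open>large_degree\<close>. If the
  claim holds in degree \<open>s + 1\<close> and \<open>g\<close> has degree \<open>s\<close>, then modulo \<open>h\<close> the products \<open>y g\<close> and \<open>z g\<close>
  are combinations \<open>F a\<close> and \<open>F b\<close> of the generators, and \<open>z a - y b\<close> is a syzygy up to a multiple
  of \<open>h\<close>. Syzygies are generated in degree at most \<open>d + 1\<close>, so for \<open>s\<close> at least \<open>d\<close> its coefficients
  \<open>u\<close> have positive degree and can be written as \<open>y p + z q\<close> modulo \<open>h\<close>. Changing \<open>a\<close> and \<open>b\<close> by the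
  syzygies with coefficients \<open>q\<close> and \<open>p\<close> turns \<open>z a - y b\<close> into zero modulo \<open>h\<close>. Then the new \<open>a\<close> is
  a multiple of \<open>y\<close> modulo \<open>h\<close>, and \<open>y\<close> can be cancelled in \<open>y g = F a\<close>.
\<close>

lemma ideal_contains_forms:
  assumes res: "graded_free_resolution I sh \<phi>"
    and shifts: "\<And>s. s \<in> set (sh 1) \<Longrightarrow> s \<le> int d + 1"
    and t: "t \<ge> int d" and g: "homogeneous t g"
  shows "\<exists>f\<in>I. homogeneous t f \<and> h dvd g - f"
proof -
  define n where "n = length (sh 0)"
  define m where "m = length (sh 1)"
  define F where "F b = \<phi> 0 $$ (0, b)" for b
  define A where "A b c = \<phi> 1 $$ (b, c)" for b c
  have hom_all: "\<And>j a b. a < length (target_shifts sh j) \<Longrightarrow> b < length (sh j) \<Longrightarrow>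
        homogeneous (sh j ! b - target_shifts sh j ! a) (\<phi> j $$ (a, b))"
    using res unfolding graded_free_resolution_def by blast
  have homF: "homogeneous (sh 0 ! b - 0) (F b)" if "b < n" for b
    using hom_all[of 0 0 b] that by (simp add: F_def n_def)
  have homA: "homogeneous (sh 1 ! c - sh 0 ! b) (A b c)" if "b < n" "c < m" for b c
    using hom_all[of b 1 c] that by (simp add: A_def n_def m_def)
  have I: "I = {\<Sum>b<n. F b * w b | w. True}"
    unfolding n_def F_def by (rule resolution_image[OF res])
  have FI: "(\<Sum>b<n. F b * w b) \<in> I" for w unfolding I by blast
  have repr: "\<exists>w. (\<forall>b\<in>{..<n}. homogeneous (s - sh 0 ! b) (w b)) \<and> f = (\<Sum>b<n. F b * w b)"
    if "f \<in> I" "homogeneous s f" for f s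
  proof -
    obtain w where w: "f = (\<Sum>b<n. F b * w b)" using \<open>f \<in> I\<close> unfolding I by blast
    have "\<exists>w. (\<forall>b\<in>{..<n}. homogeneous (s - sh 0 ! b) (w b)) \<and> (\<forall>a\<in>{()}. f = (\<Sum>b<n. F b * w b))"
      by (rule homogeneous_solution[where da = "\<lambda>_. 0"]) (use homF that w in auto)
    then show ?thesis by simp
  qed
  have syz: "(\<Sum>b<n. F b * x b) = 0 \<longleftrightarrow> (\<exists>u. \<forall>b<n. x b = (\<Sum>c<m. A b c * u c))" for x
    using resolution_syzygies[OF res, of 0 x] by (simp add: F_def A_def n_def m_def)
  have step: "\<exists>f\<in>I. homogeneous s f \<and> h dvd g - f"
    if s: "s \<ge> int d" and g: "homogeneous s g"
      and up: "\<And>g. homogeneous (s + 1) g \<Longrightarrow> \<exists>f\<in>I. homogeneous (s + 1) f \<and> h dvd g - f" for s g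
  proof -
    have hyg: "homogeneous (s + 1) (y * g)" and hzg: "homogeneous (s + 1) (z * g)"
      using g by (auto intro: hom_y_mult hom_z_mult)
    obtain f1 where f1: "f1 \<in> I" "homogeneous (s + 1) f1" "h dvd y * g - f1" using up[OF hyg] by blast
    obtain f2 where f2: "f2 \<in> I" "homogeneous (s + 1) f2" "h dvd z * g - f2" using up[OF hzg] by blast
    from repr[OF f1(1,2)] obtain a where a: "\<forall>b\<in>{..<n}. homogeneous (s + 1 - sh 0 ! b) (a b)"
      "f1 = (\<Sum>b<n. F b * a b)" by blast
    from repr[OF f2(1,2)] obtain b where b: "\<forall>i\<in>{..<n}. homogeneous (s + 1 - sh 0 ! i) (b i)"
      "f2 = (\<Sum>i<n. F i * b i)" by blast
    have "h dvd y * (z * g - f2) - z * (y * g - f1)" 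
      by (rule dvd_diff[OF dvd_mult[OF f2(3)] dvd_mult[OF f1(3)]])
    then have dvd12: "h dvd z * f1 - y * f2" by (simp add: algebra_simps)
    have "homogeneous (s + 2) (z * f1 - y * f2)"
      using f1(2) f2(2) by (intro homogeneous_diff hom_y_mult hom_z_mult) (simp_all add: algebra_simps)
    with dvd12 obtain w where w: "homogeneous (s + 2 - 1) w" "z * f1 - y * f2 = h * w" by (rule dvd_homE)
    have "h * w \<in> I" unfolding w(2)[symmetric] by (intro ideal_diff ideal_mult_left f1 f2)
    then have "w \<in> I" by (rule saturated)
    from repr[OF this w(1)] obtain e where e: "\<forall>b\<in>{..<n}. homogeneous (s + 2 - 1 - sh 0 ! b) (e b)"
      "w = (\<Sum>b<n. F b * e b)" by blast
    define x where "x i = z * a i - y * b i - h * e i" for i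
    have homx: "homogeneous (s + 2 - sh 0 ! i) (x i)" if "i < n" for i
      unfolding x_def
      by (intro homogeneous_diff hom_z_mult hom_y_mult hom_h_mult) (use a(1) b(1) e(1) that in \<open>auto simp: algebra_simps\<close>)
    have "(\<Sum>i<n. F i * x i) = z * f1 - y * f2 - h * w"
      by (simp add: x_def a(2) b(2) e(2) right_diff_distrib sum_subtractf sum_distrib_left mult.left_commute)
    then have "(\<Sum>i<n. F i * x i) = 0" using w(2) by simp
    then obtain u0 where u0: "\<forall>i<n. x i = (\<Sum>c<m. A i c * u0 c)" using syz[of x] by auto
    have "\<exists>u. (\<forall>c\<in>{..<m}. homogeneous (s + 2 - sh 1 ! c) (u c)) \<and> (\<forall>i\<in>{..<n}. x i = (\<Sum>c<m. A i c * u c))"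
      by (rule homogeneous_solution[where da = "\<lambda>i. sh 0 ! i" and u = u0]) (use homA homx u0 in auto)
    then obtain u where u: "\<forall>c\<in>{..<m}. homogeneous (s + 2 - sh 1 ! c) (u c)"
      "\<forall>i\<in>{..<n}. x i = (\<Sum>c<m. A i c * u c)" by blast
    have "\<forall>c\<in>{..<m}. \<exists>pq. homogeneous (s + 1 - sh 1 ! c) (fst pq) \<and> homogeneous (s + 1 - sh 1 ! c) (snd pq) \<and>
      h dvd u c - (y * fst pq + z * snd pq)"
    proof
      fix c assume c: "c \<in> {..<m}"
      then have "sh 1 ! c \<le> int d + 1" by (intro shifts) (simp add: m_def)
      then have "s + 2 - sh 1 ! c > 0" using s by simp
      from pos_decomp[OF u(1)[rule_format, OF c] this] obtain p q r where
        "homogeneous (s + 2 - sh 1 ! c - 1) p" "homogeneous (s + 2 - sh 1 ! c - 1) q" "u c = y * p + z * q + h * r"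
        by blast
      then show "\<exists>pq. homogeneous (s + 1 - sh 1 ! c) (fst pq) \<and> homogeneous (s + 1 - sh 1 ! c) (snd pq) \<and>
        h dvd u c - (y * fst pq + z * snd pq)"
        by (intro exI[of _ "(p, q)"]) (simp add: algebra_simps)
    qed
    from bchoice[OF this] obtain pq where pq: "\<forall>c\<in>{..<m}. homogeneous (s + 1 - sh 1 ! c) (fst (pq c)) \<and>
      homogeneous (s + 1 - sh 1 ! c) (snd (pq c)) \<and> h dvd u c - (y * fst (pq c) + z * snd (pq c))" ..
    define p q where "p c = fst (pq c)" and "q c = snd (pq c)" for c
    define P where "P i = - (b i + (\<Sum>c<m. A i c * p c))" for i
    define Q where "Q i = a i - (\<Sum>c<m. A i c * q c)" for i
    have "\<forall>i\<in>{..<n}. \<exists>r. homogeneous (s + 1 - sh 0 ! i - 1) r \<and> h dvd Q i + y * r"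
    proof
      fix i assume i: "i \<in> {..<n}"
      have homAp: "homogeneous (s + 1 - sh 0 ! i) (\<Sum>c<m. A i c * p c)"
      proof (rule homogeneous_sum)
        fix c assume "c \<in> {..<m}"
        then show "homogeneous (s + 1 - sh 0 ! i) (A i c * p c)"
          using homA[of i c] pq i by (intro homogeneous_mult'[of "sh 1 ! c - sh 0 ! i" _ "s + 1 - sh 1 ! c"]) (auto simp: p_def)
      qed
      have homAq: "homogeneous (s + 1 - sh 0 ! i) (\<Sum>c<m. A i c * q c)"
      proof (rule homogeneous_sum)
        fix c assume "c \<in> {..<m}"
        then show "homogeneous (s + 1 - sh 0 ! i) (A i c * q c)"
          using homA[of i c] pq i by (intro homogeneous_mult'[of "sh 1 ! c - sh 0 ! i" _ "s + 1 - sh 1 ! c"]) (auto simp: q_def)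
      qed
      have homP: "homogeneous (s + 1 - sh 0 ! i) (P i)"
        unfolding P_def using b(1) i homAp by (intro homogeneous_uminus homogeneous_add) auto
      have homQ: "homogeneous (s + 1 - sh 0 ! i) (Q i)"
        unfolding Q_def using a(1) i homAq by (intro homogeneous_diff) auto
      have "h dvd (\<Sum>c<m. A i c * (u c - (y * p c + z * q c))) + h * e i"
        using pq by (intro dvd_add dvd_sum) (auto simp: p_def q_def)
      also have "(\<Sum>c<m. A i c * (u c - (y * p c + z * q c)))
         = x i - (y * (\<Sum>c<m. A i c * p c) + z * (\<Sum>c<m. A i c * q c))"
        using u(2) i by (simp add: right_diff_distrib distrib_left sum_subtractf sum.distrib sum_distrib_left mult.left_commute)
      finally have "h dvd y * P i + z * Q i"
        by (simp add: x_def P_def Q_def algebra_simps)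
      from koszul[OF homP homQ this] obtain r where "homogeneous (s + 1 - sh 0 ! i - 1) r" "h dvd Q i + y * r" by blast
      then show "\<exists>r. homogeneous (s + 1 - sh 0 ! i - 1) r \<and> h dvd Q i + y * r" by (intro exI[of _ r] conjI)
    qed
    from bchoice[OF this] obtain r where r: "\<forall>i\<in>{..<n}. homogeneous (s + 1 - sh 0 ! i - 1) (r i) \<and> h dvd Q i + y * r i" ..
    define v where "v = (\<Sum>i<n. F i * r i)"
    have homv: "homogeneous s v"
      unfolding v_def
    proof (rule homogeneous_sum)
      fix i assume "i \<in> {..<n}"
      then show "homogeneous s (F i * r i)"
        using homF[of i] r by (intro homogeneous_mult'[of "sh 0 ! i" _ "s + 1 - sh 0 ! i - 1"]) auto
    qed
    have "\<exists>u. \<forall>i<n. (\<Sum>c<m. A i c * q c) = (\<Sum>c<m. A i c * u c)" by (intro exI[of _ q]) simp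
    then have 0: "(\<Sum>i<n. F i * (\<Sum>c<m. A i c * q c)) = 0" by (simp only: syz)
    have "h dvd (\<Sum>i<n. F i * (Q i + y * r i))" using r by (intro dvd_sum dvd_mult) auto
    also have "(\<Sum>i<n. F i * (Q i + y * r i)) = f1 - (\<Sum>i<n. F i * (\<Sum>c<m. A i c * q c)) + y * v"
      unfolding Q_def a(2) v_def sum_distrib_left[of y]
      by (simp add: right_diff_distrib distrib_left sum_subtractf sum.distrib mult.left_commute)
    finally have "h dvd f1 + y * v" using 0 by simp
    then have "h dvd (y * g - f1) + (f1 + y * v)" by (rule dvd_add[OF f1(3)])
    then have "h dvd y * (g + v)" by (simp add: algebra_simps)
    then have "h dvd g + v" by (rule y_cancel[OF homogeneous_add[OF g homv]])
    moreover have "- v \<in> I" unfolding v_def by (intro ring.subspace_neg[OF ideal] FI)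
    ultimately show ?thesis using homv by (intro bexI[of _ "- v"]) (auto intro: homogeneous_uminus)
  qed
  have "\<exists>f\<in>I. homogeneous t f \<and> h dvd g - f" if "homogeneous t g" "t \<ge> int d" "t + int k \<ge> int (2 * N)" for k t g
    using that
  proof (induction k arbitrary: t g)
    case 0
    then show ?case by (intro large_degree) auto
  next
    case (Suc k)
    show ?case
    proof (rule step[OF Suc.prems(2,1)])
      fix g :: "'k poly3" assume "homogeneous (t + 1) g"
      then show "\<exists>f\<in>I. homogeneous (t + 1) f \<and> h dvd g - f"
        using Suc.prems by (intro Suc.IH) auto
    qed
  qed
  from this[OF g t, of "2 * N"] t show ?thesis by simp
qed

text \<open>
  In degree \<open>d\<close> the residue map from the ideal to the binary forms is surjective by
  \<open>ideal_contains_forms\<close>. It is injective because an element \<open>h q\<close> of the ideal of degree \<open>d\<close> has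
  \<open>q\<close> in the ideal, in degree \<open>d - 1\<close>, where the ideal is zero. So the lifts of the monomials are a
  basis in degree \<open>d\<close>, and their relations modulo \<open>h\<close> lift as well.
\<close>

lemma powers_linear:
  assumes reg: "regularity I = int d"
    and low: "\<And>f t. f \<in> I \<Longrightarrow> homogeneous t f \<Longrightarrow> t < int d \<Longrightarrow> f = 0"
    and m: "m \<ge> 1"
  shows "has_linear_resolution (ideal_power I m)"
proof -
  from regularity_bounds_shifts[OF minimal_resolution_exists] obtain sh \<phi> where
    min: "minimal_graded_free_resolution I sh \<phi>" and "\<forall>j. \<forall>s\<in>set (sh j). s \<le> int d + int j"
    unfolding reg by (elim exE conjE)
  then have shifts: "\<And>j s. s \<in> set (sh j) \<Longrightarrow> s \<le> int d + int j" by simp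
  have res: "graded_free_resolution I sh \<phi>" using min unfolding minimal_graded_free_resolution_def ..
  have "\<forall>i\<in>{..d}. \<exists>f. f \<in> I \<and> homogeneous (int d) f \<and> h dvd y ^ i * z ^ (d - i) - f"
  proof
    fix i assume "i \<in> {..d}"
    then have "homogeneous (int d) (y ^ i * z ^ (d - i))" using hom_monomial[of i "d - i"] by simp
    from ideal_contains_forms[OF res _ _ this, of d] shifts[of _ 1]
    show "\<exists>f. f \<in> I \<and> homogeneous (int d) f \<and> h dvd y ^ i * z ^ (d - i) - f" by auto
  qed
  from bchoice[OF this] obtain f where
    f: "\<forall>i\<in>{..d}. f i \<in> I \<and> homogeneous (int d) (f i) \<and> h dvd y ^ i * z ^ (d - i) - f i" ..
  have combo: "\<exists>c. x = (\<Sum>j\<le>d. const_poly (c j) * f j)" if x: "x \<in> I" "homogeneous (int d) x" for x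
  proof -
    obtain c where c: "h dvd x - binary_form d c" using binary_form_mod x(2) by blast
    define s where "s = (\<Sum>j\<le>d. const_poly (c j) * f j)"
    have "h dvd (\<Sum>j\<le>d. const_poly (c j) * (y ^ j * z ^ (d - j) - f j))" using f by (intro dvd_sum dvd_mult) auto
    then have "h dvd binary_form d c - s"
      by (simp add: binary_form_def s_def right_diff_distrib sum_subtractf)
    then have dvd: "h dvd x - s" using c dvd_diff_trans by blast
    have s: "s \<in> I" "homogeneous (int d) s"
      unfolding s_def using f by (auto intro!: ideal_sum ideal_mult_left homogeneous_sum homogeneous_const_mult)
    obtain q where q: "homogeneous (int d - 1) q" "x - s = h * q"
      by (rule dvd_homE[OF dvd homogeneous_diff[OF x(2) s(2)]])
    have "h * q \<in> I" unfolding q(2)[symmetric] by (rule ideal_diff[OF x(1) s(1)])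
    then have "q = 0" using low[OF saturated q(1)] by simp
    then have "x = s" using q(2) by simp
    then show ?thesis unfolding s_def by (intro exI[of _ c])
  qed
  interpret binary_lifts h y z f d
  proof
    fix i assume "i \<le> d"
    then show "homogeneous (int d) (f i)" "h dvd f i - y ^ i * z ^ (d - i)"
      using f dvd_diff_sym by auto
  next
    fix i assume i: "i < d"
    have fi: "h dvd f j - y ^ j * z ^ (d - j)" if "j \<le> d" for j using f that dvd_diff_sym by auto
    have "z ^ (d - i) = z * z ^ (d - Suc i)" using i by (metis Suc_diff_Suc power_Suc)
    then have "z * f (Suc i) - y * f i = z * (f (Suc i) - y ^ Suc i * z ^ (d - Suc i)) - y * (f i - y ^ i * z ^ (d - i))"
      by (simp add: algebra_simps)
    also have "h dvd \<dots>" by (rule dvd_diff[OF dvd_mult[OF fi] dvd_mult[OF fi]]) (use i in auto)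
    finally have dvd: "h dvd z * f (Suc i) - y * f i" .
    have "homogeneous (int d + 1) (z * f (Suc i) - y * f i)"
      using f i by (intro homogeneous_diff hom_z_mult hom_y_mult) auto
    with dvd obtain q where q: "homogeneous (int d + 1 - 1) q" "z * f (Suc i) - y * f i = h * q" by (rule dvd_homE)
    have "h * q \<in> I" unfolding q(2)[symmetric] using f i by (intro ideal_diff ideal_mult_left) auto
    then have "q \<in> I" by (rule saturated)
    then obtain c where "q = (\<Sum>j\<le>d. const_poly (c j) * f j)" using combo q(1) by fastforce
    then show "\<exists>c. z * f (Suc i) - y * f i = h * (\<Sum>j\<le>d. const_poly (c j) * f j)"
      using q(2) by (intro exI[of _ c]) simp
  qed
  have I: "I = {\<Sum>b<length (sh 0). \<phi> 0 $$ (0, b) * w b | w. True}" by (rule resolution_image[OF res])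
  have "I = ideal_gen (f ` {..d})"
  proof (rule equalityI)
    show "ideal_gen (f ` {..d}) \<subseteq> I" using f ideal by (intro ring.span_minimal) auto
    have F: "\<phi> 0 $$ (0, b) \<in> ideal_gen (f ` {..d})" if b: "b < length (sh 0)" for b
    proof -
      have "\<forall>j. \<forall>a<length (target_shifts sh j). \<forall>b<length (sh j).
        homogeneous (sh j ! b - target_shifts sh j ! a) (\<phi> j $$ (a, b))"
        using res unfolding graded_free_resolution_def by blast
      from this[rule_format, of 0 0 b] have hom: "homogeneous (sh 0 ! b) (\<phi> 0 $$ (0, b))" using b by simp
      have "(\<Sum>b'<length (sh 0). \<phi> 0 $$ (0, b') * (if b' = b then 1 else 0)) \<in> I"
        unfolding I by (intro CollectI exI[of _ "\<lambda>b'. if b' = b then 1 else 0"]) simp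
      moreover have "(\<Sum>b'<length (sh 0). \<phi> 0 $$ (0, b') * (if b' = b then 1 else 0)) = \<phi> 0 $$ (0, b)"
        using b by (simp add: if_distrib[of "\<lambda>u. _ * u"] cong: if_cong)
      ultimately have inI: "\<phi> 0 $$ (0, b) \<in> I" by simp
      have le: "sh 0 ! b \<le> int d" using shifts[of "sh 0 ! b" 0] b by simp
      show ?thesis
      proof (cases "sh 0 ! b = int d")
        case True
        then obtain c where eq: "\<phi> 0 $$ (0, b) = (\<Sum>j\<le>d. const_poly (c j) * f j)" using combo[OF inI] hom by auto
        show ?thesis unfolding eq by (rule ring.span_sum, rule ring.span_scale, rule ring.span_base) simp
      next
        case False
        then have "\<phi> 0 $$ (0, b) = 0" using low[OF inI hom] le by simp
        then show ?thesis by (simp add: ring.span_zero)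
      qed
    qed
    show "I \<subseteq> ideal_gen (f ` {..d})"
    proof
      fix g assume "g \<in> I"
      then obtain w where g: "g = (\<Sum>b<length (sh 0). \<phi> 0 $$ (0, b) * w b)" unfolding I by blast
      have "\<phi> 0 $$ (0, b) * w b \<in> ideal_gen (f ` {..d})" if "b < length (sh 0)" for b
        using ring.span_scale[OF F[OF that], of "w b"] by (simp add: mult.commute)
      then show "g \<in> ideal_gen (f ` {..d})" unfolding g by (intro ring.span_sum) auto
    qed
  qed
  then show ?thesis using power_linear_resolution[OF m] by simp
qed

end

section \<open>Ideals of points\<close>

text \<open>
  Over a finite field the polynomial \<open>1\<close> plus the product of all \<open>X - x\<close> has no root.
\<close>

lemma infinite_alg_closed_field: "infinite (UNIV :: 'k::alg_closed_field set)"
proof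
  assume fin: "finite (UNIV :: 'k set)"
  define q :: "'k poly" where "q = (\<Prod>x\<in>UNIV. [:- x, 1:])"
  have root: "poly q x = 0" for x
    unfolding q_def poly_prod using fin by (intro prod_zero) auto
  have "degree q = card (UNIV :: 'k set)"
    unfolding q_def by (subst degree_prod_eq_sum_degree) auto
  then have "degree q > 0" using fin by (simp add: card_gt_0_iff)
  then have "degree (q + 1) > 0" by (subst degree_add_eq_left) auto
  then obtain x where "poly (q + 1) x = 0" using alg_closed_imp_poly_has_root by blast
  then show False using root by simp
qed

lemma exhaust_indices: "i = 0 \<or> i = 1 \<or> i = 2" for i :: 3
proof (induct i)
  case (of_int n)
  then have "0 \<le> n" and "n < 3" by simp_all
  then have "n = 0 \<or> n = 1 \<or> n = 2" by arith
  then show ?case by auto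
qed

lemma UNIV_indices: "(UNIV :: 3 set) = {0, 1, 2}"
  using exhaust_indices by auto

lemma indices_distinct: "(0::3) \<noteq> 1" "(0::3) \<noteq> 2" "(1::3) \<noteq> 2"
proof -
  have "card {0, 1, 2::3} = 3" unfolding UNIV_indices[symmetric] by simp
  then show "(0::3) \<noteq> 1" "(0::3) \<noteq> 2" "(1::3) \<noteq> 2" by (auto simp: card_insert_if split: if_splits)
qed

lemma sum_indices: "(\<Sum>i\<in>UNIV. F i) = F 0 + F 1 + F (2::3)" for F :: "3 \<Rightarrow> 'a::comm_monoid_add"
  unfolding UNIV_indices using indices_distinct by (simp add: add.assoc)

text \<open>
  The coefficient vectors run along a conic, so that a given point lies on at most two of these
  lines. This leaves a line that avoids any finite set of points. The coefficient of the first
  coordinate is one, so the other two coordinates complete the form to a coordinate system.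
\<close>

definition line :: "'k::field \<Rightarrow> 'k poly3" where
  "line a = coord 0 + const_poly a * coord 1 + const_poly (a\<^sup>2) * coord 2"

lemma eval3_line: "eval3 (line a) v = v 0 + a * v 1 + a\<^sup>2 * v 2"
  by (simp add: line_def eval3_add eval3_mult)

lemma homogeneous_line: "homogeneous 1 (line a)"
  unfolding line_def by (intro homogeneous_add homogeneous_const_mult homogeneous_coord)

text \<open>
  For independence, the binary form is evaluated at the points of the line with last coordinate
  one. There it becomes a polynomial in one variable that vanishes on an infinite field.
\<close>

lemma plane_coords_line:
  fixes a :: "'k::field"
  assumes inf: "infinite (UNIV :: 'k set)"
  shows "plane_coords (line a) (coord 1) (coord 2)"
proof
  show "homogeneous 1 (line a)" by (rule homogeneous_line)
  show "line a \<noteq> 0"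
  proof
    assume "line a = 0"
    then have "eval3 (line a) (\<lambda>i. if i = 0 then 1 else 0) = 0" by simp
    then show False unfolding eval3_line using indices_distinct by simp
  qed
next
  fix t and f :: "'k poly3" assume "homogeneous t f" "t > 0"
  then obtain g where g: "\<And>i. homogeneous (t - 1) (g i)" "f = (\<Sum>i\<in>UNIV. coord i * g i)"
    by (rule homogeneous_pos_decomp) blast
  have c0: "coord 0 = line a - const_poly a * coord 1 - const_poly (a\<^sup>2) * coord 2"
    by (simp add: line_def)
  have "f = coord 0 * g 0 + coord 1 * g 1 + coord 2 * g 2" unfolding g(2) by (rule sum_indices)
  also have "\<dots> = coord 1 * (g 1 - const_poly a * g 0) + coord 2 * (g 2 - const_poly (a\<^sup>2) * g 0) + line a * g 0"
    unfolding c0 by (simp add: algebra_simps)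
  finally have "f = coord 1 * (g 1 - const_poly a * g 0) + coord 2 * (g 2 - const_poly (a\<^sup>2) * g 0) + line a * g 0" .
  then show "\<exists>p q r. homogeneous (t - 1) p \<and> homogeneous (t - 1) q \<and> homogeneous (t - 1) r \<and>
      f = coord 1 * p + coord 2 * q + line a * r"
    using g(1) by (intro exI[of _ "g 1 - const_poly a * g 0"] exI[of _ "g 2 - const_poly (a\<^sup>2) * g 0"] exI[of _ "g 0"])
      (simp add: homogeneous_diff homogeneous_const_mult)
next
  fix c :: "nat \<Rightarrow> 'k" and i n
  assume dvd: "line a dvd (\<Sum>i\<le>n. const_poly (c i) * (coord 1 ^ i * coord 2 ^ (n - i)))" and i: "i \<le> n"
  define p where "p = (\<Sum>i\<le>n. monom (c i) i)"
  obtain q where q: "(\<Sum>i\<le>n. const_poly (c i) * (coord 1 ^ i * coord 2 ^ (n - i))) = line a * q"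
    using dvd by (elim dvdE)
  have "poly p s = 0" for s
  proof -
    define v where "v = (\<lambda>i :: 3. if i = 0 then - (a * s + a\<^sup>2) else if i = 1 then s else 1)"
    have v: "v 0 = - (a * s + a\<^sup>2)" "v 1 = s" "v 2 = 1" using indices_distinct by (auto simp: v_def)
    have "poly p s = (\<Sum>i\<le>n. c i * s ^ i)" by (simp add: p_def poly_sum poly_monom)
    also have "\<dots> = eval3 (\<Sum>i\<le>n. const_poly (c i) * (coord 1 ^ i * coord 2 ^ (n - i))) v"
      by (simp add: eval3_sum eval3_mult eval3_power v)
    also have "\<dots> = 0" unfolding q by (simp add: eval3_mult eval3_line v)
    finally show ?thesis .
  qed
  then have "p = 0" using poly_roots_finite[of p] inf by auto
  then have "coeff p i = 0" by simp
  moreover have "coeff p i = c i" using i by (simp add: p_def coeff_sum)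
  ultimately show "c i = 0" by simp
qed auto

text \<open>
  The ideal has homogeneous generators, so membership can be tested on components. This makes
  saturation visible: multiplication by a linear form multiplies the values of the components at a
  vector by the value of the linear form.
\<close>

lemma ideal_of_points_iff:
  "f \<in> ideal_of_points Z \<longleftrightarrow> (\<forall>t. \<forall>P\<in>Z. \<forall>v\<in>P. eval3 (component t f) v = 0)"
proof
  let ?I = "{f. \<forall>t. \<forall>P\<in>Z. \<forall>v\<in>P. eval3 (component t f) v = 0}"
  have "ring.subspace ?I"
  proof (rule ring.subspaceI)
    fix c f assume f: "f \<in> ?I"
    have "component t (c * f) = (\<Sum>u\<in>degrees c. component u c * component (t - u) f)" for t
    proof -
      have "c * f = (\<Sum>u\<in>degrees c. component u c * f)" by (simp add: sum_components flip: sum_distrib_right)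
      then have "component t (c * f) = (\<Sum>u\<in>degrees c. component t (component u c * f))"
        by (simp add: component_sum)
      then show ?thesis by (simp add: component_mult_left[OF homogeneous_component])
    qed
    then show "c * f \<in> ?I" using f by (simp add: eval3_sum eval3_mult)
  qed (auto simp: component_add eval3_add)
  moreover have "{f. (\<exists>d. homogeneous d f) \<and> (\<forall>P\<in>Z. \<forall>v\<in>P. eval3 f v = 0)} \<subseteq> ?I"
    by (auto simp: component_homogeneous)
  ultimately have "ideal_of_points Z \<subseteq> ?I" unfolding ideal_of_points_def by (intro ring.span_minimal)
  moreover assume "f \<in> ideal_of_points Z"
  ultimately show "\<forall>t. \<forall>P\<in>Z. \<forall>v\<in>P. eval3 (component t f) v = 0" by blast
next
  assume f: "\<forall>t. \<forall>P\<in>Z. \<forall>v\<in>P. eval3 (component t f) v = 0"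
  have "component t f \<in> ideal_of_points Z" for t
    unfolding ideal_of_points_def using f by (intro ring.span_base) (auto intro: homogeneous_component)
  then have "(\<Sum>t\<in>degrees f. component t f) \<in> ideal_of_points Z"
    unfolding ideal_of_points_def by (intro ring.span_sum) auto
  then show "f \<in> ideal_of_points Z" by (simp add: sum_components)
qed

lemma dvd_power_minus_prod:
  fixes l :: "'a::comm_ring_1"
  assumes "finite Z" shows "l dvd x ^ card Z - (\<Prod>P\<in>Z. x - c P * l)"
  using assms
proof (induction Z rule: finite_induct)
  case (insert P Z)
  have "x ^ card (insert P Z) - (\<Prod>Q\<in>insert P Z. x - c Q * l)
    = x * (x ^ card Z - (\<Prod>Q\<in>Z. x - c Q * l)) + l * (c P * (\<Prod>Q\<in>Z. x - c Q * l))"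
    using insert.hyps by (simp add: algebra_simps)
  then show ?case using insert.IH by simp
qed simp

lemma proj_plane_coordinates:
  assumes "P \<in> proj_plane"
  shows "\<exists>u. u \<noteq> (\<lambda>_. 0) \<and> (\<forall>v\<in>P. \<exists>c. c \<noteq> 0 \<and> v = (\<lambda>i. c * u i))"
proof -
  obtain u where "u \<noteq> (\<lambda>_. 0)" "P = proj_rel `` {u}"
    using assms unfolding proj_plane_def by (elim quotientE) auto
  then show ?thesis by (intro exI[of _ u]) (auto simp: proj_rel_def)
qed

lemma avoiding_line:
  fixes Z :: "(3 \<Rightarrow> 'k::field) set set"
  assumes Z: "Z \<subseteq> proj_plane" "finite Z" and inf: "infinite (UNIV :: 'k set)"
  shows "\<exists>a. \<forall>P\<in>Z. \<forall>v\<in>P. eval3 (line a) v \<noteq> 0"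
proof -
  have "\<forall>P\<in>Z. \<exists>u. u \<noteq> (\<lambda>_. 0) \<and> (\<forall>v\<in>P. \<exists>c. c \<noteq> 0 \<and> v = (\<lambda>i. c * u i))"
    using Z(1) by (intro ballI) (rule proj_plane_coordinates, rule subsetD)
  from bchoice[OF this] obtain u where u: "\<forall>P\<in>Z. u P \<noteq> (\<lambda>_. 0) \<and> (\<forall>v\<in>P. \<exists>c. c \<noteq> 0 \<and> v = (\<lambda>i. c * u P i))" ..
  define p where "p P = [:u P 0, u P 1, u P 2:]" for P
  have "p P \<noteq> 0" if "P \<in> Z" for P
  proof
    assume "p P = 0"
    then have "u P 0 = 0" "u P 1 = 0" "u P 2 = 0" by (auto simp: p_def)
    then have "u P i = 0" for i using exhaust_indices[of i] by auto
    then have "u P = (\<lambda>_. 0)" by (intro ext)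
    then show False using u that by blast
  qed
  then have "finite (\<Union>P\<in>Z. {a. poly (p P) a = 0})" using Z(2) poly_roots_finite by blast
  then obtain a where a: "a \<notin> (\<Union>P\<in>Z. {a. poly (p P) a = 0})" using inf ex_new_if_finite by blast
  show ?thesis
  proof (intro exI[of _ a] ballI)
    fix P v assume P: "P \<in> Z" "v \<in> P"
    then obtain c where c: "c \<noteq> 0" "v = (\<lambda>i. c * u P i)" using u by blast
    have "eval3 (line a) v = c * poly (p P) a"
      by (simp add: eval3_line c(2) p_def algebra_simps power2_eq_square)
    then show "eval3 (line a) v \<noteq> 0" using c(1) a P(1) by auto
  qed
qed

text \<open>
  Each point off the line \<open>h = 0\<close> is a zero of \<open>x - c h\<close>, where \<open>x\<close> is a coordinate and \<open>c\<close> is the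
  value of \<open>x / h\<close> at the point. The product over all points lies in the ideal and is a power of \<open>x\<close>
  modulo \<open>h\<close>.
\<close>

lemma coord_power_mod:
  assumes Z: "Z \<subseteq> proj_plane" "finite Z" and line: "\<And>P v. P \<in> Z \<Longrightarrow> v \<in> P \<Longrightarrow> eval3 (line a) v \<noteq> 0"
  shows "\<exists>f\<in>ideal_of_points Z. line a dvd coord i ^ card Z - f"
proof -
  have "\<forall>P\<in>Z. \<exists>c. \<forall>v\<in>P. v i = c * eval3 (line a) v"
  proof
    fix P assume P: "P \<in> Z"
    then have "P \<in> proj_plane" using Z(1) by blast
    from proj_plane_coordinates[OF this] obtain u where
      u: "u \<noteq> (\<lambda>_. 0)" "\<forall>v\<in>P. \<exists>c. c \<noteq> 0 \<and> v = (\<lambda>i. c * u i)" by (elim exE conjE)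
    show "\<exists>c. \<forall>v\<in>P. v i = c * eval3 (line a) v"
    proof (intro exI[of _ "u i / eval3 (line a) u"] ballI)
      fix v assume v: "v \<in> P"
      then obtain c where c: "c \<noteq> 0" "v = (\<lambda>i. c * u i)" using u(2) by blast
      have "eval3 (line a) v = c * eval3 (line a) u" unfolding c(2) eval3_line by (simp add: algebra_simps)
      moreover have "eval3 (line a) v \<noteq> 0" by (rule line[OF P v])
      ultimately show "v i = u i / eval3 (line a) u * eval3 (line a) v" unfolding c(2) by auto
    qed
  qed
  from bchoice[OF this] obtain c where c: "\<forall>P\<in>Z. \<forall>v\<in>P. v i = c P * eval3 (line a) v" ..
  define f where "f = (\<Prod>P\<in>Z. coord i - const_poly (c P) * line a)"
  have "homogeneous (int (card A)) (\<Prod>P\<in>A. coord i - const_poly (c P) * line a)" if "finite A" for A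
    using that
  proof (induction A rule: finite_induct)
    case (insert P A)
    have "homogeneous 1 (coord i - const_poly (c P) * line a)"
      by (intro homogeneous_diff homogeneous_const_mult homogeneous_line homogeneous_coord)
    from homogeneous_mult[OF this insert.IH] show ?case using insert.hyps by simp
  qed simp
  then have "homogeneous (int (card Z)) f" unfolding f_def using Z(2) by blast
  moreover have "eval3 f v = 0" if "P \<in> Z" "v \<in> P" for P v
    unfolding f_def eval3_prod using c that Z(2)
    by (intro prod_zero) (auto intro!: bexI[of _ P] simp: eval3_diff eval3_mult)
  ultimately have "f \<in> ideal_of_points Z"
    unfolding ideal_of_points_def by (intro ring.span_base) blast
  moreover have "line a dvd coord i ^ card Z - f"
    unfolding f_def by (rule dvd_power_minus_prod[OF Z(2)])
  ultimately show ?thesis by blast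
qed

lemma saturated_ideal_of_points:
  fixes Z :: "(3 \<Rightarrow> 'k::field) set set"
  assumes Z: "Z \<subseteq> proj_plane" "finite Z" and line: "\<And>P v. P \<in> Z \<Longrightarrow> v \<in> P \<Longrightarrow> eval3 (line a) v \<noteq> 0"
    and inf: "infinite (UNIV :: 'k set)"
  shows "saturated_ideal (line a) (coord 1) (coord 2) (ideal_of_points Z) (card Z)"
proof -
  interpret plane_coords "line a" "coord 1" "coord 2" by (rule plane_coords_line[OF inf])
  show ?thesis
  proof
    show "ring.subspace (ideal_of_points Z)" unfolding ideal_of_points_def by (rule ring.subspace_span)
    show "component t f \<in> ideal_of_points Z" if "f \<in> ideal_of_points Z" for f t
      using that unfolding ideal_of_points_iff by (auto simp: component_homogeneous[OF homogeneous_component])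
    show "f \<in> ideal_of_points Z" if "line a * f \<in> ideal_of_points Z" for f
      unfolding ideal_of_points_iff
    proof (intro allI ballI)
      fix t P v assume P: "P \<in> Z" "v \<in> P"
      then have "eval3 (component (t + 1) (line a * f)) v = 0" using that unfolding ideal_of_points_iff by blast
      then have "eval3 (line a) v * eval3 (component t f) v = 0"
        by (simp add: component_mult_left[OF hom_h] eval3_mult)
      then show "eval3 (component t f) v = 0" using line[OF P] by simp
    qed
    show "\<exists>f\<in>ideal_of_points Z. line a dvd coord 1 ^ card Z - f" by (rule coord_power_mod[OF Z line])
    show "\<exists>f\<in>ideal_of_points Z. line a dvd coord 2 ^ card Z - f" by (rule coord_power_mod[OF Z line])
  qed
qed

lemma initial_degree_le:
  assumes "f \<in> I" "homogeneous t f" "f \<noteq> 0" shows "int (initial_degree I) \<le> t"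
proof -
  obtain s where s: "s \<in> Poly_Mapping.keys f" using assms(3) by (metis ex_in_conv keys_eq_empty)
  have "mon_deg r = nat t" if "r \<in> Poly_Mapping.keys f" for r
    using assms(2) that unfolding homogeneous_def by force
  then have "insert 0 (mon_deg ` Poly_Mapping.keys f) = {0, nat t}" using s by force
  then have "total_degree f = nat t" by (simp add: total_degree_def)
  then have "initial_degree I \<le> nat t" unfolding initial_degree_def using assms by (intro Least_le) blast
  moreover have "t \<ge> 0" using homogeneous_neg[OF assms(2)] assms(3) by force
  ultimately show ?thesis by simp
qed

theorem corollary3p5:
  fixes Z :: "(3 \<Rightarrow> 'k::alg_closed_field) set set" and I :: "'k poly3 set"
  assumes "Z \<subseteq> proj_plane" and "finite Z"
    and "I = ideal_of_points Z"
    and "regularity I = int (initial_degree I)"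
  shows "\<forall>m\<ge>1. has_linear_resolution (ideal_power I m)"
proof (intro allI impI)
  fix m :: nat assume m: "m \<ge> 1"
  have inf: "infinite (UNIV :: 'k set)" by (rule infinite_alg_closed_field)
  from avoiding_line[OF assms(1,2) inf] obtain a where
    "\<forall>P\<in>Z. \<forall>v\<in>P. eval3 (line a) v \<noteq> 0" ..
  then have "saturated_ideal (line a) (coord 1) (coord 2) (ideal_of_points Z) (card Z)"
    by (intro saturated_ideal_of_points[OF assms(1,2) _ inf]) blast
  then interpret saturated_ideal "line a" "coord 1" "coord 2" I "card Z"
    unfolding assms(3) .
  show "has_linear_resolution (ideal_power I m)"
  proof (rule powers_linear[OF assms(4) _ m])
    fix f t assume "f \<in> I" "homogeneous t f" "t < int (initial_degree I)"
    then show "f = 0" using initial_degree_le by fastforce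
  qed
qed

end
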